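(* Let $d\ge 1$. There is a constant $C=C(d)>0$ such that for every $d\times d$ matrix weight $W$ on $J=[0,1]$ with $[W]_{A_2}<\infty$, the matrix-weighted dyadic square function $S_W: L^2_{\mathbb{C}^d}(W)\to L^2_{\mathbb{R}}$ is bounded, with $$\|S_W\|_{L^2_{\mathbb{C}^d}(W)\to L^2_{\mathbb{R}}}\le C\,[W]_{A_2}^{1/2}\,[W^{-1}]_{A_\infty}^{1/2},\qquad\text{and}\qquad [W]_{A_2}^{1/2}\,[W^{-1}]_{A_\infty}^{1/2}\le C\,[W]_{A_2}.$$ Moreover, the resulting bound $\|S_W\|_{L^2_{\mathbb{C}^d}(W)\to L^2_{\mathbb{R}}}\le C^2\,[W]_{A_2}$ is sharp among all upper bounds of the form $\phi([W]_{A_2})$: there is a constant $c=c(d)>0$ such that, if $\phi:[1,\infty)\to[0,\infty)$ is a function with $\|S_W\|_{L^2_{\mathbb{C}^d}(W)\to L^2_{\mathbb{R}}}\le \phi([W]_{A_2})$ for every $d\times d$ matrix weight $W$ on $J$ with $[W]_{A_2}<\infty$, then $\phi(t)\ge c\,t$ for all $t\ge 1$.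
   Context: Let $J=[0,1]$ and let $\mathcal{D}$ be the collection of dyadic subintervals of $J$ (including $J$). For a (scalar-, vector- or matrix-valued) function $g$ and an interval $I$, $\langle g\rangle_I=\frac{1}{|I|}\int_I g(x)\,dx$; $\chi_I$ is the indicator function of $I$. The bracket with two arguments $\langle\cdot,\cdot\rangle_{\mathbb{C}^d}$ is the standard inner product of $\mathbb{C}^d$ and $\|\cdot\|_{\mathbb{C}^d}$ its norm; $\|\cdot\|$ of a matrix is the operator norm. A weight (matrix weight) is a $d\times d$ matrix-valued function $W$ on $J$ with integrable entries such that $W(x)$ is (Hermitian) positive semidefinite for almost every $x$. $W^{-1}$ denotes the pointwise inverse; finiteness of $[W]_{A_2}$ below includes the requirement that $W$ is invertible a.e. and that $W^{-1}$ has integrable entries. $L^2_{\mathbb{C}^d}(W)$ is the space of measurable $f:J\to\mathbb{C}^d$ with $\|f\|_{L^2_{\mathbb{C}^d}(W)}^2=\int_J\|W^{1/2}(x)f(x)\|_{\mathbb{C}^d}^2\,dx=\int_J\langle W(x)f(x),f(x)\rangle_{\mathbb{C}^d}\,dx<\infty$. $L^2_{\mathbb{R}}$ is the unweighted $L^2$ space of real-valued functions on $J$. Dyadic matrix $A_2$ characteristic: $[W]_{A_2}=\sup_{I\in\mathcal{D}}\big\|\langle W\rangle_I^{1/2}\langle W^{-1}\rangle_I^{1/2}\big\|^2$. Scalar dyadic $A_\infty$ characteristic: for a nonnegative integrable function $w$ on $J$, $[w]_{A_\infty}$ is the best constant $C$ such that $\langle M_I w\rangle_I\le C\langle w\rangle_I$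 for all $I\in\mathcal{D}$, where $M_I$ is the dyadic maximal function localized to $I$, $M_I w(x)=\sup\{\langle w\rangle_{I'}: I'\in\mathcal{D},\ x\in I'\subseteq I\}$ for $x\in I$. Dyadic matrix $A_\infty$ characteristic: $[W]_{A_\infty}=\sup_{e\in\mathbb{C}^d\setminus\{0\}}[W_e]_{A_\infty}$, where $W_e(x)=\langle W(x)e,e\rangle_{\mathbb{C}^d}$. $[W^{-1}]_{A_\infty}$ is this quantity for the weight $W^{-1}$. Haar functions: $h_I=|I|^{-1/2}(\chi_{I_+}-\chi_{I_-})$, where $I_\pm$ are the two dyadic halves of $I$. For $f:J\to\mathbb{C}^d$ integrable, $(f,h_I)=\int_J f(x)h_I(x)\,dx\in\mathbb{C}^d$. For signs $\sigma=(\sigma_I)_{I\in\mathcal{D}}$, $\sigma_I=\pm1$, let $T_\sigma f(x)=\sum_{I\in\mathcal{D}}\sigma_I (f,h_I)h_I(x)$. Matrix-weighted square function: $S_Wf(x)\ge 0$ is defined by $S_Wf(x)^2=\mathbb{E}\big(\|W(x)^{1/2}T_\sigma f(x)\|_{\mathbb{C}^d}^2\big)$, where $\mathbb{E}$ is the expectation over independent uniformly distributed random signs $\sigma_I=\pm1$; equivalently, $S_Wf(x)^2=\sum_{I\in\mathcal{D}}\|W(x)^{1/2}(f,h_I)\|_{\mathbb{C}^d}^2\frac{\chi_I(x)}{|I|}$, so that $\|S_Wf\|_{L^2_{\mathbb{R}}}^2=\sum_{I\in\mathcal{D}}\big\langle\langle W\rangle_I(f,h_I),(f,h_I)\big\rangle_{\mathbb{C}^d}$.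 $\|S_W\|_{L^2_{\mathbb{C}^d}(W)\to L^2_{\mathbb{R}}}$ is the least constant $K\in[0,\infty]$ such that $\|S_Wf\|_{L^2_{\mathbb{R}}}\le K\|f\|_{L^2_{\mathbb{C}^d}(W)}$ for all $f\in L^2_{\mathbb{C}^d}(W)$. *)

theory Defs
  imports "HOL-Probability.Probability"
begin

section \<open>Linear algebra over the complex numbers\<close>

definition cinner :: "complex ^ 'n::finite \<Rightarrow> complex ^ 'n \<Rightarrow> complex" where
  "cinner x y = (\<Sum>i\<in>UNIV. x $ i * cnj (y $ i))"

definition hermitian :: "complex ^ 'n::finite ^ 'n \<Rightarrow> bool" where
  "hermitian A \<longleftrightarrow> (\<forall>i j. A $ i $ j = cnj (A $ j $ i))"

definition psd :: "complex ^ 'n::finite ^ 'n \<Rightarrow> bool" where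
  "psd A \<longleftrightarrow> hermitian A \<and> (\<forall>x. 0 \<le> Re (cinner (A *v x) x))"

text \<open>The positive semidefinite square root; only meaningful for positive semidefinite
  arguments, for which it exists and is unique.\<close>

definition msqrt :: "complex ^ 'n::finite ^ 'n \<Rightarrow> complex ^ 'n ^ 'n" where
  "msqrt A = (THE B. psd B \<and> B ** B = A)"

definition opnorm :: "complex ^ 'n::finite ^ 'n \<Rightarrow> real" where
  "opnorm A = onorm (\<lambda>x. A *v x)"

definition esqrt :: "ennreal \<Rightarrow> ennreal" where
  "esqrt x = (if x = \<top> then \<top> else ennreal (sqrt (enn2real x)))"


section \<open>Dyadic intervals, averages and Haar functions\<close>

text \<open>Dyadic intervals are taken to be closed, so that \<open>{0..1}\<close> is itself one of them. Distinct
  intervals of the same generation may share an endpoint; all such points form a null set.\<close>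

definition dyadic_gen :: "nat \<Rightarrow> real set set" where
  "dyadic_gen n = (\<lambda>j::nat. {real j / 2 ^ n .. (real j + 1) / 2 ^ n}) ` {..<2 ^ n}"

definition dyadic :: "real set set" where
  "dyadic = (\<Union>n. dyadic_gen n)"

definition avg :: "real set \<Rightarrow> (real \<Rightarrow> 'a::{banach, second_countable_topology}) \<Rightarrow> 'a" where
  "avg I g = (1 / measure lebesgue I) *\<^sub>R (LINT x:I|lebesgue. g x)"

definition left_half :: "real set \<Rightarrow> real set" where
  "left_half I = {Inf I .. (Inf I + Sup I) / 2}"

definition right_half :: "real set \<Rightarrow> real set" where
  "right_half I = {(Inf I + Sup I) / 2 .. Sup I}"

definition haar :: "real set \<Rightarrow> real \<Rightarrow> real" where
  "haar I x = (indicator (right_half I) x - indicator (left_half I) x) / sqrt (measure lebesgue I)"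

definition haar_coeff :: "(real \<Rightarrow> complex ^ 'n::finite) \<Rightarrow> real set \<Rightarrow> complex ^ 'n" where
  "haar_coeff f I = (LINT x:{0..1}|lebesgue. haar I x *\<^sub>R f x)"


section \<open>Matrix weights and their characteristics\<close>

definition matrix_weight :: "(real \<Rightarrow> complex ^ 'n::finite ^ 'n) \<Rightarrow> bool" where
  "matrix_weight W \<longleftrightarrow>
     set_integrable lebesgue {0..1} W \<and> (AE x in lebesgue_on {0..1}. psd (W x))"

definition inv_weight :: "(real \<Rightarrow> complex ^ 'n::finite ^ 'n) \<Rightarrow> real \<Rightarrow> complex ^ 'n ^ 'n" where
  "inv_weight W x = matrix_inv (W x)"

definition A2_char :: "(real \<Rightarrow> complex ^ 'n::finite ^ 'n) \<Rightarrow> ennreal" where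
  "A2_char W =
     (if (AE x in lebesgue_on {0..1}. invertible (W x)) \<and>
         set_integrable lebesgue {0..1} (inv_weight W)
      then (SUP I\<in>dyadic. ennreal ((opnorm (msqrt (avg I W) ** msqrt (avg I (inv_weight W))))\<^sup>2))
      else \<top>)"

definition dyadic_max :: "real set \<Rightarrow> (real \<Rightarrow> real) \<Rightarrow> real \<Rightarrow> ennreal" where
  "dyadic_max I w x = (SUP I'\<in>{I'\<in>dyadic. x \<in> I' \<and> I' \<subseteq> I}. ennreal (avg I' w))"

text \<open>The left-hand average may be infinite, hence the nonnegative integral.\<close>

definition Ainf_char_scalar :: "(real \<Rightarrow> real) \<Rightarrow> ennreal" where
  "Ainf_char_scalar w =
     Inf {C::ennreal. \<forall>I\<in>dyadic.
       (\<integral>\<^sup>+x\<in>I. dyadic_max I w x \<partial>lebesgue) / emeasure lebesgue I \<le> C * ennreal (avg I w)}"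

definition Ainf_char :: "(real \<Rightarrow> complex ^ 'n::finite ^ 'n) \<Rightarrow> ennreal" where
  "Ainf_char W = (SUP e\<in>UNIV - {0}. Ainf_char_scalar (\<lambda>x. Re (cinner (W x *v e) e)))"


section \<open>The matrix-weighted square function\<close>

definition L2W_norm ::
  "(real \<Rightarrow> complex ^ 'n::finite ^ 'n) \<Rightarrow> (real \<Rightarrow> complex ^ 'n) \<Rightarrow> ennreal" where
  "L2W_norm W f = esqrt (\<integral>\<^sup>+x\<in>{0..1}. ennreal ((norm (msqrt (W x) *v f x))\<^sup>2) \<partial>lebesgue)"

definition L2W :: "(real \<Rightarrow> complex ^ 'n::finite ^ 'n) \<Rightarrow> (real \<Rightarrow> complex ^ 'n) set" where
  "L2W W = {f \<in> borel_measurable (lebesgue_on {0..1}). L2W_norm W f < \<top>}"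

text \<open>Scalar \<open>L\<^sup>2\<close> for nonnegative functions. The value infinity is allowed, so that an infinite
  square function is not silently replaced by a real number; finite norm makes it a null event.\<close>

definition L2_norm :: "(real \<Rightarrow> ennreal) \<Rightarrow> ennreal" where
  "L2_norm g = esqrt (\<integral>\<^sup>+x\<in>{0..1}. (g x)\<^sup>2 \<partial>lebesgue)"

definition L2 :: "(real \<Rightarrow> ennreal) set" where
  "L2 = {g \<in> borel_measurable (lebesgue_on {0..1}). L2_norm g < \<top>}"

definition random_signs :: "(real set \<Rightarrow> real) measure" where
  "random_signs = PiM dyadic (\<lambda>_. measure_pmf (pmf_of_set {-1, 1}))"

text \<open>The Haar series at a point is not absolutely convergent in general; it is summed
  generation by generation, i.e. as the limit of the martingale partial sums.\<close>

definition T_sigma ::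
  "(real set \<Rightarrow> real) \<Rightarrow> (real \<Rightarrow> complex ^ 'n::finite) \<Rightarrow> real \<Rightarrow> complex ^ 'n" where
  "T_sigma \<sigma> f x = (\<Sum>n. \<Sum>I\<in>dyadic_gen n. (\<sigma> I * haar I x) *\<^sub>R haar_coeff f I)"

definition square_fun ::
  "(real \<Rightarrow> complex ^ 'n::finite ^ 'n) \<Rightarrow> (real \<Rightarrow> complex ^ 'n) \<Rightarrow> real \<Rightarrow> ennreal" where
  "square_fun W f x =
     esqrt (\<integral>\<^sup>+\<sigma>. ennreal ((norm (msqrt (W x) *v T_sigma \<sigma> f x))\<^sup>2) \<partial>random_signs)"

definition square_fun_norm :: "(real \<Rightarrow> complex ^ 'n::finite ^ 'n) \<Rightarrow> ennreal" where
  "square_fun_norm W =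
     Inf {K::ennreal. \<forall>f\<in>L2W W. L2_norm (square_fun W f) \<le> K * L2W_norm W f}"

end

theory Submission
  imports Defs "HOL-Computational_Algebra.Polynomial"
begin

text \<open>
  Write \<open>V\<close> for the inverse weight and \<open>A = [W]\<close>, \<open>Q = [V]\<close> for the dyadic \<open>A\<^sub>2\<close> and \<open>A\<^sub>\<infinity>\<close> characteristics.
  Let \<open>W\<^sub>I\<close>, \<open>V\<^sub>I\<close>, \<open>F\<^sub>I\<close> be the averages of \<open>W\<close>, \<open>V\<close>, \<open>f\<close> over a dyadic interval \<open>I\<close>, and let \<open>\<Delta>X\<^sub>I\<close> be half the
  difference of the averages of \<open>X\<close> over the two halves of \<open>I\<close>. Khintchine's identity for infinite
  Rademacher series (\<open>sign_series_L2\<close>) turns the squared norm of the square function into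
  \<open>\<Sum>\<^sub>I |I| \<langle>W\<^sub>I \<Delta>F\<^sub>I, \<Delta>F\<^sub>I\<rangle>\<close>. What remains is a question about martingales on the binary tree, and it is
  answered at every finite depth with bounds that do not depend on the depth.

  \<^bold>\<open>The upper bound.\<close> Put \<open>u\<^sub>I = V\<^sub>I\<^sup>-\<^sup>1 F\<^sub>I\<close> and split \<open>\<Delta>F = (\<Delta>F - \<Delta>V u) + \<Delta>V u\<close>. The first part is controlled by
  the convexity defects of \<open>\<langle>V\<^sup>-\<^sup>1 F, F\<rangle>\<close>, whose sum telescopes; passing from \<open>V\<^sub>I\<^sup>-\<^sup>1\<close> to \<open>W\<^sub>I\<close> costs one factor \<open>A\<close>
  (\<open>inverse_form_defect\<close>). The second part is a Carleson embedding with matrix coefficients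
  \<open>a\<^sub>I = \<Delta>V W\<^sub>I \<Delta>V\<close>. For it, the Bellman function \<open>\<langle>(V + s M)\<^sup>-\<^sup>1 F, F\<rangle>\<close> of Culiuc and Treil, where \<open>M\<close>
  accumulates the \<open>a\<^sub>I\<close>, controls \<open>\<langle>a\<^sub>I x, x\<rangle>\<close> at \<open>x = (V + s M)\<^sup>-\<^sup>1 F\<close> for every \<open>s > 0\<close>. By Cramer's rule
  \<open>det (V + s M) (V + s M)\<^sup>-\<^sup>1 F\<close> is a polynomial in \<open>s\<close> of degree at most \<open>d\<close>, so \<open>V\<^sup>-\<^sup>1 F\<close> is a combination
  of its values at \<open>d + 1\<close> positive points, with coefficients bounded in terms of \<open>d\<close>
  (\<open>interp_const_exists\<close>, \<open>embedding_tree\<close>).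

  The embedding needs the Carleson condition \<open>\<Sum>\<^bsub>I \<subseteq> J\<^esub> |I| \<langle>a\<^sub>I e, e\<rangle> \<le> C A Q |J| \<langle>V\<^sub>J e, e\<rangle>\<close>, which is the
  square function estimate for the test functions \<open>V e\<close> on \<open>J\<close>. It follows from a sparse argument
  (\<open>testing_tree\<close>): below an interval \<open>L\<close> one stops as soon as \<open>W\<close>, \<open>V\<close> measured in the form \<open>W\<^sub>L\<close>, or \<open>\<langle>V e, e\<rangle>\<close>
  has become too large compared with its average over \<open>L\<close>. Before stopping, the sum is a bounded martingale
  sum and contributes \<open>A |L| \<langle>V\<^sub>L e, e\<rangle>\<close>. The stopped intervals cover at most half of \<open>L\<close>, so these
  contributions add up to the integral of the maximal function of \<open>\<langle>V e, e\<rangle>\<close>, that is, to \<open>Q |J| \<langle>V\<^sub>J e, e\<rangle>\<close>.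

  The bound \<open>Q \<le> 5/2 A\<close> is Doob's inequality in \<open>L\<^sup>2(1/v)\<close> for the scalar weights \<open>v = \<langle>V e, e\<rangle>\<close>, whose
  \<open>A\<^sub>2\<close> characteristic is at most \<open>A\<close> (\<open>tmax_le_5_2_A2\<close>, \<open>tmax_v_le\<close>).

  \<^bold>\<open>Sharpness.\<close> Let \<open>v\<close> be \<open>r\<^sup>k\<close> on the interval from \<open>2\<^sup>-\<^sup>k\<^sup>-\<^sup>1\<close> to \<open>2\<^sup>-\<^sup>k\<close>, with \<open>1 \<le> r < 2\<close>, and let \<open>W\<close> be \<open>1/v\<close>
  times the identity. By self-similarity the \<open>A\<^sub>2\<close> characteristic is exactly \<open>r / ((2 - r) (2 r - 1))\<close>,
  which takes every value \<open>t \<ge> 1\<close>, and the test function \<open>v e\<close> on the left half of the unit interval shows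
  that the norm is at least \<open>t/2\<close> (\<open>step_weight_A2\<close>, \<open>step_weight_lower_bound\<close>).
\<close>

section \<open>Hermitian forms as real inner products\<close>

text \<open>The real part of the complex inner product is the real inner product of the underlying real
  space. All quadratic forms below are therefore written with \<open>\<bullet>\<close>, and Hermitian matrices are used as
  real symmetric operators.\<close>

lemma Re_cinner: "Re (cinner x y) = x \<bullet> y"
  unfolding cinner_def inner_vec_def by (simp add: inner_complex_def)

lemma scaleR_matrix_vector: "(r *\<^sub>R A) *v x = r *\<^sub>R (A *v x)"
  for A :: "complex^'n::finite^'m::finite"
  by (simp add: matrix_vector_mult_def vec_eq_iff scaleR_sum_right)

lemma matrix_vector_scaleR: "A *v (r *\<^sub>R x) = r *\<^sub>R (A *v x)"
  for A :: "complex^'n::finite^'m::finite"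
  by (simp add: matrix_vector_mult_def vec_eq_iff scaleR_sum_right)

lemma linear_matrix_vector: "linear ((*v) A)"
  for A :: "complex^'n::finite^'m::finite"
  by (intro linearI) (simp_all add: matrix_vector_right_distrib matrix_vector_scaleR)

lemmas matrix_vector_simps =
  matrix_vector_right_distrib matrix_vector_mult_diff_distrib
  matrix_vector_mult_add_rdistrib matrix_vector_mult_diff_rdistrib
  scaleR_matrix_vector matrix_vector_scaleR

definition adj :: "complex^'n::finite^'n \<Rightarrow> complex^'n^'n" where
  "adj A = (\<chi> i j. cnj (A $ j $ i))"

lemma hermitian_iff_adj: "hermitian A \<longleftrightarrow> adj A = A"
  unfolding hermitian_def adj_def vec_eq_iff vec_lambda_beta by metis

lemma adj_mult: "adj (A ** B) = adj B ** adj A"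
  by (simp add: adj_def matrix_matrix_mult_def vec_eq_iff mult.commute)

lemma inner_adj: "(A *v x) \<bullet> y = x \<bullet> (adj A *v y)"
proof -
  have "cinner (A *v x) y = cinner x (adj A *v y)"
    unfolding cinner_def matrix_vector_mult_def adj_def
    by (simp add: sum_distrib_left sum_distrib_right mult_ac) (rule sum.swap)
  then show ?thesis by (metis Re_cinner)
qed

lemma hermitian_inner: "hermitian A \<Longrightarrow> (A *v x) \<bullet> y = x \<bullet> (A *v y)"
  using inner_adj[of A x y] by (simp add: hermitian_iff_adj)

lemma psd_iff: "psd A \<longleftrightarrow> hermitian A \<and> (\<forall>x. 0 \<le> (A *v x) \<bullet> x)"
  by (simp add: psd_def Re_cinner)

lemma hermitian_add: "hermitian A \<Longrightarrow> hermitian B \<Longrightarrow> hermitian (A + B)"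
  unfolding hermitian_iff_adj by (simp add: adj_def vec_eq_iff)

lemma hermitian_diff: "hermitian A \<Longrightarrow> hermitian B \<Longrightarrow> hermitian (A - B)"
  unfolding hermitian_iff_adj by (simp add: adj_def vec_eq_iff)

lemma hermitian_scaleR: "hermitian A \<Longrightarrow> hermitian (r *\<^sub>R A)"
  unfolding hermitian_iff_adj by (simp add: adj_def vec_eq_iff)

lemma hermitian_0: "hermitian 0" and hermitian_1: "hermitian (mat 1)"
  by (auto simp: hermitian_def mat_def)

lemma hermitian_conjugate: "hermitian A \<Longrightarrow> hermitian B \<Longrightarrow> hermitian (B ** A ** B)"
  by (simp add: hermitian_iff_adj adj_mult matrix_mul_assoc)

lemma psd_hermitian: "psd A \<Longrightarrow> hermitian A"
  and psd_nonneg: "psd A \<Longrightarrow> 0 \<le> (A *v x) \<bullet> x"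
  by (auto simp: psd_iff)

lemma psd_inner: "psd A \<Longrightarrow> (A *v x) \<bullet> y = (A *v y) \<bullet> x"
  by (metis hermitian_inner psd_hermitian inner_commute)

lemma psd_add: "psd A \<Longrightarrow> psd B \<Longrightarrow> psd (A + B)"
  by (auto simp: psd_iff hermitian_add matrix_vector_simps inner_add_left)

lemma psd_scaleR: "psd A \<Longrightarrow> 0 \<le> r \<Longrightarrow> psd (r *\<^sub>R A)"
  by (auto simp: psd_iff hermitian_scaleR matrix_vector_simps)

lemma psd_0: "psd 0" and psd_1: "psd (mat 1)"
  by (auto simp: psd_iff hermitian_0 hermitian_1)

lemma conjugate_form: "hermitian B \<Longrightarrow> ((B ** A ** B) *v x) \<bullet> y = (A *v (B *v x)) \<bullet> (B *v y)"
  by (metis hermitian_inner matrix_vector_mul_assoc)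

lemma psd_conjugate: "psd A \<Longrightarrow> hermitian B \<Longrightarrow> psd (B ** A ** B)"
  by (simp add: psd_iff hermitian_conjugate conjugate_form)

lemma psd_quad_le: "psd A \<Longrightarrow> (A *v (x + y)) \<bullet> (x + y) \<le> 2 * ((A *v x) \<bullet> x) + 2 * ((A *v y) \<bullet> y)"
  using psd_nonneg[of A "x - y"] psd_inner[of A x y]
  by (simp add: matrix_vector_simps inner_simps)

lemma psd_cauchy_schwarz:
  assumes "psd A"
  shows "((A *v x) \<bullet> y)\<^sup>2 \<le> ((A *v x) \<bullet> x) * ((A *v y) \<bullet> y)"
proof -
  define a b c where "a = (A *v x) \<bullet> x" and "b = (A *v x) \<bullet> y" and "c = (A *v y) \<bullet> y"
  have nn: "0 \<le> a + 2 * t * b + t\<^sup>2 * c" for t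
    using psd_nonneg[OF assms, of "x + t *\<^sub>R y"] psd_inner[OF assms, of x y]
    by (simp add: matrix_vector_simps inner_simps a_def b_def c_def power2_eq_square algebra_simps)
  have c0: "0 \<le> c" using psd_nonneg[OF assms] by (simp add: c_def)
  have "b\<^sup>2 \<le> a * c"
  proof (cases "c = 0")
    case True
    have "b = 0"
    proof (rule ccontr)
      assume "b \<noteq> 0"
      then show False using nn[of "- (a + 1) / (2 * b)"] True by (simp add: field_simps)
    qed
    then show ?thesis using True by simp
  next
    case False
    then have "0 \<le> c * (a + 2 * (- b / c) * b + (- b / c)\<^sup>2 * c)"
      using nn[of "- b / c"] c0 by (intro mult_nonneg_nonneg) auto
    also have "\<dots> = a * c - b\<^sup>2" using False by (simp add: power2_eq_square field_simps)
    finally show ?thesis by simp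
  qed
  then show ?thesis by (simp add: a_def b_def c_def)
qed

lemma psd_kernel: "psd A \<Longrightarrow> (A *v x) \<bullet> x = 0 \<Longrightarrow> A *v x = 0"
  using psd_cauchy_schwarz[of A x "A *v x"] by simp

lemma matrix_eq_0I: "(\<And>x. A *v x = 0) \<Longrightarrow> A = (0::complex^'n::finite^'n)"
  by (metis matrix_eq matrix_vector_mult_0)

lemma matrix_mult_diff_right: "A ** (B - C) = A ** B - A ** C"
  and matrix_mult_diff_left: "(B - C) ** A = B ** A - C ** A"
  and matrix_mult_zero_right: "A ** 0 = 0"
  for A B C :: "complex^'n::finite^'n"
  by (simp_all add: matrix_matrix_mult_def vec_eq_iff algebra_simps sum_subtractf)

section \<open>The positive square root\<close>

lemma matrix_vector_axis: "(A *v axis i 1) $ k = A $ k $ i"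
  for A :: "complex^'n::finite^'n"
  by (simp add: matrix_vector_mult_def axis_def if_distrib cong: if_cong)

lemma Re_trace: "Re (trace A) = (\<Sum>i\<in>UNIV. (A *v axis i 1) \<bullet> axis i 1)"
proof -
  have "(A *v axis i 1) \<bullet> axis i 1 = Re (A $ i $ i)" for i
    by (simp add: inner_axis matrix_vector_axis)
  then show ?thesis by (simp add: trace_def)
qed

lemma psd_trace_0:
  assumes "psd A" "Re (trace A) = 0"
  shows "A = 0"
proof -
  have "(A *v axis i 1) \<bullet> axis i 1 = 0" for i
    using assms unfolding Re_trace
    by (subst (asm) sum_nonneg_eq_0_iff) (auto simp: psd_nonneg)
  then have "A *v axis i 1 = 0" for i by (rule psd_kernel[OF assms(1)])
  then show ?thesis by (metis matrix_vector_axis vec_eq_iff zero_index)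
qed

text \<open>If \<open>B\<close> and \<open>C\<close> are two square roots and \<open>D = B - C\<close>, then \<open>B ** D + D ** C = 0\<close>; multiplying by
  \<open>D\<close> and taking traces gives \<open>trace (D ** B ** D) + trace (D ** C ** D) = 0\<close>, a sum of two
  nonnegative terms, so both vanish and \<open>D ** D ** D = 0\<close>.\<close>

lemma psd_sqrt_unique:
  assumes B: "psd B" and C: "psd C" and eq: "B ** B = C ** C"
  shows "B = C"
proof -
  define D where "D = B - C"
  have hD: "hermitian D" using B C by (simp add: D_def hermitian_diff psd_hermitian)
  have "B ** D + D ** C = 0"
    using eq by (simp add: D_def matrix_mult_diff_right matrix_mult_diff_left)
  then have "D ** B ** D + D ** D ** C = 0"
    using matrix_add_ldistrib[of D "B ** D" "D ** C"] by (simp add: matrix_mul_assoc matrix_mult_zero_right)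
  then have "trace (D ** B ** D) + trace (D ** D ** C) = 0"
    by (simp add: trace_def vec_eq_iff flip: sum.distrib)
  moreover have "trace (D ** D ** C) = trace (D ** C ** D)"
    by (metis matrix_mul_assoc trace_mul_sym)
  ultimately have "Re (trace (D ** B ** D)) + Re (trace (D ** C ** D)) = 0"
    by (metis plus_complex.sel(1) zero_complex.sel(1))
  moreover have p: "psd (D ** B ** D)" "psd (D ** C ** D)" using B C hD psd_conjugate by blast+
  moreover have "0 \<le> Re (trace (D ** B ** D))" "0 \<le> Re (trace (D ** C ** D))"
    unfolding Re_trace using p by (auto intro!: sum_nonneg psd_nonneg)
  ultimately have z: "D ** B ** D = 0" "D ** C ** D = 0"
    by (auto intro!: psd_trace_0)
  have "D ** (B - C) ** D = 0"
    by (simp add: matrix_mult_diff_right matrix_mult_diff_left z)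
  then have D3: "D ** D ** D = 0" by (simp add: D_def)
  have "D *v (D *v x) = 0" for x
  proof -
    have "(D *v (D *v x)) \<bullet> (D *v (D *v x)) = (D *v (D *v (D *v x))) \<bullet> (D *v x)"
      by (metis hD hermitian_inner inner_commute)
    also have "\<dots> = 0" by (simp add: matrix_vector_mul_assoc D3 matrix_mul_assoc)
    finally show ?thesis by simp
  qed
  then have "(D *v x) \<bullet> (D *v x) = 0" for x
    by (metis hD hermitian_inner inner_zero_right)
  then show ?thesis by (metis D_def eq_iff_diff_eq_0 inner_eq_zero_iff matrix_eq_0I)
qed

definition outer :: "complex^'n::finite \<Rightarrow> complex^'n^'n" where
  "outer v = (\<chi> i j. v $ i * cnj (v $ j))"

lemma outer_mult: "outer v *v x = cinner x v *s v"
  by (simp add: outer_def matrix_vector_mult_def cinner_def vec_eq_iff sum_distrib_left mult_ac)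

lemma outer_form: "(outer v *v x) \<bullet> x = (cmod (cinner x v))\<^sup>2"
proof -
  have "cinner (outer v *v x) x = cinner x v * cinner v x"
    unfolding outer_mult cinner_def[of "_ *s _"] cinner_def[of v x]
    by (simp add: sum_distrib_left mult.assoc)
  also have "cinner v x = cnj (cinner x v)" by (simp add: cinner_def mult.commute)
  finally show ?thesis by (metis Re_cinner Re_complex_of_real complex_norm_square)
qed

lemma psd_outer: "psd (outer v)"
  unfolding psd_iff by (auto simp: outer_form) (simp add: hermitian_def outer_def)

text \<open>A maximizer \<open>v\<close> of the form on the unit sphere makes the positive semidefinite form of
  \<open>l - A\<close> vanish at \<open>v\<close>, and a zero of such a form lies in the kernel.\<close>

lemma psd_top_eigenvector:
  assumes "psd A"
  obtains v l where "norm v = 1" "0 \<le> l" "A *v v = l *\<^sub>R v" "\<And>x. (A *v x) \<bullet> x \<le> l * (x \<bullet> x)"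
proof -
  have ne: "sphere (0::complex^'n) 1 \<noteq> {}" 
    using vector_choose_size[of 1, where 'a="complex^'n"] by (metis empty_iff mem_sphere_0 zero_le_one)
  have "continuous_on (sphere 0 1) (\<lambda>x. (A *v x) \<bullet> x)"
    using linear_continuous_on[OF linear_conv_bounded_linear[THEN iffD1, OF linear_matrix_vector]]
    by (intro continuous_intros)
  then obtain v where v: "v \<in> sphere 0 1" and mx: "\<And>x. x \<in> sphere 0 1 \<Longrightarrow> (A *v x) \<bullet> x \<le> (A *v v) \<bullet> v"
    using continuous_attains_sup[OF compact_sphere ne] by blast
  define l where "l = (A *v v) \<bullet> v"
  have bd: "(A *v x) \<bullet> x \<le> l * (x \<bullet> x)" for x
  proof (cases "x = 0")
    case False
    have "(A *v (x /\<^sub>R norm x)) \<bullet> (x /\<^sub>R norm x) \<le> l" using mx[of "x /\<^sub>R norm x"] False l_def by simp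
    then have "((A *v x) \<bullet> x) / (norm x)\<^sup>2 \<le> l"
      by (simp add: matrix_vector_scaleR[of _ "inverse (norm x)"] power2_eq_square divide_inverse mult_ac)
    then show ?thesis using False by (simp add: divide_le_eq power2_norm_eq_inner)
  qed auto
  have vv: "v \<bullet> v = 1" using v by (simp add: power2_norm_eq_inner[symmetric])
  have "psd (l *\<^sub>R mat 1 - A)"
    using assms bd by (auto simp: psd_iff hermitian_diff hermitian_scaleR hermitian_1 matrix_vector_simps inner_diff_left)
  then have "(l *\<^sub>R mat 1 - A) *v v = 0"
    by (rule psd_kernel) (simp add: matrix_vector_simps inner_diff_left vv l_def)
  then have "A *v v = l *\<^sub>R v" by (simp add: matrix_vector_simps)
  moreover have "0 \<le> l" using psd_nonneg[OF assms] by (simp add: l_def)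
  ultimately show ?thesis using that[of v l] v bd by auto
qed

text \<open>Splitting off the top eigenvector: \<open>A - l vv\<^sup>*\<close> is again positive semidefinite and has a strictly
  larger kernel.\<close>

lemma psd_sqrt_exists:
  fixes A :: "complex^'n::finite^'n"
  assumes "psd A"
  shows "\<exists>B. psd B \<and> B ** B = A"
  using assms
proof (induction "DIM(complex^'n) - dim {x. A *v x = 0}" arbitrary: A rule: less_induct)
  case (less A)
  obtain v l where v: "norm v = 1" "0 \<le> l" "A *v v = l *\<^sub>R v"
    and top: "\<And>x. (A *v x) \<bullet> x \<le> l * (x \<bullet> x)" using psd_top_eigenvector[OF less.prems] by metis
  show ?case
  proof (cases "l = 0")
    case True
    then have "(A *v x) \<bullet> x = 0" for x
      using top[of x] psd_nonneg[OF less.prems, of x] by simp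
    then have "A = 0" using matrix_eq_0I psd_kernel[OF less.prems] by blast
    then show ?thesis using psd_0 by (metis matrix_mult_zero_right)
  next
    case False
    define A' where "A' = A - l *\<^sub>R outer v"
    have vv: "cinner v v = 1"
    proof -
      have "cinner v v = of_real (\<Sum>i\<in>UNIV. (cmod (v $ i))\<^sup>2)"
        unfolding cinner_def complex_norm_square of_real_sum by simp
      also have "(\<Sum>i\<in>UNIV. (cmod (v $ i))\<^sup>2) = (norm v)\<^sup>2"
        by (simp add: norm_vec_def L2_set_def sum_nonneg)
      finally show ?thesis using v by simp
    qed
    have A'v: "A' *v v = 0"
      by (simp add: A'_def matrix_vector_simps v outer_mult vv)
    have hA': "hermitian A'" using less.prems
      by (simp add: A'_def hermitian_diff hermitian_scaleR psd_hermitian psd_outer)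
    have A'pos: "0 \<le> (A' *v x) \<bullet> x" for x
    proof -
      define c where "c = cinner x v"
      define y where "y = x - c *s v"
      have yv: "cinner y v = 0"
        unfolding y_def using vv by (simp add: cinner_def sum_subtractf c_def left_diff_distrib mult.assoc flip: sum_distrib_left)
      have z: "A' *v (c *s v) = 0" using A'v by (simp add: vector_scalar_commute)
      have x: "x = y + c *s v" by (simp add: y_def)
      have "(A' *v x) \<bullet> x = (A' *v y) \<bullet> y"
        by (subst (1 2) x) (simp add: matrix_vector_simps z inner_simps hermitian_inner[OF hA', of y "c *s v"])
      also have "\<dots> = (A *v y) \<bullet> y"
        by (simp add: A'_def matrix_vector_simps outer_mult yv)
      finally show ?thesis using psd_nonneg[OF less.prems] by simp
    qed
    have pA': "psd A'" using hA' A'pos by (simp add: psd_iff)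
    have sub: "subspace {x. B *v x = 0}" for B :: "complex^'n^'n"
      by (auto simp: subspace_def matrix_vector_simps)
    have "{x. A *v x = 0} \<subset> {x. A' *v x = 0}"
    proof
      show "{x. A *v x = 0} \<subseteq> {x. A' *v x = 0}"
      proof safe
        fix x assume x: "A *v x = 0"
        have "(A' *v x) \<bullet> x \<le> 0" using x v by (simp add: A'_def matrix_vector_simps inner_diff_left outer_form)
        then show "A' *v x = 0" using A'pos[of x] psd_kernel[OF pA', of x] by simp
      qed
      have "v \<notin> {x. A *v x = 0}" using v False by auto
      then show "{x. A *v x = 0} \<noteq> {x. A' *v x = 0}" using A'v by blast
    qed
    then have "dim {x. A *v x = 0} < dim {x. A' *v x = 0}"
      using dim_psubset sub by (metis span_eq_iff)
    moreover have "dim {x. A' *v x = 0} \<le> DIM(complex^'n)" by (rule dim_subset_UNIV)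
    ultimately obtain B' where B': "psd B'" "B' ** B' = A'" using less.hyps[OF _ pA'] by fastforce
    have "(B' *v v) \<bullet> (B' *v v) = (A' *v v) \<bullet> v"
      by (metis B' hermitian_inner inner_commute matrix_vector_mul_assoc psd_hermitian)
    then have B'v: "B' *v v = 0" using A'v by simp
    define B where "B = B' + sqrt l *\<^sub>R outer v"
    have "psd B" using B' v by (simp add: B_def psd_add psd_scaleR psd_outer)
    moreover have "B ** B = A"
    proof (subst matrix_eq, intro allI)
      fix x
      have Bo: "B' *v (c *s v) = 0" for c using B'v by (simp add: vector_scalar_commute)
      have oB: "outer v ** B' = 0"
      proof -
        have "adj (outer v ** B') = B' ** outer v"
          using B' psd_outer[of v] by (simp add: adj_mult hermitian_iff_adj psd_iff)
        moreover have "B' ** outer v = 0"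
          by (rule matrix_eq_0I) (simp add: matrix_vector_mul_assoc[symmetric] outer_mult Bo)
        ultimately have "adj (adj (outer v ** B')) = 0" by (simp add: adj_def vec_eq_iff)
        then show ?thesis by (simp add: adj_def vec_eq_iff)
      qed
      have Bo': "B' ** outer v = 0"
        by (rule matrix_eq_0I) (simp add: matrix_vector_mul_assoc[symmetric] outer_mult Bo)
      have oo: "outer v *v (outer v *v x) = outer v *v x"
        by (simp add: outer_mult cinner_def mult.assoc flip: sum_distrib_left)
           (simp add: vv[unfolded cinner_def])
      have "(B ** B) *v x = B *v (B *v x)" by (simp add: matrix_vector_mul_assoc)
      also have "\<dots> = A' *v x + l *\<^sub>R (outer v *v x)"
        using v B'(2)
        by (simp add: B_def matrix_vector_simps oo)
           (simp add: oB Bo' matrix_vector_mul_assoc)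
      also have "\<dots> = A *v x" by (simp add: A'_def matrix_vector_simps)
      finally show "(B ** B) *v x = A *v x" .
    qed
    ultimately show ?thesis by blast
  qed
qed

lemma msqrt_psd: "psd A \<Longrightarrow> psd (msqrt A)"
  and msqrt_square: "psd A \<Longrightarrow> msqrt A ** msqrt A = A"
proof -
  assume "psd A"
  then obtain B where B: "psd B \<and> B ** B = A" using psd_sqrt_exists by blast
  have "psd (msqrt A) \<and> msqrt A ** msqrt A = A"
    unfolding msqrt_def by (rule theI[where a=B]) (use B psd_sqrt_unique in blast)+
  then show "psd (msqrt A)" "msqrt A ** msqrt A = A" by auto
qed

lemma msqrt_hermitian: "psd A \<Longrightarrow> hermitian (msqrt A)"
  by (simp add: msqrt_psd psd_hermitian)

lemma msqrt_inner: "psd A \<Longrightarrow> (msqrt A *v x) \<bullet> (msqrt A *v y) = (A *v x) \<bullet> y"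
  by (metis hermitian_inner inner_commute matrix_vector_mul_assoc msqrt_hermitian msqrt_square)

lemma norm_msqrt: "psd A \<Longrightarrow> (norm (msqrt A *v x))\<^sup>2 = (A *v x) \<bullet> x"
  by (simp add: power2_norm_eq_inner msqrt_inner)

section \<open>Positive definite matrices\<close>

definition pd :: "complex^'n::finite^'n \<Rightarrow> bool" where
  "pd A \<longleftrightarrow> psd A \<and> (\<forall>x. x \<noteq> 0 \<longrightarrow> 0 < (A *v x) \<bullet> x)"

lemma pd_psd: "pd A \<Longrightarrow> psd A" and pd_pos: "pd A \<Longrightarrow> x \<noteq> 0 \<Longrightarrow> 0 < (A *v x) \<bullet> x"
  by (auto simp: pd_def)

lemma pd_add_psd: "pd A \<Longrightarrow> psd B \<Longrightarrow> pd (A + B)"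
  unfolding pd_def using psd_nonneg[of B]
  by (auto simp: psd_add matrix_vector_simps inner_add_left intro: add_pos_nonneg)

lemma pd_inj: "pd A \<Longrightarrow> A *v x = A *v y \<Longrightarrow> x = y"
  using pd_pos[of A "x - y"] by (auto simp: matrix_vector_simps)

lemma pd_solve: "pd A \<Longrightarrow> \<exists>u. A *v u = y"
  using linear_inj_imp_surj[OF linear_matrix_vector[of A]] pd_inj[of A]
  by (metis injI surjD)

definition solve :: "complex^'n::finite^'n \<Rightarrow> complex^'n \<Rightarrow> complex^'n" where
  "solve A y = (SOME u. A *v u = y)"

lemma solve: "pd A \<Longrightarrow> A *v solve A y = y"
  unfolding solve_def using pd_solve[of A y] by (metis (mono_tags) someI_ex)

text \<open>The inequality behind \<open>\<langle>P\<^sup>-\<^sup>1 y, y\<rangle> = sup\<^sub>z (2 \<langle>y, z\<rangle> - \<langle>P z, z\<rangle>)\<close>; it replaces all computations with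
  the inverses of averages.\<close>

lemma psd_variational:
  assumes "psd P" "P *v x = y"
  shows "2 * (y \<bullet> z) - (P *v z) \<bullet> z \<le> y \<bullet> x"
  using psd_nonneg[OF assms(1), of "x - z"] psd_inner[OF assms(1), of x z] assms(2)
  by (simp add: matrix_vector_simps inner_simps)

lemma matrix_inverse_of_inj:
  fixes A :: "complex^'n::finite^'n"
  assumes "\<And>x. A *v x = 0 \<Longrightarrow> x = 0"
  obtains B where "A ** B = mat 1" "B ** A = mat 1"
proof -
  have "inj ((*v) A)" by (rule injI) (metis assms eq_iff_diff_eq_0 matrix_vector_mult_diff_distrib)
  then have "invertible A"
    using matrix_left_invertible_injective[of A] invertible_left_inverse by blast
  then show ?thesis using that invertible_def by blast
qed

text \<open>A change of variables by this inverse root turns \<open>V\<close> into the identity.\<close>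

lemma pd_sqrt_inverse:
  assumes "pd V"
  obtains Ri where "hermitian Ri" "msqrt V ** Ri = mat 1" "Ri ** msqrt V = mat 1"
proof -
  have V: "psd V" using assms by (simp add: pd_def)
  have "x = 0" if "msqrt V *v x = 0" for x
    using norm_msqrt[OF V, of x] pd_pos[OF assms, of x] that by fastforce
  then obtain Ri where Ri: "msqrt V ** Ri = mat 1" "Ri ** msqrt V = mat 1"
    using matrix_inverse_of_inj by metis
  have "adj (msqrt V ** Ri) = mat 1" by (simp add: Ri adj_def mat_def vec_eq_iff)
  then have "adj Ri ** msqrt V = mat 1"
    using msqrt_hermitian[OF V] by (simp add: adj_mult hermitian_iff_adj)
  then have "adj Ri = Ri"
    by (metis Ri(1) matrix_mul_assoc matrix_mul_lid matrix_mul_rid)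
  then show ?thesis using that Ri by (simp add: hermitian_iff_adj)
qed

lemma psd_norm_le:
  assumes "psd N" "\<And>x. (N *v x) \<bullet> x \<le> x \<bullet> x"
  shows "norm (N *v x) \<le> norm x"
proof -
  have "((N *v x) \<bullet> (N *v x))\<^sup>2 \<le> ((N *v x) \<bullet> x) * ((N *v (N *v x)) \<bullet> (N *v x))"
    by (rule psd_cauchy_schwarz[OF assms(1)])
  also have "\<dots> \<le> (x \<bullet> x) * ((N *v x) \<bullet> (N *v x))"
    by (intro mult_mono assms(2) psd_nonneg[OF assms(1)]) auto
  finally have "((N *v x) \<bullet> (N *v x)) \<le> x \<bullet> x"
    by (metis inner_gt_zero_iff inner_zero_left less_eq_real_def mult_le_cancel_right_pos power2_eq_square inner_ge_zero)
  then show ?thesis by (simp add: norm_le)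
qed

section \<open>Interpolation of inverses\<close>

lemma lagrange_at_0:
  fixes s :: "nat \<Rightarrow> complex"
  assumes "inj_on s {..d}"
  shows "\<exists>L. \<forall>p. degree p \<le> d \<longrightarrow> poly p 0 = (\<Sum>j\<le>d. L j * poly p (s j))"
proof -
  define l where "l j = smult (inverse (\<Prod>i\<in>{..d}-{j}. s j - s i)) (\<Prod>i\<in>{..d}-{j}. [:- s i, 1:])" for j
  have ls: "poly (l j) (s k) = (if j = k then 1 else 0)" if "j \<le> d" "k \<le> d" for j k
  proof (cases "j = k")
    case True
    have "(\<Prod>i\<in>{..d}-{j}. s j - s i) \<noteq> 0" using assms that by (auto simp: inj_on_def)
    then show ?thesis using True by (simp add: l_def poly_prod)
  next
    case False
    then have "(\<Prod>i\<in>{..d}-{j}. s k - s i) = 0" using that by auto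
    then show ?thesis using False by (simp add: l_def poly_prod)
  qed
  have dl: "degree (l j) \<le> d" if "j \<le> d" for j
  proof -
    have "degree (\<Prod>i\<in>{..d}-{j}. [:- s i, 1:]) \<le> sum (degree \<circ> (\<lambda>i. [:- s i, 1:])) ({..d}-{j})"
      by (rule degree_prod_sum_le) auto
    also have "\<dots> = d" using that by simp
    finally show ?thesis unfolding l_def using degree_smult_le le_trans by blast
  qed
  have "poly p 0 = (\<Sum>j\<le>d. poly (l j) 0 * poly p (s j))" if p: "degree p \<le> d" for p
  proof -
    define q where "q = p - (\<Sum>j\<le>d. smult (poly p (s j)) (l j))"
    have "degree (\<Sum>j\<le>d. smult (poly p (s j)) (l j)) \<le> d"
    proof (rule degree_sum_le)
      show "degree (smult (poly p (s j)) (l j)) \<le> d" if "j \<in> {..d}" for j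
        using degree_smult_le[of "poly p (s j)" "l j"] dl[of j] that by simp
    qed simp
    then have dq: "degree q \<le> d" using p unfolding q_def by (rule degree_diff_le[rotated])
    have "poly q (s k) = 0" if "k \<le> d" for k
      using that by (simp add: q_def poly_sum ls if_distrib cong: if_cong)
    then have sub: "s ` {..d} \<subseteq> {x. poly q x = 0}" by auto
    have "q = 0"
    proof (rule ccontr)
      assume "q \<noteq> 0"
      then have "card (s ` {..d}) \<le> degree q"
        using card_mono[OF poly_roots_finite sub] card_poly_roots_bound[of q] by simp
      then show False using dq by (simp add: card_image assms)
    qed
    then have "p = (\<Sum>j\<le>d. smult (poly p (s j)) (l j))" by (simp add: q_def)
    then have "poly p 0 = poly (\<Sum>j\<le>d. smult (poly p (s j)) (l j)) 0" by simp
    then show ?thesis by (simp add: poly_sum mult.commute)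
  qed
  then show ?thesis by (intro exI[of _ "\<lambda>j. poly (l j) 0"]) blast
qed

text \<open>Each term of the Leibniz formula is a product of one affine function of \<open>z\<close> per row.\<close>

lemma det_affine_poly:
  fixes A B :: "complex^'n::finite^'n"
  shows "\<exists>p. degree p \<le> CARD('n) \<and> (\<forall>z. poly p z = det (\<chi> i j. A $ i $ j + z * B $ i $ j))"
proof -
  define p where "p = (\<Sum>\<pi> | \<pi> permutes (UNIV::'n set). of_int (sign \<pi>) * (\<Prod>i\<in>UNIV. [:A $ i $ \<pi> i, B $ i $ \<pi> i:]))"
  have "degree p \<le> CARD('n)"
    unfolding p_def
  proof (rule degree_sum_le)
    fix \<pi> assume "\<pi> \<in> {\<pi>. \<pi> permutes (UNIV::'n set)}"
    have "degree (\<Prod>i\<in>UNIV. [:A $ i $ \<pi> i, B $ i $ \<pi> i:]) \<le> sum (degree \<circ> (\<lambda>i. [:A $ i $ \<pi> i, B $ i $ \<pi> i:])) UNIV"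
      by (rule degree_prod_sum_le) auto
    also have "\<dots> \<le> (\<Sum>i\<in>(UNIV::'n set). 1)" by (intro sum_mono) auto
    finally have "degree (\<Prod>i\<in>UNIV. [:A $ i $ \<pi> i, B $ i $ \<pi> i:]) \<le> CARD('n)" by simp
    then show "degree (of_int (sign \<pi>) * (\<Prod>i\<in>UNIV. [:A $ i $ \<pi> i, B $ i $ \<pi> i:])) \<le> CARD('n)"
      by (intro order_trans[OF degree_mult_le]) simp
  qed auto
  moreover have "poly p z = det (\<chi> i j. A $ i $ j + z * B $ i $ j)" for z
    by (simp add: p_def det_def poly_sum poly_prod)
  ultimately show ?thesis by blast
qed

lemma cmod_det_le:
  fixes X :: "complex^'n::finite^'n"
  assumes "\<And>i j. cmod (X $ i $ j) \<le> b"
  shows "cmod (det X) \<le> real (card {\<pi>. \<pi> permutes (UNIV::'n set)}) * b ^ CARD('n)"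
proof -
  have "cmod (det X) \<le> (\<Sum>\<pi> | \<pi> permutes (UNIV::'n set). b ^ CARD('n))"
    unfolding det_def
  proof (rule sum_norm_le)
    fix \<pi> assume "\<pi> \<in> {\<pi>. \<pi> permutes (UNIV::'n set)}"
    have "cmod (of_int (sign \<pi>) * (\<Prod>i\<in>UNIV. X $ i $ \<pi> i)) = (\<Prod>i\<in>UNIV. cmod (X $ i $ \<pi> i))"
      by (simp add: norm_mult prod_norm sign_def)
    also have "\<dots> \<le> (\<Prod>i\<in>(UNIV::'n set). b)" by (intro prod_mono) (auto simp: assms)
    finally show "cmod (of_int (sign \<pi>) * (\<Prod>i\<in>UNIV. X $ i $ \<pi> i)) \<le> b ^ CARD('n)" by simp
  qed
  then show ?thesis by simp
qed

text \<open>The interpolation points lie in the interval from 0 to 1 and stay away from 0, since the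
  embedding estimate at \<open>s\<close> carries a factor \<open>1/s\<close>.\<close>

definition interp_pt :: "'n::finite itself \<Rightarrow> nat \<Rightarrow> real" where
  "interp_pt _ j = (real j + 1) / (real CARD('n) + 1)"

lemma interp_pt_pos: "0 < interp_pt T j"
  by (simp add: interp_pt_def add_nonneg_pos)

lemma interp_pt_le1: "j \<le> CARD('n) \<Longrightarrow> interp_pt TYPE('n::finite) j \<le> 1"
  by (simp add: interp_pt_def)

text \<open>Conjugation by the inverse root of \<open>V\<close> replaces \<open>V + t M\<close> by \<open>1 + t N\<close> with \<open>0 \<le> N \<le> 1\<close>, whose
  entries are at most 2 in modulus; the Leibniz formula then bounds the determinant.\<close>

lemma det_perturbation_bound:
  fixes V M :: "complex^'n::finite^'n"
  assumes V: "pd V" and M: "psd M" and le: "\<And>x. (M *v x) \<bullet> x \<le> (V *v x) \<bullet> x"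
    and t: "0 \<le> t" "t \<le> 1"
  shows "det V \<noteq> 0"
    "cmod (det (V + t *\<^sub>R M)) \<le> real (card {\<pi>. \<pi> permutes (UNIV::'n set)}) * 2 ^ CARD('n) * cmod (det V)"
proof -
  have pV: "psd V" using V by (simp add: pd_def)
  obtain Ri where Ri: "hermitian Ri" "msqrt V ** Ri = mat 1" "Ri ** msqrt V = mat 1"
    using pd_sqrt_inverse[OF V] .
  define R where "R = msqrt V"
  define N where "N = Ri ** M ** Ri"
  have RR: "R ** R = V" using msqrt_square[OF pV] by (simp add: R_def)
  have dR: "det R * det Ri = 1" by (metis R_def Ri(2) det_I det_mul)
  have dV: "det V = det R * det R" by (metis RR det_mul)
  show "det V \<noteq> 0" using dR dV by auto
  have pN: "psd N" using psd_conjugate[OF M Ri(1)] by (simp add: N_def)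
  have Nle: "(N *v x) \<bullet> x \<le> x \<bullet> x" for x
  proof -
    have "(N *v x) \<bullet> x = (M *v (Ri *v x)) \<bullet> (Ri *v x)"
      unfolding N_def by (rule conjugate_form[OF Ri(1)])
    also have "\<dots> \<le> (V *v (Ri *v x)) \<bullet> (Ri *v x)" by (rule le)
    also have "\<dots> = (norm (R *v (Ri *v x)))\<^sup>2" by (simp add: norm_msqrt[OF pV] R_def)
    also have "\<dots> = x \<bullet> x" using Ri(2) by (simp add: matrix_vector_mul_assoc R_def power2_norm_eq_inner)
    finally show ?thesis .
  qed
  have Nij: "cmod (N $ i $ j) \<le> 1" for i j
  proof -
    have "cmod (N $ i $ j) \<le> norm (N *v axis j 1)"
      using Finite_Cartesian_Product.norm_nth_le[of "N *v axis j 1" i] by (simp add: matrix_vector_axis)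
    also have "\<dots> \<le> norm (axis j 1 :: complex^'n)" by (rule psd_norm_le[OF pN Nle])
    finally show ?thesis by simp
  qed
  have RNR: "R ** N ** R = M"
    using Ri unfolding N_def R_def by (metis matrix_mul_assoc matrix_mul_lid matrix_mul_rid)
  have "V + t *\<^sub>R M = R ** (mat 1 + t *\<^sub>R N) ** R"
  proof (subst matrix_eq, intro allI)
    fix x
    have "M *v x = R *v (N *v (R *v x))" by (simp add: matrix_vector_mul_assoc RNR matrix_mul_assoc)
    moreover have "V *v x = R *v (R *v x)" by (simp add: matrix_vector_mul_assoc RR)
    ultimately show "(V + t *\<^sub>R M) *v x = R ** (mat 1 + t *\<^sub>R N) ** R *v x"
      by (simp add: matrix_vector_simps flip: matrix_vector_mul_assoc)
  qed
  then have "det (V + t *\<^sub>R M) = det V * det (mat 1 + t *\<^sub>R N)"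
    by (simp add: det_mul dV mult_ac)
  moreover have "cmod ((mat 1 + t *\<^sub>R N) $ i $ j) \<le> 2" for i j
  proof -
    have "cmod ((mat 1 + t *\<^sub>R N) $ i $ j) \<le> cmod ((mat 1 :: complex^'n^'n) $ i $ j) + t * cmod (N $ i $ j)"
      using t norm_triangle_ineq[of "(mat 1 :: complex^'n^'n) $ i $ j" "t *\<^sub>R N $ i $ j"] by simp
    also have "\<dots> \<le> 1 + 1 * 1"
      using t Nij by (intro add_mono mult_mono) (auto simp: mat_def)
    finally show ?thesis by simp
  qed
  then have "cmod (det (mat 1 + t *\<^sub>R N)) \<le> real (card {\<pi>. \<pi> permutes (UNIV::'n set)}) * 2 ^ CARD('n)"
    by (rule cmod_det_le)
  ultimately show "cmod (det (V + t *\<^sub>R M)) \<le> real (card {\<pi>. \<pi> permutes (UNIV::'n set)}) * 2 ^ CARD('n) * cmod (det V)"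
    by (simp add: norm_mult mult.commute mult_left_mono)
qed

text \<open>The coefficients \<open>c\<close> may depend on \<open>V\<close> and \<open>M\<close>, but not on the vector \<open>F\<close> to which the inverses are
  applied, and their bound \<open>C\<close> is uniform.\<close>

definition interp_const :: "'n::finite itself \<Rightarrow> real \<Rightarrow> bool" where
  "interp_const T C \<longleftrightarrow> (\<forall>V M :: complex^'n^'n. pd V \<longrightarrow> psd M \<longrightarrow> (\<forall>x. (M *v x) \<bullet> x \<le> (V *v x) \<bullet> x) \<longrightarrow>
     (\<exists>c. (\<forall>j\<le>CARD('n). cmod (c j) \<le> C) \<and>
       (\<forall>F u w. V *v u = F \<longrightarrow> (\<forall>j\<le>CARD('n). (V + interp_pt TYPE('n) j *\<^sub>R M) *v w j = F) \<longrightarrow>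
          u = (\<Sum>j\<le>CARD('n). c j *s w j))))"

text \<open>By Cramer's rule the vector \<open>det (V + s M) (V + s M)\<^sup>-\<^sup>1 F\<close> is polynomial of degree at most \<open>d\<close> in
  \<open>s\<close>. Lagrange interpolation from \<open>d + 1\<close> positive points to \<open>s = 0\<close>, followed by division by \<open>det V\<close>,
  gives the coefficients; they are bounded because the determinants are comparable.\<close>

lemma interp_const_exists: "\<exists>C\<ge>0. interp_const TYPE('n::finite) C"
proof -
  define d where "d = CARD('n)"
  define s where "s = interp_pt TYPE('n)"
  have "inj_on (\<lambda>j. complex_of_real (s j)) {..d}"
  proof (rule inj_onI)
    fix i j assume "complex_of_real (s i) = complex_of_real (s j)"
    then have "s i = s j" by (simp only: of_real_eq_iff)
    then show "i = j" using of_nat_0_le_iff[of "CARD('n)", where 'a=real]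
      by (auto simp: s_def interp_pt_def divide_cancel_right simp del: of_nat_0_le_iff)
  qed
  then obtain L where L: "\<And>p. degree p \<le> d \<Longrightarrow> poly p 0 = (\<Sum>j\<le>d. L j * poly p (complex_of_real (s j)))"
    using lagrange_at_0 by blast
  define P where "P = real (card {\<pi>. \<pi> permutes (UNIV::'n set)}) * 2 ^ CARD('n)"
  define C where "C = (\<Sum>j\<le>d. cmod (L j)) * P"
  have "interp_const TYPE('n) C"
    unfolding interp_const_def
  proof (intro allI impI)
    fix V M :: "complex^'n^'n"
    assume V: "pd V" and M: "psd M" and le: "\<forall>x. (M *v x) \<bullet> x \<le> (V *v x) \<bullet> x"
    have dV: "det V \<noteq> 0" using det_perturbation_bound(1)[OF V M, of 0] le by simp
    define c where "c j = L j * det (V + s j *\<^sub>R M) / det V" for j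
    have "cmod (c j) \<le> C" if "j \<le> d" for j
    proof -
      have "cmod (det (V + s j *\<^sub>R M)) \<le> P * cmod (det V)"
        unfolding P_def
        by (rule det_perturbation_bound(2)[OF V M]) (use le that in \<open>auto simp: s_def d_def interp_pt_le1 less_imp_le[OF interp_pt_pos]\<close>)
      then have "cmod (c j) \<le> cmod (L j) * P"
        using dV by (simp add: c_def norm_mult norm_divide divide_le_eq mult.assoc mult_left_mono)
      also have "\<dots> \<le> C"
        unfolding C_def by (intro mult_right_mono member_le_sum) (use that in \<open>auto simp: P_def\<close>)
      finally show ?thesis .
    qed
    moreover have "u = (\<Sum>j\<le>d. c j *s w j)"
      if u: "V *v u = F" and w: "\<forall>j\<le>d. (V + s j *\<^sub>R M) *v w j = F" for F u w
    proof (subst vec_eq_iff, intro allI)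
      fix k
      obtain p where p: "degree p \<le> d"
        "\<And>z. poly p z = det (\<chi> i j. (\<chi> i l. if l = k then F $ i else V $ i $ l) $ i $ j +
            z * (\<chi> i l. if l = k then 0 else M $ i $ l) $ i $ j)"
        using det_affine_poly[of "\<chi> i l. if l = k then F $ i else V $ i $ l" "\<chi> i l. if l = k then 0 else M $ i $ l"]
        unfolding d_def by metis
      have det_pos: "det (V + s j *\<^sub>R M) \<noteq> 0" if "j \<le> d" for j
      proof -
        have "pd (V + s j *\<^sub>R M)"
          by (intro pd_add_psd V psd_scaleR M less_imp_le) (simp add: s_def interp_pt_pos)
        then show ?thesis using det_perturbation_bound(1)[of "V + s j *\<^sub>R M" 0 0]
          by (simp add: psd_0 psd_nonneg pd_psd)
      qed
      have 0: "poly p 0 = u $ k * det V"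
      proof -
        have "u = (\<chi> k. det (\<chi> i j. if j = k then F $ i else V $ i $ j) / det V)"
          using u cramer[OF dV] by blast
        then have "u $ k * det V = det (\<chi> i j. if j = k then F $ i else V $ i $ j)"
          using dV by simp
        also have "(\<chi> i j. if j = k then F $ i else V $ i $ j) =
          (\<chi> i j'. (\<chi> i l. if l = k then F $ i else V $ i $ l) $ i $ j' +
            0 * (\<chi> i l. if l = k then 0 else M $ i $ l) $ i $ j')"
          by (simp add: vec_eq_iff)
        finally show ?thesis using p(2) by simp
      qed
      have j: "poly p (s j) = w j $ k * det (V + s j *\<^sub>R M)" if "j \<le> d" for j
      proof -
        have "w j = (\<chi> k. det (\<chi> i l. if l = k then F $ i else (V + s j *\<^sub>R M) $ i $ l) / det (V + s j *\<^sub>R M))"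
          using w[rule_format, OF that] cramer[OF det_pos[OF that]] by blast
        then have "w j $ k * det (V + s j *\<^sub>R M) = det (\<chi> i l. if l = k then F $ i else (V + s j *\<^sub>R M) $ i $ l)"
          using det_pos[OF that] by simp
        also have "(\<chi> i l. if l = k then F $ i else (V + s j *\<^sub>R M) $ i $ l) =
          (\<chi> i j'. (\<chi> i l. if l = k then F $ i else V $ i $ l) $ i $ j' +
            complex_of_real (s j) * (\<chi> i l. if l = k then 0 else M $ i $ l) $ i $ j')"
          by (simp add: vec_eq_iff scaleR_conv_of_real[of _ "_ :: complex"])
        finally show ?thesis using p(2) by simp
      qed
      have "u $ k * det V = (\<Sum>j\<le>d. L j * (w j $ k * det (V + s j *\<^sub>R M)))"
        using L[OF p(1)] 0 j by simp
      then have "u $ k = (\<Sum>j\<le>d. L j * (w j $ k * det (V + s j *\<^sub>R M))) / det V"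
        using dV by (simp add: field_simps)
      also have "\<dots> = (\<Sum>j\<le>d. c j *s w j) $ k"
        by (simp add: c_def sum_divide_distrib mult_ac)
      finally show "u $ k = (\<Sum>j\<le>d. c j *s w j) $ k" .
    qed
    ultimately show "\<exists>c. (\<forall>j\<le>CARD('n). cmod (c j) \<le> C) \<and>
       (\<forall>F u w. V *v u = F \<longrightarrow> (\<forall>j\<le>CARD('n). (V + interp_pt TYPE('n) j *\<^sub>R M) *v w j = F) \<longrightarrow>
          u = (\<Sum>j\<le>CARD('n). c j *s w j))"
      unfolding s_def d_def by blast
  qed
  moreover have "0 \<le> C" by (simp add: C_def P_def sum_nonneg)
  ultimately show ?thesis by blast
qed

section \<open>Martingales on the binary tree\<close>

text \<open>The nodes of the tree are binary words; the children of \<open>I\<close> are \<open>False # I\<close> and \<open>True # I\<close>, so the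
  descendants of \<open>I\<close> are the words \<open>K @ I\<close>.\<close>

definition mart :: "(bool list \<Rightarrow> 'a::real_vector) \<Rightarrow> bool" where
  "mart X \<longleftrightarrow> (\<forall>I. X I = (1/2) *\<^sub>R (X (False # I) + X (True # I)))"

definition dif :: "(bool list \<Rightarrow> 'a::real_vector) \<Rightarrow> bool list \<Rightarrow> 'a" where
  "dif X I = (1/2) *\<^sub>R (X (True # I) - X (False # I))"

text \<open>The sum of \<open>a\<close> over the first \<open>h\<close> generations below \<open>I\<close>, each interval weighted by its length relative
  to \<open>I\<close>. With this normalization no interval lengths occur in the estimates on trees.\<close>

fun tsum :: "(bool list \<Rightarrow> 'a::real_vector) \<Rightarrow> nat \<Rightarrow> bool list \<Rightarrow> 'a" where
  "tsum a 0 I = 0"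
| "tsum a (Suc h) I = a I + (1/2) *\<^sub>R (tsum a h (False # I) + tsum a h (True # I))"

text \<open>The average over \<open>I\<close> of the maximum of \<open>m\<close> and of the values of \<open>v\<close> along the path to a node \<open>h\<close>
  generations below; the starting value \<open>m\<close> records the maximum reached above \<open>I\<close>.\<close>

fun tmax :: "(bool list \<Rightarrow> real) \<Rightarrow> nat \<Rightarrow> bool list \<Rightarrow> real \<Rightarrow> real" where
  "tmax v 0 I m = max m (v I)"
| "tmax v (Suc h) I m = (tmax v h (False # I) (max m (v I)) + tmax v h (True # I) (max m (v I))) / 2"

lemma mart_children: "mart X \<Longrightarrow> X (True # I) = X I + dif X I" "mart X \<Longrightarrow> X (False # I) = X I - dif X I"
proof -
  assume "mart X"
  then have "X I = (1/2) *\<^sub>R (X (False # I) + X (True # I))" unfolding mart_def by (rule spec)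
  then have "2 *\<^sub>R X I = X (False # I) + X (True # I)" by simp
  moreover have "2 *\<^sub>R dif X I = X (True # I) - X (False # I)" by (simp add: dif_def)
  ultimately have "2 *\<^sub>R X (True # I) = 2 *\<^sub>R (X I + dif X I)" "2 *\<^sub>R X (False # I) = 2 *\<^sub>R (X I - dif X I)"
    by (simp_all add: scaleR_right_distrib scaleR_right_diff_distrib scaleR_2)
  then show "X (True # I) = X I + dif X I" "X (False # I) = X I - dif X I"
    by (simp_all only: scaleR_cancel_left) simp_all
qed

lemma mart_linear: "mart X \<Longrightarrow> linear f \<Longrightarrow> mart (\<lambda>I. f (X I))"
  unfolding mart_def by (metis linear_add linear_scale)

lemma mart_real: "mart (X :: bool list \<Rightarrow> real) \<longleftrightarrow> (\<forall>I. X I = (X (False # I) + X (True # I)) / 2)"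
  by (simp add: mart_def)

lemma tmax_mono: "m \<le> m' \<Longrightarrow> tmax v h I m \<le> tmax v h I m'"
proof (induction h arbitrary: I m m')
  case (Suc h)
  have "max m (v I) \<le> max m' (v I)" using Suc.prems by simp
  then show ?case using Suc.IH[of "max m (v I)" "max m' (v I)"] by (simp add: add_mono)
qed auto

lemma tmax_ge: "m \<le> tmax v h I m"
proof (induction h arbitrary: I m)
  case (Suc h)
  have "m \<le> max m (v I)" by simp
  then show ?case using Suc[of "max m (v I)" "False # I"] Suc[of "max m (v I)" "True # I"] by simp
qed auto

lemma tmax_ge_v: "v I \<le> tmax v h I m"
proof (cases h)
  case (Suc k)
  have "v I \<le> max m (v I)" by simp
  then show ?thesis using tmax_ge[of "max m (v I)" v k "False # I"] tmax_ge[of "max m (v I)" v k "True # I"] Suc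
    by simp
qed auto

lemma tmax_absorb: "m \<le> v I \<Longrightarrow> tmax v h I m = tmax v h I (v I)"
  by (cases h) (auto simp: max_def)

lemma tmax_step: "(tmax v h (False # I) m + tmax v h (True # I) m) / 2 \<le> tmax v (Suc h) I m"
  using tmax_mono[of m "max m (v I)" v h] by (simp add: add_mono)

text \<open>The Bellman function \<open>5/2 v - 2 L + L\<^sup>2 s\<close> of Doob's maximal inequality in \<open>L\<^sup>2(s)\<close>, where \<open>L\<close> is the
  running maximum of \<open>1/s\<close>, so that \<open>A L\<close> bounds the running maximum of \<open>v\<close>: it is linear in the martingales \<open>v\<close>, \<open>s\<close>, decreases when \<open>L\<close> is
  updated to \<open>1/s\<close>, and dominates \<open>L\<close> at the leaves.\<close>

lemma tmax_le_A2:
  assumes v: "mart v" and s: "mart s" and pos: "\<And>I. 0 < s I"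
    and lower: "\<And>I. 1 \<le> v I * s I" and upper: "\<And>I. v I * s I \<le> A"
  shows "0 \<le> L \<Longrightarrow> tmax v h I (A * L) \<le> A * (5/2 * v I - 2 * max L (1 / s I) + (max L (1 / s I))\<^sup>2 * s I)"
proof (induction h arbitrary: I L)
  case 0
  have A: "1 \<le> A" using lower[of I] upper[of I] by linarith
  define L' where "L' = max L (1 / s I)"
  have "v I \<le> A * (1 / s I)" using upper[of I] pos[of I] by (simp add: field_simps)
  also have "\<dots> \<le> A * L'" using A by (intro mult_left_mono) (auto simp: L'_def)
  finally have "v I \<le> A * L'" .
  moreover have "A * L \<le> A * L'" using A by (intro mult_left_mono) (auto simp: L'_def)
  moreover have "L' \<le> 5/2 * v I - 2 * L' + L'\<^sup>2 * s I"
  proof -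
    have "0 \<le> (L' * s I - 3/2)\<^sup>2 + 1/4 + 5/2 * (v I * s I - 1)" using lower[of I] by simp
    also have "\<dots> = s I * (5/2 * v I - 3 * L' + L'\<^sup>2 * s I)" by (simp add: power2_eq_square field_simps)
    finally show ?thesis using pos[of I] by (simp add: zero_le_mult_iff not_le[symmetric])
  qed
  then have "A * L' \<le> A * (5/2 * v I - 2 * L' + L'\<^sup>2 * s I)" using A by (intro mult_left_mono) auto
  ultimately show ?case unfolding L'_def[symmetric] by simp
next
  case (Suc h)
  have A: "1 \<le> A" using lower[of I] upper[of I] by linarith
  define L' where "L' = max L (1 / s I)"
  have L'0: "0 \<le> L'" using Suc.prems by (simp add: L'_def)
  have "v I \<le> A * (1 / s I)" using upper[of I] pos[of I] by (simp add: field_simps)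
  also have "\<dots> \<le> A * L'" using A by (intro mult_left_mono) (auto simp: L'_def)
  finally have "v I \<le> A * L'" .
  moreover have "A * L \<le> A * L'" using A by (intro mult_left_mono) (auto simp: L'_def)
  ultimately have m: "max (A * L) (v I) \<le> A * L'" by simp
  have child: "tmax v h J (max (A * L) (v I)) \<le> A * (5/2 * v J - 2 * L' + L'\<^sup>2 * s J)" for J
  proof -
    have "tmax v h J (max (A * L) (v I)) \<le> tmax v h J (A * L')" by (rule tmax_mono[OF m])
    also have "\<dots> \<le> A * (5/2 * v J - 2 * max L' (1 / s J) + (max L' (1 / s J))\<^sup>2 * s J)"
      by (rule Suc.IH[OF L'0])
    also have "\<dots> \<le> A * (5/2 * v J - 2 * L' + L'\<^sup>2 * s J)"
    proof (intro mult_left_mono)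
      show "5/2 * v J - 2 * max L' (1 / s J) + (max L' (1 / s J))\<^sup>2 * s J \<le> 5/2 * v J - 2 * L' + L'\<^sup>2 * s J"
      proof (cases "L' \<le> 1 / s J")
        case True
        have "0 \<le> (1 - L' * s J)\<^sup>2 / s J" using pos[of J] by simp
        also have "\<dots> = 1 / s J - 2 * L' + L'\<^sup>2 * s J"
          using pos[of J] by (simp add: power2_eq_square field_simps)
        finally show ?thesis using True pos[of J] by (simp add: max_def power2_eq_square)
      qed (simp add: max_def)
    qed (use A in auto)
    finally show ?thesis .
  qed
  have "tmax v (Suc h) I (A * L) \<le> (A * (5/2 * v (False # I) - 2 * L' + L'\<^sup>2 * s (False # I))
      + A * (5/2 * v (True # I) - 2 * L' + L'\<^sup>2 * s (True # I))) / 2"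
    using child[of "False # I"] child[of "True # I"] by simp
  also have "\<dots> = A * (5/2 * v I - 2 * L' + L'\<^sup>2 * s I)"
  proof -
    have "v (True # I) = 2 * v I - v (False # I)" "s (True # I) = 2 * s I - s (False # I)"
      using v[unfolded mart_real, rule_format, of I] s[unfolded mart_real, rule_format, of I] by auto
    then show ?thesis by (simp only:) (simp add: field_simps)
  qed
  finally show ?case unfolding L'_def .
qed

corollary tmax_le_5_2_A2:
  assumes v: "mart v" and s: "mart s" and pos: "\<And>I. 0 < s I"
    and lower: "\<And>I. 1 \<le> v I * s I" and upper: "\<And>I. v I * s I \<le> A"
  shows "tmax v h I 0 \<le> 5/2 * A * v I"
proof -
  have "tmax v h I (A * 0) \<le> A * (5/2 * v I - 2 * max 0 (1 / s I) + (max 0 (1 / s I))\<^sup>2 * s I)"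
    by (rule tmax_le_A2[OF assms]) simp
  also have "max 0 (1 / s I) = 1 / s I" using pos[of I] by simp
  also have "A * (5/2 * v I - 2 * (1 / s I) + (1 / s I)\<^sup>2 * s I) = 5/2 * A * v I - A / s I"
    using pos[of I] by (simp add: power2_eq_square field_simps)
  also have "\<dots> \<le> 5/2 * A * v I" using pos[of I] lower[of I] upper[of I] by simp
  finally show ?thesis by simp
qed

section \<open>Testing the square function\<close>

lemma power2_norm_Basis: "(norm x)\<^sup>2 = (\<Sum>b\<in>Basis. (x \<bullet> b)\<^sup>2)" for x :: "'a::euclidean_space"
  unfolding power2_norm_eq_inner by (subst euclidean_inner) (simp add: power2_eq_square)

text \<open>If \<open>R\<close> is the square root of \<open>U'\<close> and \<open>Ri\<close> its inverse, the sum is the trace of \<open>U\<close> relative to \<open>U'\<close>.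
  Unlike the best constant in \<open>U \<le> c U'\<close>, this trace is linear in \<open>U\<close>, hence a martingale along the tree.\<close>

lemma form_le_trace:
  fixes U R :: "complex^'n::finite^'n"
  assumes U: "psd U" and Ri: "Ri ** R = mat 1"
  shows "(U *v x) \<bullet> x \<le> (\<Sum>b\<in>Basis. (U *v (Ri *v b)) \<bullet> (Ri *v b)) * (norm (R *v x))\<^sup>2"
proof -
  define S where "S = msqrt U"
  have "x = Ri *v (R *v x)" by (simp add: matrix_vector_mul_assoc Ri)
  also have "\<dots> = Ri *v (\<Sum>b\<in>Basis. ((R *v x) \<bullet> b) *\<^sub>R b)" by (simp add: euclidean_representation)
  also have "\<dots> = (\<Sum>b\<in>Basis. ((R *v x) \<bullet> b) *\<^sub>R (Ri *v b))"
    by (simp add: linear_sum[OF linear_matrix_vector] matrix_vector_scaleR)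
  finally have x: "x = (\<Sum>b\<in>Basis. ((R *v x) \<bullet> b) *\<^sub>R (Ri *v b))" .
  have "norm (S *v x) = norm (\<Sum>b\<in>Basis. ((R *v x) \<bullet> b) *\<^sub>R (S *v (Ri *v b)))"
    by (subst x) (simp add: linear_sum[OF linear_matrix_vector] matrix_vector_scaleR)
  also have "\<dots> \<le> (\<Sum>b\<in>Basis. \<bar>(R *v x) \<bullet> b\<bar> * norm (S *v (Ri *v b)))"
    by (rule order_trans[OF norm_sum]) simp
  finally have "(norm (S *v x))\<^sup>2 \<le> (\<Sum>b\<in>Basis. \<bar>(R *v x) \<bullet> b\<bar> * norm (S *v (Ri *v b)))\<^sup>2"
    by (intro power_mono) auto
  also have "\<dots> \<le> (\<Sum>b\<in>Basis. \<bar>(R *v x) \<bullet> b\<bar>\<^sup>2) * (\<Sum>b\<in>Basis. (norm (S *v (Ri *v b)))\<^sup>2)"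
    by (rule Cauchy_Schwarz_ineq_sum)
  also have "(\<Sum>b\<in>Basis. \<bar>(R *v x) \<bullet> b\<bar>\<^sup>2) = (norm (R *v x))\<^sup>2"
    by (simp add: power2_norm_Basis[of "R *v x"])
  finally show ?thesis by (simp add: S_def norm_msqrt[OF U] mult.commute)
qed

text \<open>The vector \<open>V e\<close> in the form \<open>R\<^sup>2\<close> is bounded by two quantities that are linear in \<open>V\<close>, so its size can
  be controlled by stopping on averages alone.\<close>

lemma conjugated_norm_le_trace:
  fixes V R :: "complex^'n::finite^'n"
  assumes V: "psd V" and R: "hermitian R"
  shows "(norm (R *v (V *v e)))\<^sup>2 \<le> (\<Sum>b\<in>Basis. (V *v (R *v b)) \<bullet> (R *v b)) * ((V *v e) \<bullet> e)"
proof -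
  have "(norm (R *v (V *v e)))\<^sup>2 = (\<Sum>b\<in>Basis. ((V *v e) \<bullet> (R *v b))\<^sup>2)"
    by (simp add: power2_norm_Basis[of "R *v (V *v e)"] hermitian_inner[OF R])
  also have "\<dots> \<le> (\<Sum>b\<in>Basis. ((V *v e) \<bullet> e) * ((V *v (R *v b)) \<bullet> (R *v b)))"
    by (intro sum_mono psd_cauchy_schwarz V)
  finally show ?thesis by (simp add: sum_distrib_left sum_distrib_right mult.commute)
qed

lemma form_mart: "mart W \<Longrightarrow> mart (\<lambda>I. (W I *v x) \<bullet> x)"
  for W :: "bool list \<Rightarrow> complex^'n::finite^'n"
  by (erule mart_linear[where f = "\<lambda>A. (A *v x) \<bullet> x"], intro linearI)
     (simp_all add: matrix_vector_simps inner_add_left)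

lemma mart_sum: "(\<And>b. b \<in> B \<Longrightarrow> mart (\<lambda>I. X b I)) \<Longrightarrow> mart (\<lambda>I. \<Sum>b\<in>B. X b I)"
  unfolding mart_def
proof (intro allI)
  fix I
  assume X: "\<And>b. b \<in> B \<Longrightarrow> \<forall>I. X b I = (1/2) *\<^sub>R (X b (False # I) + X b (True # I))"
  have "(\<Sum>b\<in>B. X b I) = (\<Sum>b\<in>B. (1/2) *\<^sub>R (X b (False # I) + X b (True # I)))"
    by (rule sum.cong[OF refl]) (rule X[rule_format])
  then show "(\<Sum>b\<in>B. X b I) = (1/2) *\<^sub>R ((\<Sum>b\<in>B. X b (False # I)) + (\<Sum>b\<in>B. X b (True # I)))"
    by (simp only: sum.distrib[symmetric] scaleR_sum_right)
qed

text \<open>The square function estimate for the function \<open>V e\<close>. The martingale \<open>\<theta>\<close> adds up the three normalized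
  quantities that have to stay bounded below \<open>L\<close>; it starts from 3 and the recursion stops where it
  exceeds 6, which happens on at most half of \<open>L\<close>. The estimate for stopped intervals comes from the
  outer induction on the height, and the inner induction \<open>descend\<close> carries a potential that makes up
  for both parts: \<open>\<Lambda> - q (V e)\<close> pays for the differences before stopping, and
  \<open>tmax - m (1 - \<theta>/6)\<close> keeps an unused amount \<open>m/2\<close> of the maximal function at \<open>L\<close>.\<close>

lemma testing_tree:
  fixes W V :: "bool list \<Rightarrow> complex^'n::finite^'n" and A :: real
  assumes mW: "mart W" and mV: "mart V" and W: "\<And>I. pd (W I)" and V: "\<And>I. pd (V I)" and e: "e \<noteq> 0"
    and A2: "\<And>I. (\<Sum>b\<in>Basis. (V I *v (msqrt (W I) *v b)) \<bullet> (msqrt (W I) *v b)) \<le> A"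
  shows "tsum (\<lambda>I. (W I *v (dif V I *v e)) \<bullet> (dif V I *v e)) h L
      \<le> 1728 * real DIM(complex^'n) * A * tmax (\<lambda>I. (V I *v e) \<bullet> e) h L 0"
proof -
  define D where "D = real DIM(complex^'n)"
  define a where "a I = (W I *v (dif V I *v e)) \<bullet> (dif V I *v e)" for I
  define v where "v I = (V I *v e) \<bullet> e" for I
  define K where "K = 1728 * D * A"
  have D0: "0 < D" by (simp add: D_def)
  have pW: "psd (W I)" and pV: "psd (V I)" for I using W V by (auto simp: pd_def)
  have v0: "0 < v I" for I using pd_pos[OF V e] by (simp add: v_def)
  have "0 \<le> (\<Sum>b\<in>Basis. (V [] *v (msqrt (W []) *v b)) \<bullet> (msqrt (W []) *v b))"
    by (intro sum_nonneg psd_nonneg pV)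
  then have A0: "0 \<le> A" using A2[of "[]"] by linarith
  have K0: "0 \<le> K" using A0 D0 by (simp add: K_def)
  have "tsum a h L \<le> K * tmax v h L 0"
  proof (induction h arbitrary: L rule: less_induct)
    case (less h)
    define R where "R = msqrt (W L)"
    obtain Ri where Ri: "R ** Ri = mat 1" "Ri ** R = mat 1"
      unfolding R_def using pd_sqrt_inverse[OF W] by metis
    have hR: "hermitian R" by (simp add: R_def msqrt_hermitian[OF pW])
    define wt where "wt I = (\<Sum>b\<in>Basis. (W I *v (Ri *v b)) \<bullet> (Ri *v b))" for I
    define vt where "vt I = (\<Sum>b\<in>Basis. (V I *v (R *v b)) \<bullet> (R *v b))" for I
    define \<tau> where "\<tau> = vt L"
    define m where "m = v L"
    define \<theta> where "\<theta> I = wt I / D + vt I / \<tau> + v I / m" for I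
    define q where "q y = (norm (R *v y))\<^sup>2" for y
    define \<Lambda> where "\<Lambda> = 144 * \<tau> * m"
    have m0: "0 < m" using v0 by (simp add: m_def)
    have wt0: "0 \<le> wt I" and vt0: "0 \<le> vt I" for I
      unfolding wt_def vt_def by (intro sum_nonneg psd_nonneg pW pV)+
    have \<tau>A: "\<tau> \<le> A" unfolding \<tau>_def vt_def R_def by (rule A2)
    have \<tau>0: "0 < \<tau>"
    proof -
      have "R *v b \<noteq> 0" if "b \<in> Basis" for b
        using that Ri(2) by (metis matrix_vector_mul_assoc matrix_vector_mul_lid matrix_vector_mult_0_right nonzero_Basis)
      then show ?thesis unfolding \<tau>_def vt_def by (intro sum_pos pd_pos[OF V]) auto
    qed
    have "wt L = (\<Sum>b\<in>Basis. (b::complex^'n) \<bullet> b)"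
    proof -
      have "(W L *v (Ri *v b)) \<bullet> (Ri *v b) = b \<bullet> b" for b
        using msqrt_inner[OF pW[of L], of "Ri *v b" "Ri *v b"] Ri(1)
        by (simp add: matrix_vector_mul_assoc R_def[symmetric])
      then show ?thesis by (simp add: wt_def)
    qed
    then have wtL: "wt L = D" by (simp add: D_def inner_Basis)
    have \<theta>L: "\<theta> L = 3" using D0 \<tau>0 m0 by (simp add: \<theta>_def wtL \<tau>_def[symmetric] m_def[symmetric])
    have mwt: "mart wt" unfolding wt_def by (intro mart_sum form_mart mW)
    have mvt: "mart vt" unfolding vt_def by (intro mart_sum form_mart mV)
    have mv: "mart v" unfolding v_def by (intro form_mart mV)
    have m\<theta>: "\<theta> I = (\<theta> (False # I) + \<theta> (True # I)) / 2" for I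
      using mwt[unfolded mart_real, rule_format, of I] mvt[unfolded mart_real, rule_format, of I]
        mv[unfolded mart_real, rule_format, of I]
      by (simp add: \<theta>_def add_divide_distrib)
    have \<theta>0: "0 \<le> \<theta> I" for I
      unfolding \<theta>_def using wt0 vt0 v0[of I] D0 \<tau>0 m0 by (intro add_nonneg_nonneg divide_nonneg_nonneg) auto
    have parts: "wt I / D \<le> \<theta> I" "vt I / \<tau> \<le> \<theta> I" "v I / m \<le> \<theta> I" for I
      unfolding \<theta>_def using wt0[of I] vt0[of I] v0[of I] D0 \<tau>0 m0 by simp_all
    have a_le: "a I \<le> 6 * D * q (dif V I *v e)" if "\<theta> I \<le> 6" for I
    proof -
      have "wt I / D \<le> 6" using parts(1)[of I] that by simp
      then have "wt I \<le> 6 * D" using D0 by (simp add: divide_le_eq)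
      then show ?thesis
        using form_le_trace[OF pW Ri(2), of I "dif V I *v e"] mult_right_mono[of "wt I" "6 * D" "q (dif V I *v e)"]
        by (simp add: a_def wt_def[symmetric] q_def)
    qed
    have q_le: "q (V I *v e) \<le> \<Lambda>" if "\<theta> I \<le> 12" for I
    proof -
      have "vt I / \<tau> \<le> 12" "v I / m \<le> 12" using parts(2,3)[of I] that by simp_all
      then have "vt I \<le> 12 * \<tau>" "v I \<le> 12 * m" using \<tau>0 m0 by (simp_all add: divide_le_eq)
      then have "vt I * v I \<le> (12 * \<tau>) * (12 * m)"
        using vt0[of I] v0[of I] \<tau>0 by (intro mult_mono) auto
      then show ?thesis
        using conjugated_norm_le_trace[OF pV hR, of I e] by (simp add: q_def vt_def[symmetric] v_def[symmetric] \<Lambda>_def)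
    qed
    have q_avg: "(q (V (False # I) *v e) + q (V (True # I) *v e)) / 2 = q (V I *v e) + q (dif V I *v e)" for I
      unfolding mart_children[OF mV, of I] q_def
      by (simp add: matrix_vector_simps power2_norm_eq_inner inner_simps inner_commute)
    \<comment> \<open>a node with \<open>\<theta> > 6\<close> still satisfies \<open>\<theta> \<le> 12\<close>, since its parent has \<open>\<theta> \<le> 6\<close> and values at most double\<close>
    have descend: "tsum a k I \<le> 6 * D * (\<Lambda> - q (V I *v e)) + K * (tmax v k I m - m * (1 - \<theta> I / 6))"
      if "k \<le> h" "\<theta> I \<le> 12" "k < h \<or> \<theta> I \<le> 6" for k I
      using that
    proof (induction k arbitrary: I)
      case 0
      have "0 \<le> 6 * D * (\<Lambda> - q (V I *v e))" using q_le[of I] 0 D0 by simp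
      moreover have "m * (1 - \<theta> I / 6) \<le> tmax v 0 I m"
      proof -
        have "m * (1 - \<theta> I / 6) \<le> m" using m0 \<theta>0[of I] by (simp add: mult_le_cancel_left1)
        also have "\<dots> \<le> tmax v 0 I m" by (rule tmax_ge)
        finally show ?thesis .
      qed
      ultimately show ?case using K0 by simp
    next
      case (Suc k)
      show ?case
      proof (cases "\<theta> I \<le> 6")
        case False
        then have "Suc k < h" using Suc.prems by simp
        then have "tsum a (Suc k) I \<le> K * tmax v (Suc k) I 0" by (rule less.IH)
        also have "\<dots> \<le> K * (tmax v (Suc k) I m - m * (1 - \<theta> I / 6))"
        proof (intro mult_left_mono K0)
          have "tmax v (Suc k) I 0 \<le> tmax v (Suc k) I m" by (rule tmax_mono) (use m0 in simp)
          moreover have "m * (1 - \<theta> I / 6) \<le> 0" using False m0 by (simp add: mult_le_0_iff)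
          ultimately show "tmax v (Suc k) I 0 \<le> tmax v (Suc k) I m - m * (1 - \<theta> I / 6)" by linarith
        qed
        also have "\<dots> \<le> 6 * D * (\<Lambda> - q (V I *v e)) + K * (tmax v (Suc k) I m - m * (1 - \<theta> I / 6))"
          using q_le[of I] Suc.prems D0 by simp
        finally show ?thesis .
      next
        case True
        have c12: "\<theta> (b # I) \<le> 12" for b
          using True m\<theta>[of I] \<theta>0[of "False # I"] \<theta>0[of "True # I"] by (cases b) auto
        have IH: "tsum a k (b # I) \<le> 6 * D * (\<Lambda> - q (V (b # I) *v e)) + K * (tmax v k (b # I) m - m * (1 - \<theta> (b # I) / 6))" for b
          by (rule Suc.IH) (use Suc.prems c12 in auto)
        have "tsum a (Suc k) I \<le> a I + (1/2) * (6 * D * (2 * \<Lambda> - (q (V (False # I) *v e) + q (V (True # I) *v e)))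
            + K * (tmax v k (False # I) m + tmax v k (True # I) m - m * (2 - (\<theta> (False # I) + \<theta> (True # I)) / 6)))"
          using IH[of False] IH[of True] by (simp add: algebra_simps add_divide_distrib)
        also have "\<dots> = a I - 6 * D * q (dif V I *v e) + 6 * D * (\<Lambda> - q (V I *v e)) 
            + K * ((tmax v k (False # I) m + tmax v k (True # I) m) / 2 - m * (1 - \<theta> I / 6))"
        proof -
          have "q (V (False # I) *v e) + q (V (True # I) *v e) = 2 * (q (V I *v e) + q (dif V I *v e))"
            using q_avg[of I] by simp
          moreover have "\<theta> (False # I) + \<theta> (True # I) = 2 * \<theta> I" using m\<theta>[of I] by simp
          ultimately show ?thesis by (simp add: algebra_simps)
        qed
        also have "\<dots> \<le> 6 * D * (\<Lambda> - q (V I *v e)) + K * (tmax v (Suc k) I m - m * (1 - \<theta> I / 6))"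
        proof -
          have "K * ((tmax v k (False # I) m + tmax v k (True # I) m) / 2 - m * (1 - \<theta> I / 6))
             \<le> K * (tmax v (Suc k) I m - m * (1 - \<theta> I / 6))"
            by (intro mult_left_mono K0 diff_right_mono tmax_step)
          then show ?thesis using a_le[OF True] by linarith
        qed
        finally show ?thesis .
      qed
    qed
    have "tsum a h L \<le> 6 * D * (\<Lambda> - q (V L *v e)) + K * (tmax v h L m - m * (1 - \<theta> L / 6))"
      by (rule descend) (auto simp: \<theta>L)
    also have "\<dots> \<le> 6 * D * \<Lambda> + K * (tmax v h L m - m / 2)"
      using D0 by (simp add: \<theta>L q_def)
    also have "\<dots> \<le> K * tmax v h L m"
    proof -
      \<comment> \<open>\<open>K = 1728 D A\<close> is chosen so that \<open>K m / 2\<close> absorbs \<open>6 D \<Lambda> = 864 D \<tau> m\<close>\<close>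
      have "D * m * \<tau> \<le> D * m * A" using \<tau>A D0 m0 by (intro mult_left_mono) auto
      then show ?thesis by (simp add: K_def \<Lambda>_def algebra_simps)
    qed
    also have "tmax v h L m = tmax v h L 0"
      using tmax_absorb[of 0 v L h] v0[of L] by (simp add: m_def)
    finally show ?case .
  qed
  then show ?thesis unfolding a_def[abs_def] v_def[abs_def] K_def D_def .
qed

section \<open>The weighted Carleson embedding\<close>

lemma quad_scaleC:
  fixes A :: "complex^'n::finite^'n"
  shows "(A *v (c *s x)) \<bullet> (c *s x) = (cmod c)\<^sup>2 * ((A *v x) \<bullet> x)"
proof -
  have "cinner (A *v (c *s x)) (c *s x) = of_real ((cmod c)\<^sup>2) * cinner (A *v x) x"
    unfolding complex_norm_square vector_scalar_commute
    by (simp add: cinner_def sum_distrib_left mult_ac)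
  from arg_cong[OF this, of Re] show ?thesis by (simp add: Re_cinner)
qed

lemma quad_sum_le:
  fixes A :: "complex^'n::finite^'n"
  assumes A: "psd A" and c: "\<And>j. j \<in> J \<Longrightarrow> cmod (c j) \<le> C" and J: "finite J"
  shows "(A *v (\<Sum>j\<in>J. c j *s u j)) \<bullet> (\<Sum>j\<in>J. c j *s u j) \<le> real (card J) * C\<^sup>2 * (\<Sum>j\<in>J. (A *v u j) \<bullet> u j)"
proof -
  have q: "(A *v x) \<bullet> x = (norm (msqrt A *v x))\<^sup>2" for x by (simp add: norm_msqrt[OF A])
  have "norm (msqrt A *v (\<Sum>j\<in>J. c j *s u j)) \<le> (\<Sum>j\<in>J. norm (msqrt A *v (c j *s u j)))"
    unfolding linear_sum[OF linear_matrix_vector] by (rule norm_sum)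
  then have "(norm (msqrt A *v (\<Sum>j\<in>J. c j *s u j)))\<^sup>2 \<le> (\<Sum>j\<in>J. 1 * norm (msqrt A *v (c j *s u j)))\<^sup>2"
    by (intro power_mono) auto
  also have "\<dots> \<le> (\<Sum>j\<in>J. 1\<^sup>2) * (\<Sum>j\<in>J. (norm (msqrt A *v (c j *s u j)))\<^sup>2)"
    by (rule Cauchy_Schwarz_ineq_sum)
  also have "\<dots> = real (card J) * (\<Sum>j\<in>J. (cmod (c j))\<^sup>2 * ((A *v u j) \<bullet> u j))"
    by (simp add: q[symmetric] quad_scaleC)
  also have "\<dots> \<le> real (card J) * (\<Sum>j\<in>J. C\<^sup>2 * ((A *v u j) \<bullet> u j))"
    by (intro mult_left_mono sum_mono mult_right_mono power_mono c psd_nonneg[OF A]) auto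
  finally show ?thesis by (simp add: q[symmetric] sum_distrib_left mult.assoc)
qed

text \<open>Joint convexity of \<open>(P, F) \<mapsto> \<langle>P\<^sup>-\<^sup>1 F, F\<rangle>\<close>, with the gain that comes from the excess \<open>E\<close> of \<open>P\<close> over the average
  of \<open>P1\<close> and \<open>P2\<close>: the solution \<open>u\<close> for the parent is a competitor in the variational formulas of both
  children.\<close>

lemma inverse_form_step:
  fixes P P1 P2 E :: "complex^'n::finite^'n"
  assumes "psd P1" "psd P2" "P = E + (1/2) *\<^sub>R (P1 + P2)" "F = (1/2) *\<^sub>R (F1 + F2)"
    "P *v u = F" "P1 *v u1 = F1" "P2 *v u2 = F2"
  shows "F \<bullet> u + (E *v u) \<bullet> u \<le> (F1 \<bullet> u1 + F2 \<bullet> u2) / 2"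
proof -
  have "2 * (F1 \<bullet> u) - (P1 *v u) \<bullet> u \<le> F1 \<bullet> u1" "2 * (F2 \<bullet> u) - (P2 *v u) \<bullet> u \<le> F2 \<bullet> u2"
    using assms by (auto intro: psd_variational)
  moreover have "F \<bullet> u = (F1 \<bullet> u + F2 \<bullet> u) / 2" by (simp add: assms(4) inner_add_left)
  moreover have "F \<bullet> u = (E *v u) \<bullet> u + ((P1 *v u) \<bullet> u + (P2 *v u) \<bullet> u) / 2"
    using assms(5) by (simp add: assms(3) matrix_vector_simps inner_add_left flip: assms(5))
  ultimately show ?thesis by (simp add: field_simps)
qed

text \<open>The defect of convexity of \<open>\<langle>V\<^sup>-\<^sup>1 F, F\<rangle>\<close> controls the part of \<open>dif F\<close> that is not explained by
  \<open>dif V\<close>: both \<open>F - V u\<close> at the children are \<open>y\<close> up to sign, and the children of \<open>V\<close> are at most \<open>2 V\<close>.\<close>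

lemma inverse_form_defect:
  fixes V W :: "bool list \<Rightarrow> complex^'n::finite^'n" and A :: real
  assumes mV: "mart V" and mF: "mart F" and V: "\<And>I. pd (V I)" and W: "psd (W I)"
    and A2: "\<And>u. (W I *v (V I *v u)) \<bullet> (V I *v u) \<le> A * ((V I *v u) \<bullet> u)" and A: "0 \<le> A"
    and u: "\<And>I. V I *v u I = F I"
  defines "y \<equiv> dif F I - dif V I *v u I"
  shows "(W I *v y) \<bullet> y \<le> 2 * A * ((F (False # I) \<bullet> u (False # I) + F (True # I) \<bullet> u (True # I)) / 2 - F I \<bullet> u I)"
proof -
  have pV: "psd (V J)" for J using V by (simp add: pd_def)
  define z where "z = solve (V I) y"
  have z: "V I *v z = y" unfolding z_def by (rule solve[OF V])
  have Wy: "(W I *v y) \<bullet> y \<le> A * (y \<bullet> z)" using A2[of z] by (simp add: z)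
  have Vb: "V (True # I) *v x = V I *v x + dif V I *v x" "V (False # I) *v x = V I *v x - dif V I *v x" for x
    by (simp_all add: mart_children[OF mV] matrix_vector_simps)
  have sum: "(V (False # I) *v x) \<bullet> x + (V (True # I) *v x) \<bullet> x = 2 * ((V I *v x) \<bullet> x)" for x
    by (simp add: Vb inner_simps)
  have nn: "0 \<le> (V J *v x) \<bullet> x" for J x by (rule psd_nonneg[OF pV])
  have key: "y \<bullet> z / 2 \<le> F J \<bullet> u J - (2 * (F J \<bullet> u I) - (V J *v u I) \<bullet> u I)"
    if J: "J = True # I \<and> s = 1 \<or> J = False # I \<and> s = - 1" for J and s :: real
  proof -
    define x where "x = s *\<^sub>R (u J - u I)"
    have s2: "s * s = 1" using J by auto
    have x: "V J *v x = y"
      using J u[of I] u[of J] unfolding x_def y_def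
      by (auto simp: matrix_vector_simps Vb mart_children[OF mF])
    have "2 * (y \<bullet> ((1/2) *\<^sub>R z)) - (V J *v ((1/2) *\<^sub>R z)) \<bullet> ((1/2) *\<^sub>R z) \<le> y \<bullet> x"
      by (rule psd_variational[OF pV x])
    then have "y \<bullet> z - (1/4) * ((V J *v z) \<bullet> z) \<le> y \<bullet> x" by (simp add: matrix_vector_simps)
    moreover have "(V J *v z) \<bullet> z \<le> 2 * (y \<bullet> z)"
      using sum[of z] nn[of "True # I" z] nn[of "False # I" z] J z by auto
    moreover have "y \<bullet> x = F J \<bullet> u J - (2 * (F J \<bullet> u I) - (V J *v u I) \<bullet> u I)"
    proof -
      have "y \<bullet> x = (V J *v x) \<bullet> x" using x by simp
      also have "\<dots> = (V J *v (u J - u I)) \<bullet> (u J - u I)"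
        using s2 by (simp add: x_def matrix_vector_scaleR mult.assoc[symmetric])
      also have "\<dots> = F J \<bullet> u J - (2 * (F J \<bullet> u I) - (V J *v u I) \<bullet> u I)"
        using psd_inner[OF pV, of J "u J" "u I"] u[of J] by (simp add: matrix_vector_simps inner_simps)
      finally show ?thesis .
    qed
    ultimately show ?thesis by linarith
  qed
  have "y \<bullet> z / 2 \<le> (F (False # I) \<bullet> u (False # I) + F (True # I) \<bullet> u (True # I)) / 2 - F I \<bullet> u I"
  proof -
    have "F (False # I) \<bullet> u I + F (True # I) \<bullet> u I = 2 * (F I \<bullet> u I)"
      by (simp add: mart_children[OF mF] inner_simps)
    moreover have "(V (False # I) *v u I) \<bullet> u I + (V (True # I) *v u I) \<bullet> u I = 2 * (F I \<bullet> u I)"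
      using sum[of "u I"] u[of I] by simp
    moreover have "p / 2 \<le> (f + t) / 2 - w"
      if "fa + fb = 2 * w" "va + vb = 2 * w" "p / 2 \<le> t - (2 * fb - vb)" "p / 2 \<le> f - (2 * fa - va)"
      for p f t w fa fb va vb :: real
      using that by argo
    ultimately show ?thesis
      using key[OF disjI1[OF conjI[OF refl refl]]] key[OF disjI2[OF conjI[OF refl refl]]] by blast
  qed
  from mult_left_mono[OF this A] Wy show ?thesis by (simp only: mult.assoc)
qed

lemma tsum_psd: "(\<And>I. psd (a I)) \<Longrightarrow> psd (tsum a h I)"
  by (induction h arbitrary: I) (auto simp: psd_0 intro!: psd_add psd_scaleR)

lemma tsum_form: "(tsum a h I *v x) \<bullet> x = tsum (\<lambda>I. (a I *v x) \<bullet> x) h I"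
  for a :: "bool list \<Rightarrow> complex^'n::finite^'n"
  by (induction h arbitrary: I) (auto simp: matrix_vector_simps inner_add_left)

text \<open>The weighted Carleson embedding theorem, combined with the convexity defect. The potential consists
  of \<open>b I = \<langle>V\<^sup>-\<^sup>1 F, F\<rangle>\<close> and of the functions \<open>B j h I = \<langle>(V + s M)\<^sup>-\<^sup>1 F, F\<rangle>\<close> at the interpolation points, where
  \<open>M\<close> sums the coefficients \<open>a\<close> over the remaining \<open>h\<close> generations, divided by the Carleson constant so that
  \<open>M \<le> V\<close>. All of them lie between 0 and the energy \<open>\<phi>\<close>.\<close>

lemma embedding_tree:
  fixes V W :: "bool list \<Rightarrow> complex^'n::finite^'n" and \<phi> :: "bool list \<Rightarrow> real" and A \<kappa> C :: real
  assumes mV: "mart V" and mF: "mart F" and m\<phi>: "mart \<phi>" and V: "\<And>I. pd (V I)" and W: "\<And>I. psd (W I)"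
    and energy: "\<And>I u. 2 * (F I \<bullet> u) \<le> \<phi> I + (V I *v u) \<bullet> u"
    and A2: "\<And>I u. (W I *v (V I *v u)) \<bullet> (V I *v u) \<le> A * ((V I *v u) \<bullet> u)" and A: "0 \<le> A"
    and carleson: "\<And>h I e. tsum (\<lambda>I. (W I *v (dif V I *v e)) \<bullet> (dif V I *v e)) h I \<le> \<kappa> * ((V I *v e) \<bullet> e)"
    and \<kappa>: "0 < \<kappa>"
    and C: "interp_const TYPE('n) C"
  shows "tsum (\<lambda>I. (W I *v dif F I) \<bullet> dif F I) h I
      \<le> (4 * A + 2 * (real CARD('n) + 1)^3 * C\<^sup>2 * \<kappa>) * \<phi> I"
proof -
  define d where "d = CARD('n)"
  define a where "a I = dif V I ** W I ** dif V I" for I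
  define s where "s = interp_pt TYPE('n)"
  define M where "M h I = (1/\<kappa>) *\<^sub>R tsum a h I" for h I
  define \<beta> where "\<beta> = 2 * (real d + 1)\<^sup>2 * C\<^sup>2 * \<kappa>"
  have pV: "psd (V I)" for I using V by (simp add: pd_def)
  have hD: "hermitian (dif V I)" for I
    unfolding dif_def by (intro hermitian_scaleR hermitian_diff psd_hermitian pV)
  have pa: "psd (a I)" for I unfolding a_def by (rule psd_conjugate[OF W hD])
  have aform: "(a I *v x) \<bullet> x = (W I *v (dif V I *v x)) \<bullet> (dif V I *v x)" for I x
    unfolding a_def by (rule conjugate_form[OF hD])
  have pM: "psd (M h I)" for h I unfolding M_def using \<kappa> by (intro psd_scaleR tsum_psd pa) simp
  have Mle: "(M h I *v x) \<bullet> x \<le> (V I *v x) \<bullet> x" for h I x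
    using carleson[of x h I] \<kappa> by (simp add: M_def matrix_vector_simps tsum_form aform divide_le_eq mult.commute)
  have s0: "0 < s j" for j by (simp add: s_def interp_pt_pos)
  have pdP: "pd (V I + s j *\<^sub>R M h I)" for j h I
    by (intro pd_add_psd V psd_scaleR pM less_imp_le s0)
  define u where "u I = solve (V I) (F I)" for I
  define w where "w j h I = solve (V I + s j *\<^sub>R M h I) (F I)" for j h I
  have u: "V I *v u I = F I" for I unfolding u_def by (rule solve[OF V])
  have w: "(V I + s j *\<^sub>R M h I) *v w j h I = F I" for j h I unfolding w_def by (rule solve[OF pdP])
  define b where "b I = F I \<bullet> u I" for I
  define B where "B j h I = F I \<bullet> w j h I" for j h I
  have b0: "0 \<le> b I" for I using psd_nonneg[OF pV, of I "u I"] by (simp add: b_def u)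
  have B0: "0 \<le> B j h I" for j h I
    using psd_nonneg[OF pd_psd[OF pdP], of I j h "w j h I"] by (simp add: B_def w)
  have b1: "b I \<le> \<phi> I" for I using energy[of I "u I"] by (simp add: b_def u)
  have B1: "B j h I \<le> \<phi> I" for j h I
  proof -
    have "F I \<bullet> w j h I = (V I *v w j h I) \<bullet> w j h I + s j * ((M h I *v w j h I) \<bullet> w j h I)"
      using arg_cong[OF w[of I j h], of "\<lambda>z. z \<bullet> w j h I"]
      by (simp add: matrix_vector_simps inner_add_left)
    moreover have "0 \<le> s j * ((M h I *v w j h I) \<bullet> w j h I)"
      using s0[of j] psd_nonneg[OF pM] by (intro mult_nonneg_nonneg) auto
    ultimately show ?thesis using energy[of I "w j h I"] by (simp add: B_def)
  qed
  have Bstep: "B j (Suc h) I + (s j / \<kappa>) * ((a I *v w j (Suc h) I) \<bullet> w j (Suc h) I)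
      \<le> (B j h (False # I) + B j h (True # I)) / 2" for j h I
  proof -
    have "F I \<bullet> w j (Suc h) I + (((s j / \<kappa>) *\<^sub>R a I) *v w j (Suc h) I) \<bullet> w j (Suc h) I
      \<le> (F (False # I) \<bullet> w j h (False # I) + F (True # I) \<bullet> w j h (True # I)) / 2"
    proof (rule inverse_form_step)
      show "V I + s j *\<^sub>R M (Suc h) I = (s j / \<kappa>) *\<^sub>R a I +
        (1/2) *\<^sub>R (V (False # I) + s j *\<^sub>R M h (False # I) + (V (True # I) + s j *\<^sub>R M h (True # I)))"
        by (subst mV[unfolded mart_def, rule_format, of I])
           (simp add: M_def scaleR_right_distrib mult.commute)
      show "F I = (1/2) *\<^sub>R (F (False # I) + F (True # I))"
        using mF unfolding mart_def by (rule spec)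
    qed (use w pdP pd_psd in blast)+
    then show ?thesis by (simp add: B_def matrix_vector_simps)
  qed
  have interp: "(a I *v u I) \<bullet> u I \<le> (real d + 1) * C\<^sup>2 * (\<Sum>j\<le>d. (a I *v w j h I) \<bullet> w j h I)" for h I
  proof -
    have "\<exists>c. (\<forall>j\<le>d. cmod (c j) \<le> C) \<and>
        (\<forall>F u w. V I *v u = F \<longrightarrow> (\<forall>j\<le>d. (V I + s j *\<^sub>R M h I) *v w j = F) \<longrightarrow> u = (\<Sum>j\<le>d. c j *s w j))"
      using C unfolding interp_const_def d_def s_def
      by (elim allE[of _ "V I"] allE[of _ "M h I"] impE) (use V pM Mle in auto)
    then obtain c where c: "\<And>j. j \<le> d \<Longrightarrow> cmod (c j) \<le> C"
      and ex: "\<forall>F u w. V I *v u = F \<longrightarrow> (\<forall>j\<le>d. (V I + s j *\<^sub>R M h I) *v w j = F) \<longrightarrow> u = (\<Sum>j\<le>d. c j *s w j)"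
      by blast
    have uc: "u I = (\<Sum>j\<le>d. c j *s w j h I)"
      by (rule ex[rule_format, OF u]) (rule w)
    show ?thesis
      unfolding uc using quad_sum_le[OF pa, of "{..d}" c C I "\<lambda>j. w j h I"] c by (simp add: add.commute)
  qed
  have "tsum (\<lambda>I. (W I *v dif F I) \<bullet> dif F I) h I \<le> 4 * A * (\<phi> I - b I) + \<beta> * (\<Sum>j\<le>d. \<phi> I - B j h I)"
  proof (induction h arbitrary: I)
    case 0
    have "0 \<le> \<beta>" using \<kappa> by (simp add: \<beta>_def)
    then have "0 \<le> \<beta> * (\<Sum>j\<le>d. \<phi> I - B j 0 I)" using B1 by (intro mult_nonneg_nonneg sum_nonneg) auto
    then show ?case using A b1[of I] by simp
  next
    case (Suc h)
    define y where "y = dif F I - dif V I *v u I"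
    define S where "S = (\<Sum>j\<le>d. (s j / \<kappa>) * ((a I *v w j (Suc h) I) \<bullet> w j (Suc h) I))"
    have dF: "dif F I = y + dif V I *v u I" by (simp add: y_def)
    have "(W I *v dif F I) \<bullet> dif F I \<le> 2 * ((W I *v y) \<bullet> y) + 2 * ((a I *v u I) \<bullet> u I)"
      unfolding dF aform by (rule psd_quad_le[OF W])
    also have "(W I *v y) \<bullet> y \<le> 2 * A * ((b (False # I) + b (True # I)) / 2 - b I)"
      unfolding y_def b_def by (rule inverse_form_defect[OF mV mF V W A2 A u])
    also have "(a I *v u I) \<bullet> u I \<le> \<beta> / 2 * S"
    proof -
      \<comment> \<open>the points satisfy \<open>s j \<ge> 1 / (d + 1)\<close>, so the factor \<open>s j\<close> of the gain can be dropped at this cost\<close>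
      have "1 \<le> (real d + 1) * s j" for j by (simp add: s_def interp_pt_def d_def)
      then have "(\<Sum>j\<le>d. (a I *v w j (Suc h) I) \<bullet> w j (Suc h) I)
          \<le> (\<Sum>j\<le>d. ((real d + 1) * s j) * ((a I *v w j (Suc h) I) \<bullet> w j (Suc h) I))"
        using mult_right_mono[OF _ psd_nonneg[OF pa], of 1] by (intro sum_mono) fastforce
      also have "\<dots> = (real d + 1) * \<kappa> * S"
        using \<kappa> by (simp add: S_def sum_distrib_left mult_ac)
      finally have "(real d + 1) * C\<^sup>2 * (\<Sum>j\<le>d. (a I *v w j (Suc h) I) \<bullet> w j (Suc h) I)
          \<le> (real d + 1) * C\<^sup>2 * ((real d + 1) * \<kappa> * S)" by (intro mult_left_mono) auto
      also have "\<dots> = \<beta> / 2 * S" by (simp add: \<beta>_def power2_eq_square mult_ac)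
      finally show ?thesis using interp[of I "Suc h"] by linarith
    qed
    finally have diag: "(W I *v dif F I) \<bullet> dif F I
        \<le> 4 * A * ((b (False # I) + b (True # I)) / 2 - b I) + \<beta> * S" by simp
    have "S \<le> (\<Sum>j\<le>d. (B j h (False # I) + B j h (True # I)) / 2 - B j (Suc h) I)"
      unfolding S_def using Bstep[of _ h I] by (intro sum_mono) (simp add: le_diff_eq add.commute)
    then have \<beta>S: "\<beta> * S \<le> \<beta> * (\<Sum>j\<le>d. (B j h (False # I) + B j h (True # I)) / 2 - B j (Suc h) I)"
      using \<kappa> by (intro mult_left_mono) (simp_all add: \<beta>_def)
    define p0 p1 where "p0 = \<phi> (False # I)" and "p1 = \<phi> (True # I)"
    have \<phi>I: "\<phi> I = (p0 + p1) / 2" using m\<phi>[unfolded mart_real, rule_format, of I] by (simp add: p0_def p1_def)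
    have "tsum (\<lambda>I. (W I *v dif F I) \<bullet> dif F I) (Suc h) I
      \<le> 4 * A * ((b (False # I) + b (True # I)) / 2 - b I)
        + \<beta> * (\<Sum>j\<le>d. (B j h (False # I) + B j h (True # I)) / 2 - B j (Suc h) I)
        + (4 * A * (p0 - b (False # I)) + \<beta> * (\<Sum>j\<le>d. p0 - B j h (False # I))
         + (4 * A * (p1 - b (True # I)) + \<beta> * (\<Sum>j\<le>d. p1 - B j h (True # I)))) / 2"
    proof -
      have "q + (1/2) *\<^sub>R (t0 + t1) \<le> x + y + (z0 + z1) / 2"
        if "q \<le> x + r" "r \<le> y" "t0 \<le> z0" "t1 \<le> z1" for q t0 t1 x y r z0 z1 :: real
        using that by (simp add: field_simps)
      then show ?thesis
        unfolding tsum.simps p0_def p1_def using diag \<beta>S Suc.IH[of "False # I"] Suc.IH[of "True # I"] by blast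
    qed
    also have "\<dots> = 4 * A * (\<phi> I - b I) + \<beta> * (\<Sum>j\<le>d. \<phi> I - B j (Suc h) I)"
      unfolding \<phi>I by (simp add: sum_subtractf sum.distrib algebra_simps add_divide_distrib diff_divide_distrib flip: sum_divide_distrib)
    finally show ?case .
  qed
  also have "\<dots> \<le> 4 * A * \<phi> I + \<beta> * (\<Sum>j\<le>d. \<phi> I)"
    using A b0[of I] B0[of _ h I] \<kappa> by (intro add_mono mult_left_mono sum_mono) (auto simp: \<beta>_def)
  also have "\<dots> = (4 * A + 2 * (real CARD('n) + 1)^3 * C\<^sup>2 * \<kappa>) * \<phi> I"
    by (simp add: \<beta>_def d_def power3_eq_cube power2_eq_square algebra_simps)
  finally show ?thesis .
qed

section \<open>Random signs\<close>

definition coin :: "real measure" where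
  "coin = measure_pmf (pmf_of_set {-1, 1})"

definition signs :: "(nat \<Rightarrow> real) measure" where
  "signs = PiM UNIV (\<lambda>_. coin)"

lemma prob_space_coin: "prob_space coin"
  unfolding coin_def by (rule prob_space_measure_pmf)

interpretation signs: sequence_space coin
  by (intro sequence_space.intro product_prob_spaceI prob_space_coin)

lemma prob_space_signs: "prob_space signs"
  unfolding signs_def by (rule prob_space_PiM) (rule prob_space_coin)

lemma measurable_sign [measurable]: "(\<lambda>\<omega>. \<omega> i) \<in> borel_measurable signs"
proof -
  have "(\<lambda>\<omega>. \<omega> i) \<in> measurable signs coin"
    unfolding signs_def by (rule measurable_component_singleton) simp
  moreover have "(\<lambda>x. x) \<in> measurable coin borel" by (simp add: coin_def)
  ultimately show ?thesis by (rule measurable_compose)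
qed

lemma nn_integral_coin: "(\<integral>\<^sup>+s. g s \<partial>coin) = (g (-1) + g 1) / 2"
  unfolding coin_def by (subst nn_integral_pmf_of_set) (auto simp: numeral_2_eq_2)

text \<open>The first sign is independent of the shifted sequence, which has the same law; this allows induction
  on the number of terms of a Rademacher sum.\<close>

lemma nn_integral_first_sign:
  assumes [measurable]: "g \<in> borel_measurable signs"
  shows "(\<integral>\<^sup>+\<omega>. g \<omega> \<partial>signs) =
    ((\<integral>\<^sup>+\<omega>. g (case_nat (-1) \<omega>) \<partial>signs) + (\<integral>\<^sup>+\<omega>. g (case_nat 1 \<omega>) \<partial>signs)) / 2"
proof -
  interpret s: sigma_finite_measure signs
    using prob_space_signs prob_space_imp_sigma_finite by blast
  have m: "(\<lambda>(s, \<omega>). case_nat s \<omega>) \<in> measurable (coin \<Otimes>\<^sub>M signs) signs"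
    unfolding signs_def by measurable
  have "signs = distr (coin \<Otimes>\<^sub>M signs) signs (\<lambda>(s, \<omega>). case_nat s \<omega>)"
    using signs.PiM_iter by (simp add: signs_def)
  then have "(\<integral>\<^sup>+\<omega>. g \<omega> \<partial>signs) = (\<integral>\<^sup>+\<omega>. g \<omega> \<partial>distr (coin \<Otimes>\<^sub>M signs) signs (\<lambda>(s, \<omega>). case_nat s \<omega>))"
    by simp
  also have "\<dots> = (\<integral>\<^sup>+p. g (case_nat (fst p) (snd p)) \<partial>(coin \<Otimes>\<^sub>M signs))"
    by (subst nn_integral_distr[OF m]) (simp_all add: assms case_prod_beta)
  also have "\<dots> = (\<integral>\<^sup>+s. (\<integral>\<^sup>+\<omega>. g (case_nat s \<omega>) \<partial>signs) \<partial>coin)"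
    using measurable_compose[OF m assms] by (subst s.nn_integral_fst[symmetric]) (auto simp: case_prod_beta)
  finally show ?thesis by (simp add: nn_integral_coin)
qed

fun running_max :: "(nat \<Rightarrow> 'a::euclidean_space) \<Rightarrow> nat \<Rightarrow> 'a \<Rightarrow> real \<Rightarrow> (nat \<Rightarrow> real) \<Rightarrow> real" where
  "running_max a 0 b L \<omega> = max L (norm b)"
| "running_max a (Suc N) b L \<omega> =
     running_max (\<lambda>n. a (Suc n)) N (b + \<omega> 0 *\<^sub>R a 0) (max L (norm b)) (\<lambda>n. \<omega> (Suc n))"

lemma running_max_ge_L: "L \<le> running_max a N b L \<omega>"
proof (induction N arbitrary: a b L \<omega>)
  case (Suc N)
  have "L \<le> max L (norm b)" by simp
  also have "\<dots> \<le> running_max a (Suc N) b L \<omega>" unfolding running_max.simps by (rule Suc)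
  finally show ?case .
qed simp

lemma running_max_ge: "n \<le> N \<Longrightarrow> norm (b + (\<Sum>i<n. \<omega> i *\<^sub>R a i)) \<le> running_max a N b L \<omega>"
proof (induction N arbitrary: a b L \<omega> n)
  case (Suc N)
  show ?case
  proof (cases n)
    case 0
    have "norm b \<le> max L (norm b)" by simp
    also have "\<dots> \<le> running_max a (Suc N) b L \<omega>" unfolding running_max.simps by (rule running_max_ge_L)
    finally show ?thesis using 0 by simp
  next
    case (Suc k)
    have "b + (\<Sum>i<n. \<omega> i *\<^sub>R a i) = (b + \<omega> 0 *\<^sub>R a 0) + (\<Sum>i<k. \<omega> (Suc i) *\<^sub>R a (Suc i))"
      by (simp only: Suc sum.lessThan_Suc_shift) (simp add: add.assoc)
    then show ?thesis unfolding running_max.simps using Suc.prems Suc by (simp only:) (rule Suc.IH, simp)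
  qed
qed auto

lemma measurable_running_max [measurable]:
  assumes "f \<in> borel_measurable M" "g \<in> borel_measurable M" "\<And>i. (\<lambda>x. w x i) \<in> borel_measurable M"
  shows "(\<lambda>x. running_max a N (f x) (g x) (w x)) \<in> borel_measurable M"
  using assms
proof (induction N arbitrary: a f g w)
  case (Suc N)
  note [measurable] = Suc.prems
  show ?case unfolding running_max.simps by (rule Suc.IH) measurable
qed (simp add: borel_measurable_max)

lemma ennreal_half_sum: "0 \<le> x \<Longrightarrow> 0 \<le> y \<Longrightarrow> (ennreal x + ennreal y) / 2 = ennreal ((x + y) / 2)"
  by (metis add_nonneg_nonneg divide_ennreal ennreal_numeral ennreal_plus zero_less_numeral zero_le_numeral)

text \<open>Doob's maximal inequality in \<open>L\<^sup>2\<close>. With \<open>x = norm b\<close>, the Bellman function \<open>4 y - 4 L x + 2 L\<^sup>2\<close> is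
  linear in the energy \<open>y\<close>, concave in \<open>x\<close>, and minimal at \<open>L = x\<close>, so updating the running maximum
  only decreases it.\<close>

lemma running_max_L2:
  fixes a :: "nat \<Rightarrow> 'a::euclidean_space"
  assumes "0 \<le> L"
  shows "(\<integral>\<^sup>+\<omega>. ennreal ((running_max a N b L \<omega>)\<^sup>2) \<partial>signs)
    \<le> ennreal (4 * ((norm b)\<^sup>2 + (\<Sum>i<N. (norm (a i))\<^sup>2)) - 4 * max L (norm b) * norm b + 2 * (max L (norm b))\<^sup>2)"
  using assms
proof (induction N arbitrary: a b L)
  case 0
  interpret prob_space signs by (rule prob_space_signs)
  have "0 \<le> (2 * norm b - max L (norm b))\<^sup>2" by simp
  then have "(max L (norm b))\<^sup>2 \<le> 4 * (norm b)\<^sup>2 - 4 * max L (norm b) * norm b + 2 * (max L (norm b))\<^sup>2"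
    by (simp add: power2_eq_square algebra_simps)
  then show ?case by (simp add: ennreal_leI emeasure_space_1)
next
  case (Suc N)
  define L' where "L' = max L (norm b)"
  define T where "T = (\<Sum>i<N. (norm (a (Suc i)))\<^sup>2)"
  define \<Phi> where "\<Phi> x = 4 * ((norm x)\<^sup>2 + T) - 4 * L' * norm x + 2 * L'\<^sup>2" for x :: 'a
  have L'0: "0 \<le> L'" using Suc.prems by (simp add: L'_def)
  have T0: "0 \<le> T" by (simp add: T_def sum_nonneg)
  have \<Phi>0: "0 \<le> \<Phi> x" for x
  proof -
    have "\<Phi> x = 2 * (norm x - L')\<^sup>2 + 2 * (norm x)\<^sup>2 + 4 * T"
      by (simp add: \<Phi>_def power2_eq_square algebra_simps)
    then show ?thesis using T0 by simp
  qed
  have branch: "(\<integral>\<^sup>+\<omega>. ennreal ((running_max a (Suc N) b L (case_nat s \<omega>))\<^sup>2) \<partial>signs) \<le> ennreal (\<Phi> (b + s *\<^sub>R a 0))" for s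
  proof -
    define x where "x = b + s *\<^sub>R a 0"
    have "(\<integral>\<^sup>+\<omega>. ennreal ((running_max a (Suc N) b L (case_nat s \<omega>))\<^sup>2) \<partial>signs)
       \<le> ennreal (4 * ((norm x)\<^sup>2 + T) - 4 * max L' (norm x) * norm x + 2 * (max L' (norm x))\<^sup>2)"
      using Suc.IH[OF L'0, of "\<lambda>n. a (Suc n)" x] by (simp add: x_def T_def L'_def)
    also have "\<dots> \<le> ennreal (\<Phi> x)"
    proof (rule ennreal_leI, cases "norm x \<le> L'")
      case False
      have "0 \<le> 2 * (L' - norm x)\<^sup>2" by simp
      then show "4 * ((norm x)\<^sup>2 + T) - 4 * max L' (norm x) * norm x + 2 * (max L' (norm x))\<^sup>2 \<le> \<Phi> x"
        using False by (simp add: \<Phi>_def max_def power2_eq_square algebra_simps)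
    qed (simp add: \<Phi>_def max_def)
    finally show ?thesis unfolding x_def .
  qed
  have "(\<integral>\<^sup>+\<omega>. ennreal ((running_max a (Suc N) b L \<omega>)\<^sup>2) \<partial>signs)
    = ((\<integral>\<^sup>+\<omega>. ennreal ((running_max a (Suc N) b L (case_nat (-1) \<omega>))\<^sup>2) \<partial>signs)
      + (\<integral>\<^sup>+\<omega>. ennreal ((running_max a (Suc N) b L (case_nat 1 \<omega>))\<^sup>2) \<partial>signs)) / 2"
    by (rule nn_integral_first_sign) (measurable)
  also have "\<dots> \<le> (ennreal (\<Phi> (b + (-1) *\<^sub>R a 0)) + ennreal (\<Phi> (b + 1 *\<^sub>R a 0))) / 2"
    by (intro divide_right_mono_ennreal add_mono branch)
  also have "\<dots> = ennreal ((\<Phi> (b - a 0) + \<Phi> (b + a 0)) / 2)"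
    using \<Phi>0 by (simp add: ennreal_half_sum)
  also have "\<dots> \<le> ennreal (4 * ((norm b)\<^sup>2 + (\<Sum>i<Suc N. (norm (a i))\<^sup>2)) - 4 * L' * norm b + 2 * L'\<^sup>2)"
  proof (rule ennreal_leI)
    have sq: "(norm (b - a 0))\<^sup>2 + (norm (b + a 0))\<^sup>2 = 2 * (norm b)\<^sup>2 + 2 * (norm (a 0))\<^sup>2"
      by (simp add: power2_norm_eq_inner inner_simps inner_commute)
    have "2 * norm b = norm ((b - a 0) + (b + a 0))" by (simp flip: scaleR_2)
    also have "\<dots> \<le> norm (b - a 0) + norm (b + a 0)" by (rule norm_triangle_ineq)
    finally have "L' * (2 * norm b) \<le> L' * (norm (b - a 0) + norm (b + a 0))" using L'0 by (rule mult_left_mono)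
    moreover have "(\<Sum>i<Suc N. (norm (a i))\<^sup>2) = (norm (a 0))\<^sup>2 + T"
      unfolding T_def by (rule sum.lessThan_Suc_shift)
    ultimately show "(\<Phi> (b - a 0) + \<Phi> (b + a 0)) / 2
        \<le> 4 * ((norm b)\<^sup>2 + (\<Sum>i<Suc N. (norm (a i))\<^sup>2)) - 4 * L' * norm b + 2 * L'\<^sup>2"
      using sq by (simp add: \<Phi>_def field_simps)
  qed
  finally show ?case unfolding L'_def .
qed

lemma sign_sum_L2:
  fixes a :: "nat \<Rightarrow> 'a::euclidean_space"
  shows "(\<integral>\<^sup>+\<omega>. ennreal ((norm (b + (\<Sum>i<N. \<omega> i *\<^sub>R a i)))\<^sup>2) \<partial>signs) = ennreal ((norm b)\<^sup>2 + (\<Sum>i<N. (norm (a i))\<^sup>2))"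
proof (induction N arbitrary: a b)
  case 0
  interpret prob_space signs by (rule prob_space_signs)
  show ?case by (simp add: emeasure_space_1)
next
  case (Suc N)
  define T where "T = (\<Sum>i<N. (norm (a (Suc i)))\<^sup>2)"
  have T0: "0 \<le> T" by (simp add: T_def sum_nonneg)
  have branch: "(\<integral>\<^sup>+\<omega>. ennreal ((norm (b + (\<Sum>i<Suc N. case_nat s \<omega> i *\<^sub>R a i)))\<^sup>2) \<partial>signs)
      = ennreal ((norm (b + s *\<^sub>R a 0))\<^sup>2 + T)" for s
    using Suc.IH[of "b + s *\<^sub>R a 0" "\<lambda>n. a (Suc n)"]
    by (simp add: sum.lessThan_Suc_shift T_def add.assoc del: sum.lessThan_Suc)
  have sq: "(norm (b - a 0))\<^sup>2 + (norm (b + a 0))\<^sup>2 = 2 * (norm b)\<^sup>2 + 2 * (norm (a 0))\<^sup>2"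
    by (simp add: power2_norm_eq_inner inner_simps inner_commute)
  have "(\<integral>\<^sup>+\<omega>. ennreal ((norm (b + (\<Sum>i<Suc N. \<omega> i *\<^sub>R a i)))\<^sup>2) \<partial>signs)
    = (ennreal ((norm (b - a 0))\<^sup>2 + T) + ennreal ((norm (b + a 0))\<^sup>2 + T)) / 2"
    by (subst nn_integral_first_sign) (measurable, simp only: branch, simp)
  also have "\<dots> = ennreal ((norm b)\<^sup>2 + ((norm (a 0))\<^sup>2 + T))"
  proof -
    have "((norm (b - a 0))\<^sup>2 + T + ((norm (b + a 0))\<^sup>2 + T)) / 2 = (norm b)\<^sup>2 + ((norm (a 0))\<^sup>2 + T)"
      using sq by (simp add: field_simps)
    then show ?thesis using T0 by (subst ennreal_half_sum) (simp_all del: ennreal_plus)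
  qed
  also have "(norm (a 0))\<^sup>2 + T = (\<Sum>i<Suc N. (norm (a i))\<^sup>2)"
    unfolding T_def by (rule sum.lessThan_Suc_shift[symmetric])
  finally show ?case .
qed

lemma sign_sum_maximal:
  fixes a :: "nat \<Rightarrow> 'a::euclidean_space"
  assumes "summable (\<lambda>i. (norm (a i))\<^sup>2)"
  shows "(\<integral>\<^sup>+\<omega>. (SUP n. ennreal ((norm (\<Sum>i<n. \<omega> i *\<^sub>R a i))\<^sup>2)) \<partial>signs) \<le> ennreal (4 * (\<Sum>i. (norm (a i))\<^sup>2))"
proof -
  define f where "f N \<omega> = (SUP n\<in>{..N}. ennreal ((norm (\<Sum>i<n. \<omega> i *\<^sub>R a i))\<^sup>2))" for N \<omega>
  have [measurable]: "f N \<in> borel_measurable signs" for N unfolding f_def by measurable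
  have inc: "incseq f" unfolding incseq_def le_fun_def f_def by (auto intro!: SUP_subset_mono)
  have "(SUP n. ennreal ((norm (\<Sum>i<n. \<omega> i *\<^sub>R a i))\<^sup>2)) = (SUP N. f N \<omega>)" for \<omega>
  proof (rule antisym)
    have "ennreal ((norm (\<Sum>i<n. \<omega> i *\<^sub>R a i))\<^sup>2) \<le> f n \<omega>" for n
      unfolding f_def by (rule SUP_upper) simp
    then show "(SUP n. ennreal ((norm (\<Sum>i<n. \<omega> i *\<^sub>R a i))\<^sup>2)) \<le> (SUP N. f N \<omega>)"
      by (intro SUP_mono) blast
    show "(SUP N. f N \<omega>) \<le> (SUP n. ennreal ((norm (\<Sum>i<n. \<omega> i *\<^sub>R a i))\<^sup>2))"
      unfolding f_def by (intro SUP_least SUP_upper) simp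
  qed
  then have "(\<integral>\<^sup>+\<omega>. (SUP n. ennreal ((norm (\<Sum>i<n. \<omega> i *\<^sub>R a i))\<^sup>2)) \<partial>signs) = (SUP N. \<integral>\<^sup>+\<omega>. f N \<omega> \<partial>signs)"
    using nn_integral_monotone_convergence_SUP[OF inc] by simp
  also have "\<dots> \<le> ennreal (4 * (\<Sum>i. (norm (a i))\<^sup>2))"
  proof (rule SUP_least)
    fix N
    have "f N \<omega> \<le> ennreal ((running_max a N 0 0 \<omega>)\<^sup>2)" for \<omega>
      unfolding f_def using running_max_ge[of _ N 0 \<omega> a 0]
      by (intro SUP_least ennreal_leI power_mono) auto
    then have "(\<integral>\<^sup>+\<omega>. f N \<omega> \<partial>signs) \<le> (\<integral>\<^sup>+\<omega>. ennreal ((running_max a N 0 0 \<omega>)\<^sup>2) \<partial>signs)"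
      by (intro nn_integral_mono)
    also have "\<dots> \<le> ennreal (4 * (\<Sum>i<N. (norm (a i))\<^sup>2))"
      using running_max_L2[of 0 a N 0] by simp
    also have "\<dots> \<le> ennreal (4 * (\<Sum>i. (norm (a i))\<^sup>2))"
      using sum_le_suminf[OF assms, of "{..<N}"] by (intro ennreal_leI) auto
    finally show "(\<integral>\<^sup>+\<omega>. f N \<omega> \<partial>signs) \<le> ennreal (4 * (\<Sum>i. (norm (a i))\<^sup>2))" .
  qed
  finally show ?thesis .
qed

text \<open>By the maximal inequality for the tails, the mean of the oscillation after the index \<open>k\<close> tends to 0. Hence
  the infimum over \<open>k\<close> of this oscillation vanishes almost surely, so the partial sums are Cauchy.\<close>

lemma sign_series_AE_summable:
  fixes a :: "nat \<Rightarrow> 'a::euclidean_space"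
  assumes sm: "summable (\<lambda>i. (norm (a i))\<^sup>2)"
  shows "AE \<omega> in signs. summable (\<lambda>i. \<omega> i *\<^sub>R a i)"
proof -
  \<comment> \<open>zeroing the first \<open>k\<close> terms keeps the same signs for all tails\<close>
  define t where "t k i = (if i < k then 0 else a i)" for k i
  define D where "D k \<omega> = (SUP n. ennreal ((norm (\<Sum>i<n. \<omega> i *\<^sub>R t k i))\<^sup>2))" for k \<omega>
  have [measurable]: "D k \<in> borel_measurable signs" for k unfolding D_def by measurable
  have st: "summable (\<lambda>i. (norm (t k i))\<^sup>2)" for k
    by (rule summable_comparison_test'[OF sm, of 0]) (simp add: t_def)
  have tail: "(\<Sum>i. (norm (t k i))\<^sup>2) = (\<Sum>i. (norm (a (i + k)))\<^sup>2)" for k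
    using suminf_split_initial_segment[OF st, of k k] by (simp add: t_def)
  have "(\<integral>\<^sup>+\<omega>. (INF k. D k \<omega>) \<partial>signs) \<le> 0"
  proof (rule tendsto_lowerbound[of "\<lambda>k. ennreal (4 * (\<Sum>i. (norm (a (i + k)))\<^sup>2))" _ sequentially])
    have "(\<lambda>k. \<Sum>i. (norm (a (i + k)))\<^sup>2) \<longlonglongrightarrow> 0"
      using suminf_exist_split2[OF sm] by simp
    then have "(\<lambda>k. 4 * (\<Sum>i. (norm (a (i + k)))\<^sup>2)) \<longlonglongrightarrow> 4 * 0" by (intro tendsto_intros)
    then show "(\<lambda>k. ennreal (4 * (\<Sum>i. (norm (a (i + k)))\<^sup>2))) \<longlonglongrightarrow> 0"
      using tendsto_ennrealI by fastforce
    show "\<forall>\<^sub>F k in sequentially. (\<integral>\<^sup>+\<omega>. (INF k. D k \<omega>) \<partial>signs) \<le> ennreal (4 * (\<Sum>i. (norm (a (i + k)))\<^sup>2))"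
    proof (intro always_eventually allI)
      fix k
      have "(\<integral>\<^sup>+\<omega>. (INF k. D k \<omega>) \<partial>signs) \<le> (\<integral>\<^sup>+\<omega>. D k \<omega> \<partial>signs)"
        by (intro nn_integral_mono INF_lower) simp
      also have "\<dots> \<le> ennreal (4 * (\<Sum>i. (norm (t k i))\<^sup>2))"
        unfolding D_def by (rule sign_sum_maximal[OF st])
      finally show "(\<integral>\<^sup>+\<omega>. (INF k. D k \<omega>) \<partial>signs) \<le> ennreal (4 * (\<Sum>i. (norm (a (i + k)))\<^sup>2))"
        by (simp add: tail)
    qed
  qed simp
  moreover have "(\<lambda>\<omega>. INF k. D k \<omega>) \<in> borel_measurable signs" by measurable
  ultimately have "AE \<omega> in signs. (INF k. D k \<omega>) = 0"
    by (simp add: nn_integral_0_iff_AE)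
  then show ?thesis
  proof (rule AE_mp, intro AE_I2 impI)
    fix \<omega> :: "nat \<Rightarrow> real"
    assume D0: "(INF k. D k \<omega>) = 0"
    define S where "S n = (\<Sum>i<n. \<omega> i *\<^sub>R a i)" for n
    have "Cauchy S"
    proof (rule CauchyI)
      fix e :: real assume e: "0 < e"
      then have "(INF k. D k \<omega>) < ennreal ((e/2)\<^sup>2)" unfolding D0 by simp
      then obtain k where k: "D k \<omega> < ennreal ((e/2)\<^sup>2)" by (auto simp: INF_less_iff)
      have diff: "norm (S n - S k) < e/2" if "k \<le> n" for n
      proof -
        have "(\<Sum>i<n. \<omega> i *\<^sub>R t k i) = (\<Sum>i\<in>{k..<n}. \<omega> i *\<^sub>R t k i)"
          by (rule sum.mono_neutral_right) (auto simp: t_def)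
        also have "\<dots> = (\<Sum>i\<in>{k..<n}. \<omega> i *\<^sub>R a i)" by (rule sum.cong) (auto simp: t_def)
        also have "\<dots> = S n - S k" unfolding S_def lessThan_atLeast0
          using that by (simp add: sum_diff_nat_ivl)
        finally have "ennreal ((norm (S n - S k))\<^sup>2) \<le> D k \<omega>"
          unfolding D_def by (intro SUP_upper2[of n]) auto
        then have "ennreal ((norm (S n - S k))\<^sup>2) < ennreal ((e/2)\<^sup>2)" using k by (rule le_less_trans)
        then have "(norm (S n - S k))\<^sup>2 < (e/2)\<^sup>2" by (simp add: ennreal_less_iff)
        then show ?thesis by (rule power2_less_imp_less) (use e in simp)
      qed
      show "\<exists>M. \<forall>m\<ge>M. \<forall>n\<ge>M. norm (S m - S n) < e"
      proof (intro exI[of _ k] allI impI)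
        fix m n assume "k \<le> m" "k \<le> n"
        then have "norm ((S m - S k) - (S n - S k)) < e/2 + e/2"
          by (intro le_less_trans[OF norm_triangle_ineq4] add_strict_mono diff)
        then show "norm (S m - S n) < e" by simp
      qed
    qed
    then show "summable (\<lambda>i. \<omega> i *\<^sub>R a i)"
      unfolding S_def[abs_def] summable_iff_convergent by (rule Cauchy_convergent)
  qed
qed

text \<open>Orthogonality gives the identity for partial sums; the maximal function is an integrable majorant.\<close>

lemma sign_series_L2:
  fixes a :: "nat \<Rightarrow> 'a::euclidean_space"
  assumes sm: "summable (\<lambda>i. (norm (a i))\<^sup>2)"
  shows "(\<integral>\<^sup>+\<omega>. ennreal ((norm (\<Sum>i. \<omega> i *\<^sub>R a i))\<^sup>2) \<partial>signs) = ennreal (\<Sum>i. (norm (a i))\<^sup>2)"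
proof -
  have "(\<lambda>n. \<integral>\<^sup>+\<omega>. ennreal ((norm (\<Sum>i<n. \<omega> i *\<^sub>R a i))\<^sup>2) \<partial>signs)
      \<longlonglongrightarrow> (\<integral>\<^sup>+\<omega>. ennreal ((norm (\<Sum>i. \<omega> i *\<^sub>R a i))\<^sup>2) \<partial>signs)"
  proof (rule nn_integral_dominated_convergence[where w = "\<lambda>\<omega>. SUP n. ennreal ((norm (\<Sum>i<n. \<omega> i *\<^sub>R a i))\<^sup>2)"])
    show "(\<integral>\<^sup>+\<omega>. (SUP n. ennreal ((norm (\<Sum>i<n. \<omega> i *\<^sub>R a i))\<^sup>2)) \<partial>signs) < \<infinity>"
      by (rule le_less_trans[OF sign_sum_maximal[OF sm]]) simp
    show "AE \<omega> in signs. (\<lambda>n. ennreal ((norm (\<Sum>i<n. \<omega> i *\<^sub>R a i))\<^sup>2)) \<longlonglongrightarrow> ennreal ((norm (\<Sum>i. \<omega> i *\<^sub>R a i))\<^sup>2)"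
      using sign_series_AE_summable[OF sm]
      by eventually_elim (intro tendsto_intros tendsto_ennrealI summable_LIMSEQ)
    show "AE \<omega> in signs. ennreal ((norm (\<Sum>i<j. \<omega> i *\<^sub>R a i))\<^sup>2)
        \<le> (SUP n. ennreal ((norm (\<Sum>i<n. \<omega> i *\<^sub>R a i))\<^sup>2))" for j
      by (intro AE_I2 SUP_upper) simp
  qed measurable
  moreover have "(\<lambda>n. \<integral>\<^sup>+\<omega>. ennreal ((norm (\<Sum>i<n. \<omega> i *\<^sub>R a i))\<^sup>2) \<partial>signs) \<longlonglongrightarrow> ennreal (\<Sum>i. (norm (a i))\<^sup>2)"
  proof -
    have "(\<integral>\<^sup>+\<omega>. ennreal ((norm (\<Sum>i<n. \<omega> i *\<^sub>R a i))\<^sup>2) \<partial>signs) = ennreal (\<Sum>i<n. (norm (a i))\<^sup>2)" for n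
      using sign_sum_L2[of 0 a n] by simp
    then show ?thesis by (simp only:) (intro tendsto_ennrealI summable_LIMSEQ sm)
  qed
  ultimately show ?thesis by (rule LIMSEQ_unique)
qed

(* The left-hand side matches any function applied to a fixed argument, which derails later
   measurability proofs on other spaces. *)
declare measurable_sign [measurable del]

section \<open>Dyadic intervals as binary words\<close>

text \<open>The head of a word is the last binary digit of the position.\<close>

fun pos :: "bool list \<Rightarrow> nat" where
  "pos [] = 0"
| "pos (b # I) = 2 * pos I + of_bool b"

definition dint :: "bool list \<Rightarrow> real set" where
  "dint I = {real (pos I) / 2 ^ length I .. (real (pos I) + 1) / 2 ^ length I}"

lemma pos_less: "pos I < 2 ^ length I"
  by (induction I) auto

lemma bij_pos: "bij_betw pos {I. length I = n} {..<2 ^ n}"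
proof (induction n)
  case (Suc n)
  have inj: "I = J" if "length I = length J" "pos I = pos J" for I J
    using that
  proof (induction I J rule: list_induct2)
    case (Cons x xs y ys)
    have "x = y" using Cons.prems by (cases x; cases y) (auto, presburger+)
    then show ?case using Cons by auto
  qed simp
  have "m \<in> pos ` {I. length I = Suc n}" if "m < 2 ^ Suc n" for m
  proof -
    have "m div 2 < 2 ^ n" using that by auto
    then obtain I where I: "length I = n" "pos I = m div 2"
      using Suc[unfolded bij_betw_def] by (metis (mono_tags, lifting) imageE lessThan_iff mem_Collect_eq)
    have "pos (odd m # I) = m" by (simp add: I)
    then show ?thesis using I by (metis (mono_tags, lifting) image_eqI length_Cons mem_Collect_eq)
  qed
  then show ?case
    unfolding bij_betw_def using pos_less inj by (auto simp: inj_on_def) (metis length_Cons power_Suc pos_less)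
qed (auto simp: bij_betw_def)

lemma dyadic_gen_eq: "dyadic_gen n = dint ` {I. length I = n}"
proof -
  have "dyadic_gen n = (\<lambda>j::nat. {real j / 2 ^ n .. (real j + 1) / 2 ^ n}) ` (pos ` {I. length I = n})"
    unfolding dyadic_gen_def bij_pos[unfolded bij_betw_def, THEN conjunct2] ..
  then show ?thesis by (auto simp: dint_def image_image)
qed

lemma dyadic_eq: "dyadic = range dint"
  by (auto simp: dyadic_def dyadic_gen_eq)

lemma dint_bounds: "real (pos I) / 2 ^ length I < (real (pos I) + 1) / 2 ^ length I"
  by (simp add: divide_strict_right_mono)

lemma Inf_dint: "Inf (dint I) = real (pos I) / 2 ^ length I"
  and Sup_dint: "Sup (dint I) = (real (pos I) + 1) / 2 ^ length I"
  using less_imp_le[OF dint_bounds[of I]] by (simp_all add: dint_def)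

lemma measure_dint: "measure lebesgue (dint I) = 1 / 2 ^ length I"
  by (simp add: dint_def divide_right_mono add_divide_distrib)

lemma emeasure_dint: "emeasure lebesgue (dint I) = ennreal (1 / 2 ^ length I)"
  using less_imp_le[OF dint_bounds[of I]] by (simp add: dint_def add_divide_distrib)

lemma dint_sets [measurable]: "dint I \<in> sets lebesgue"
  by (simp add: dint_def)

lemma inj_dint: "inj dint"
proof (rule injI)
  fix I J assume eq: "dint I = dint J"
  then have "(1::real) / 2 ^ length I = 1 / 2 ^ length J" by (metis measure_dint)
  then have l: "length I = length J" by simp
  moreover have "pos I = pos J" using eq Inf_dint[of I] Inf_dint[of J] l by simp
  ultimately show "I = J" using bij_pos[of "length J"] by (auto simp: bij_betw_def inj_on_def)
qed

lemma sum_dyadic_gen: "(\<Sum>I\<in>dyadic_gen n. f I) = (\<Sum>I | length I = n. f (dint I))"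
  unfolding dyadic_gen_eq by (rule sum.reindex_cong[of dint]) (auto intro: inj_on_subset[OF inj_dint])

lemma left_half_dint: "left_half (dint I) = dint (False # I)"
  and right_half_dint: "right_half (dint I) = dint (True # I)"
  unfolding left_half_def right_half_def Inf_dint Sup_dint dint_def
  by (simp_all add: field_simps)

lemma dint_split: "dint I = dint (False # I) \<union> dint (True # I)"
proof -
  have "{a..c} = {a..(a + c) / 2} \<union> {(a + c) / 2..c}" if "a < c" for a c :: real
    using that by auto
  from this[OF dint_bounds[of I]] show ?thesis
    unfolding left_half_dint[symmetric] right_half_dint[symmetric] left_half_def right_half_def Inf_dint Sup_dint
    by (simp add: dint_def)
qed

lemma dint_Cons_subset: "dint (b # I) \<subseteq> dint I"
  using dint_split[of I] by (cases b) auto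

lemma dint_append_subset: "dint (K @ I) \<subseteq> dint I"
  by (induction K) (use dint_Cons_subset in fastforce)+

lemma dint_Nil: "dint [] = {0..1}"
  by (simp add: dint_def)

lemma dint_subset: "dint I \<subseteq> {0..1}"
  using dint_append_subset[of I "[]"] by (simp add: dint_Nil)

text \<open>Closed dyadic intervals of one generation overlap only in these points.\<close>

definition dyadic_pts :: "real set" where
  "dyadic_pts = range (\<lambda>(k::nat, n::nat). real k / 2 ^ n)"

lemma null_dyadic_pts: "dyadic_pts \<in> null_sets lebesgue"
  unfolding dyadic_pts_def by (intro countable_imp_null_set_lborel[THEN null_sets_completionI]) auto

lemma AE_not_dyadic_pt: "AE x in lebesgue. x \<notin> dyadic_pts"
  using null_dyadic_pts by (rule AE_not_in)

lemma dint_unique: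
  assumes "length I = length J" "x \<in> dint I" "x \<in> dint J" "x \<notin> dyadic_pts"
  shows "I = J"
proof -
  have s: "real (pos K) < x * 2 ^ length K \<and> x * 2 ^ length K < real (pos K) + 1" if "x \<in> dint K" for K
  proof -
    have "real m / 2 ^ n \<in> dyadic_pts" for m n
      unfolding dyadic_pts_def by (rule range_eqI[of _ _ "(m, n)"]) simp
    then have "x \<noteq> real (pos K) / 2 ^ length K" "x \<noteq> real (pos K + 1) / 2 ^ length K"
      using assms(4) by metis+
    then show ?thesis using that by (auto simp: dint_def field_simps order_less_le)
  qed
  have "pos I = pos J" using s[OF assms(2)] s[OF assms(3)] assms(1) by simp
  then show ?thesis using assms(1) bij_pos[of "length J"] by (auto simp: bij_betw_def inj_on_def)
qed

lemma dint_Cons_disjoint: "x \<notin> dyadic_pts \<Longrightarrow> x \<in> dint (b # I) \<Longrightarrow> x \<in> dint (b' # I) \<Longrightarrow> b = b'"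
  using dint_unique[of "b # I" "b' # I" x] by simp

lemma dint_exists: "x \<in> {0..1} \<Longrightarrow> \<exists>I. length I = n \<and> x \<in> dint I"
proof (induction n)
  case (Suc n)
  then obtain I where "length I = n" "x \<in> dint I" by blast
  then show ?case using dint_split[of I] by (metis UnE length_Cons)
qed (auto simp: dint_Nil)

text \<open>Away from dyadic points, inclusion of dyadic intervals is the suffix order on words: the
  suffix of \<open>J\<close> of the length of \<open>I\<close> is a word of that length whose interval contains \<open>x\<close>.\<close>

lemma dint_subset_append:
  assumes "dint J \<subseteq> dint I" "x \<in> dint J" "x \<notin> dyadic_pts"
  shows "\<exists>K. J = K @ I"
proof -
  have "measure lebesgue (dint J) \<le> measure lebesgue (dint I)"
    by (rule measure_mono_fmeasurable[OF assms(1)]) (simp_all add: fmeasurable_def emeasure_dint)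
  then have le: "length I \<le> length J" by (simp add: measure_dint field_simps)
  define K where "K = take (length J - length I) J"
  define I' where "I' = drop (length J - length I) J"
  have J: "J = K @ I'" by (simp add: K_def I'_def)
  have "x \<in> dint I'" using assms(2) dint_append_subset J by blast
  moreover have "length I' = length I" using le by (simp add: I'_def)
  ultimately have "I' = I" using dint_unique assms by blast
  then show ?thesis using J by blast
qed

lemma finite_words: "finite {I :: bool list. length I = n}"
  using finite_lists_length_eq[of "UNIV :: bool set" n] by simp

lemma sum_words_Suc:
  "(\<Sum>K | length K = Suc n. f K) = (\<Sum>K | length K = n. f (K @ [False]) + f (K @ [True]))"
proof -
  have "{K. length K = Suc n} = (\<lambda>K. K @ [False]) ` {K. length K = n} \<union> (\<lambda>K. K @ [True]) ` {K. length K = n}"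
  proof (intro equalityI subsetI)
    fix K :: "bool list" assume "K \<in> {K. length K = Suc n}"
    then have "K \<noteq> []" "length (butlast K) = n" by auto
    then have "K = butlast K @ [last K]" "length (butlast K) = n" by auto
    then show "K \<in> (\<lambda>K. K @ [False]) ` {K. length K = n} \<union> (\<lambda>K. K @ [True]) ` {K. length K = n}"
      by (cases "last K") (auto intro!: image_eqI[of _ _ "butlast K"])
  qed auto
  also have "sum f \<dots> = (\<Sum>K | length K = n. f (K @ [False])) + (\<Sum>K | length K = n. f (K @ [True]))"
    by (subst sum.union_disjoint) (auto simp: finite_words sum.reindex inj_on_def)
  finally show ?thesis by (simp add: sum.distrib)
qed

lemma tsum_eq_sum:
  fixes a :: "bool list \<Rightarrow> real"
  shows "tsum a h I = (\<Sum>n<h. (1 / 2 ^ n) * (\<Sum>K | length K = n. a (K @ I)))"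
proof (induction h arbitrary: I)
  case (Suc h)
  have "(\<Sum>n<Suc h. (1 / 2 ^ n) * (\<Sum>K | length K = n. a (K @ I)))
    = a I + (\<Sum>n<h. (1 / 2 ^ Suc n) * (\<Sum>K | length K = Suc n. a (K @ I)))"
    by (subst sum.lessThan_Suc_shift) simp
  also have "(\<Sum>n<h. (1 / 2 ^ Suc n) * (\<Sum>K | length K = Suc n. a (K @ I)))
    = (1/2) * (tsum a h (False # I) + tsum a h (True # I))"
    unfolding Suc.IH sum_words_Suc
    by (simp add: sum.distrib sum_distrib_left algebra_simps)
  finally show ?case by simp
qed simp

section \<open>Dyadic averages\<close>

lemma AE_J01: "(AE x::real in lebesgue_on {0..1}. P x) \<longleftrightarrow> (AE x in lebesgue. x \<in> {0..1} \<longrightarrow> P x)"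
proof -
  have "{0..1::real} \<in> sets lebesgue" by simp
  then show ?thesis by (subst AE_restrict_space_iff) (simp_all add: Int_commute)
qed

lemma set_integrable_dint: "set_integrable lebesgue {0..1} g \<Longrightarrow> set_integrable lebesgue (dint I) g"
  for g :: "real \<Rightarrow> 'a::euclidean_space"
  by (rule set_integrable_subset) (auto intro: subsetD[OF dint_subset])

definition av :: "(real \<Rightarrow> 'a::euclidean_space) \<Rightarrow> bool list \<Rightarrow> 'a" where
  "av g I = avg (dint I) g"

lemma av_eq: "av g I = 2 ^ length I *\<^sub>R (LINT x:dint I|lebesgue. g x)"
  by (simp add: av_def avg_def measure_dint)

lemma integral_dint: "(LINT x:dint I|lebesgue. g x) = (1 / 2 ^ length I) *\<^sub>R av g I"
  by (simp add: av_eq)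

lemma mart_av:
  fixes g :: "real \<Rightarrow> 'a::euclidean_space"
  assumes "set_integrable lebesgue {0..1} g"
  shows "mart (av g)"
  unfolding mart_def
proof
  fix I
  have "AE x in lebesgue. \<not> (x \<in> dint (False # I) \<and> x \<in> dint (True # I))"
    using AE_not_dyadic_pt by eventually_elim (use dint_Cons_disjoint in blast)
  then have "(LINT x:dint I|lebesgue. g x) = (LINT x:dint (False # I)|lebesgue. g x) + (LINT x:dint (True # I)|lebesgue. g x)"
    by (subst dint_split) (rule set_integral_Un_AE, auto intro: set_integrable_dint assms)
  then show "av g I = (1 / 2) *\<^sub>R (av g (False # I) + av g (True # I))"
    by (simp add: av_eq scaleR_right_distrib)
qed

lemma av_linear:
  fixes g :: "real \<Rightarrow> 'a::euclidean_space" and T :: "'a \<Rightarrow> 'b::euclidean_space"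
  assumes g: "set_integrable lebesgue {0..1} g" and T: "linear T"
  shows "set_integrable lebesgue {0..1} (\<lambda>x. T (g x))" "av (\<lambda>x. T (g x)) I = T (av g I)"
proof -
  have bl: "bounded_linear T" using T by (simp add: linear_conv_bounded_linear)
  have "integrable lebesgue (\<lambda>x. T (indicator {0..1} x *\<^sub>R g x))"
    using integrable_bounded_linear[OF bl] g unfolding set_integrable_def by blast
  then show "set_integrable lebesgue {0..1} (\<lambda>x. T (g x))"
    unfolding set_integrable_def by (simp add: linear_scale[OF T])
  have "(LINT x|lebesgue. T (indicator (dint I) x *\<^sub>R g x)) = T (LINT x|lebesgue. indicator (dint I) x *\<^sub>R g x)"
    by (rule integral_bounded_linear[OF bl]) (use set_integrable_dint[OF g] in \<open>simp add: set_integrable_def\<close>)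
  then show "av (\<lambda>x. T (g x)) I = T (av g I)"
    by (simp add: av_eq set_lebesgue_integral_def linear_scale[OF T])
qed

lemma av_mono:
  fixes g g' :: "real \<Rightarrow> real"
  assumes "set_integrable lebesgue {0..1} g" "set_integrable lebesgue {0..1} g'"
    and "AE x in lebesgue. x \<in> {0..1} \<longrightarrow> g x \<le> g' x"
  shows "av g I \<le> av g' I"
proof -
  have "(LINT x:dint I|lebesgue. g x) \<le> (LINT x:dint I|lebesgue. g' x)"
    by (rule set_integral_mono_AE)
       (use assms dint_subset[of I] in \<open>auto intro: set_integrable_dint elim!: eventually_mono\<close>)
  then show ?thesis by (simp add: av_eq)
qed

lemma av_cong:
  assumes "AE x in lebesgue. x \<in> {0..1} \<longrightarrow> g x = g' x"
    and "set_integrable lebesgue {0..1} g" "set_integrable lebesgue {0..1} g'"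
  shows "av g I = av g' I"
proof -
  have m: "(\<lambda>x. indicator (dint I) x *\<^sub>R h x) \<in> borel_measurable lebesgue"
    if "set_integrable lebesgue {0..1} h" for h :: "real \<Rightarrow> 'a"
    using set_integrable_dint[OF that] unfolding set_integrable_def by (rule borel_measurable_integrable)
  have "AE x in lebesgue. indicator (dint I) x *\<^sub>R g x = indicator (dint I) x *\<^sub>R g' x"
    using assms(1) by eventually_elim (use dint_subset[of I] in \<open>auto simp: indicator_def\<close>)
  then have "(LINT x:dint I|lebesgue. g x) = (LINT x:dint I|lebesgue. g' x)"
    unfolding set_lebesgue_integral_def by (intro integral_cong_AE m assms)
  then show ?thesis by (simp add: av_eq)
qed

lemma av_pos:
  fixes g :: "real \<Rightarrow> real"
  assumes g: "set_integrable lebesgue {0..1} g" and pos: "AE x in lebesgue. x \<in> {0..1} \<longrightarrow> 0 < g x"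
  shows "0 < av g I"
proof (rule ccontr)
  assume "\<not> 0 < av g I"
  define f where "f x = indicator (dint I) x *\<^sub>R g x" for x
  have f: "integrable lebesgue f" using set_integrable_dint[OF g] by (simp add: f_def[abs_def] set_integrable_def)
  have nn: "AE x in lebesgue. 0 \<le> f x"
    using pos by eventually_elim (use dint_subset[of I] in \<open>auto simp: f_def indicator_def less_imp_le\<close>)
  have "integral\<^sup>L lebesgue f \<le> 0"
    using \<open>\<not> 0 < av g I\<close> by (simp add: av_eq set_lebesgue_integral_def f_def[abs_def] zero_less_mult_iff not_less)
  then have "integral\<^sup>L lebesgue f = 0" using integral_nonneg_AE[OF nn] by simp
  then have "AE x in lebesgue. f x = 0" using integral_nonneg_eq_0_iff_AE[OF f nn] by blast
  then have "AE x in lebesgue. x \<notin> dint I"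
    using pos by eventually_elim (use dint_subset[of I] in \<open>auto simp: f_def indicator_def\<close>)
  then have "emeasure lebesgue (dint I) = 0"
    by (subst (asm) AE_iff_measurable[of "dint I"]) auto
  then show False by (simp add: emeasure_dint)
qed

lemma nn_integral_dint:
  fixes g :: "real \<Rightarrow> real"
  assumes g: "set_integrable lebesgue {0..1} g" and nn: "AE x in lebesgue. x \<in> {0..1} \<longrightarrow> 0 \<le> g x"
  shows "(\<integral>\<^sup>+x\<in>dint I. ennreal (g x) \<partial>lebesgue) = ennreal (av g I / 2 ^ length I)"
proof -
  have "(\<integral>\<^sup>+x\<in>dint I. ennreal (g x) \<partial>lebesgue) = (\<integral>\<^sup>+x. ennreal (indicator (dint I) x *\<^sub>R g x) \<partial>lebesgue)"
    by (rule nn_integral_cong) (simp add: indicator_def)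
  also have "\<dots> = ennreal (LINT x:dint I|lebesgue. g x)"
    unfolding set_lebesgue_integral_def
  proof (rule nn_integral_eq_integral)
    show "integrable lebesgue (\<lambda>x. indicator (dint I) x *\<^sub>R g x)"
      using set_integrable_dint[OF g] by (simp add: set_integrable_def)
    show "AE x in lebesgue. 0 \<le> indicator (dint I) x *\<^sub>R g x"
      using nn by eventually_elim (use dint_subset[of I] in \<open>auto simp: indicator_def\<close>)
  qed
  finally show ?thesis by (simp add: integral_dint)
qed

section \<open>Matrix weights\<close>

lemma matrix_inv_mult:
  assumes "invertible A"
  shows "A ** matrix_inv A = mat 1" "matrix_inv A ** A = mat 1"
  using someI_ex[of "\<lambda>B. A ** B = mat 1 \<and> B ** A = mat 1"] assms
  unfolding matrix_inv_def invertible_def by auto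

lemma pd_if_invertible:
  assumes "psd A" "invertible A"
  shows "pd A"
  unfolding pd_def
proof (intro conjI allI impI assms)
  fix x :: "complex^'a" assume "x \<noteq> 0"
  have "A *v x \<noteq> 0"
    using matrix_inv_mult(2)[OF assms(2)] \<open>x \<noteq> 0\<close>
    by (metis matrix_vector_mul_assoc matrix_vector_mul_lid matrix_vector_mult_0_right)
  then show "0 < (A *v x) \<bullet> x"
    using psd_kernel[OF assms(1), of x] psd_nonneg[OF assms(1), of x] by fastforce
qed

lemma pd_matrix_inv:
  assumes "psd A" "invertible A"
  shows "pd (matrix_inv A)"
proof (rule pd_if_invertible)
  note inv = matrix_inv_mult[OF assms(2)]
  show "invertible (matrix_inv A)" using inv unfolding invertible_def by blast
  have "adj (matrix_inv A) ** A = mat 1"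
    using arg_cong[OF inv(1), of adj] psd_hermitian[OF assms(1)]
    by (simp add: adj_mult hermitian_iff_adj) (simp add: adj_def mat_def vec_eq_iff)
  then have "adj (matrix_inv A) = matrix_inv A"
    by (metis inv(1) matrix_mul_assoc matrix_mul_lid matrix_mul_rid)
  moreover have "0 \<le> (matrix_inv A *v x) \<bullet> x" for x
  proof -
    have "(matrix_inv A *v x) \<bullet> x = (matrix_inv A *v x) \<bullet> (A *v (matrix_inv A *v x))"
      by (simp add: matrix_vector_mul_assoc inv)
    then show ?thesis using psd_nonneg[OF assms(1)] by (simp add: inner_commute)
  qed
  ultimately show "psd (matrix_inv A)" by (simp add: psd_iff hermitian_iff_adj)
qed

text \<open>Young's inequality for the dual pair \<open>A\<close>, \<open>A\<^sup>-\<^sup>1\<close>. It survives averaging, and is the form in which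
  the energy of \<open>f\<close> enters the argument on the tree.\<close>

lemma energy_inequality:
  assumes "psd A" "invertible A"
  shows "2 * (f \<bullet> u) \<le> (A *v f) \<bullet> f + (matrix_inv A *v u) \<bullet> u"
  using psd_variational[OF assms(1), of "matrix_inv A *v u" u f] matrix_inv_mult(1)[OF assms(2)]
  by (simp add: matrix_vector_mul_assoc inner_commute)

lemma inverse_cauchy_schwarz:
  assumes "psd A" "invertible A"
  shows "(f \<bullet> e)\<^sup>2 \<le> ((A *v f) \<bullet> f) * ((matrix_inv A *v e) \<bullet> e)"
proof -
  have "A *v (matrix_inv A *v e) = e" by (simp add: matrix_vector_mul_assoc matrix_inv_mult[OF assms(2)])
  then show ?thesis
    using psd_cauchy_schwarz[OF assms(1), of f "matrix_inv A *v e"] hermitian_inner[OF psd_hermitian[OF assms(1)], of f "matrix_inv A *v e"]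
    by (simp add: inner_commute)
qed

lemma linear_form: "linear (\<lambda>A. (A *v x) \<bullet> y)"
  for x y :: "complex^'n::finite"
  by (intro linearI) (simp_all add: matrix_vector_simps inner_add_left)

lemma linear_adj: "linear (adj :: complex^'n::finite^'n \<Rightarrow> _)"
  by (intro linearI) (simp_all add: adj_def vec_eq_iff)

lemma set_integrable_const: "set_integrable lebesgue {0..1::real} (\<lambda>_. c :: real)"
  unfolding set_integrable_def by (intro integrable_scaleR_left integrable_real_indicator) auto

lemma av_form:
  fixes U :: "real \<Rightarrow> complex^'n::finite^'n"
  assumes "set_integrable lebesgue {0..1} U"
  shows "set_integrable lebesgue {0..1} (\<lambda>t. (U t *v x) \<bullet> y)" "av (\<lambda>t. (U t *v x) \<bullet> y) I = (av U I *v x) \<bullet> y"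
  using av_linear[OF assms linear_form[of x y]] by auto

lemma av_psd:
  fixes U :: "real \<Rightarrow> complex^'n::finite^'n"
  assumes U: "set_integrable lebesgue {0..1} U" and psd: "AE x in lebesgue. x \<in> {0..1} \<longrightarrow> psd (U x)"
  shows "psd (av U I)"
proof -
  have "adj (av U I) = av (\<lambda>t. adj (U t)) I" by (simp add: av_linear(2)[OF U linear_adj])
  also have "\<dots> = av U I"
    by (rule av_cong[OF _ av_linear(1)[OF U linear_adj] U])
       (use psd in \<open>auto simp: psd_iff hermitian_iff_adj elim!: eventually_mono\<close>)
  finally have "hermitian (av U I)" by (simp add: hermitian_iff_adj)
  moreover have "0 \<le> (av U I *v x) \<bullet> x" for x
  proof -
    have "set_integrable lebesgue {0..1} (\<lambda>_. 0 :: real)" by (simp add: set_integrable_def)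
    then have "av (\<lambda>_. 0) I \<le> av (\<lambda>t. (U t *v x) \<bullet> x) I"
      by (rule av_mono[OF _ av_form(1)[OF U]]) (use psd in \<open>auto simp: psd_nonneg elim!: eventually_mono\<close>)
    then show ?thesis by (simp add: av_form(2)[OF U] av_eq)
  qed
  ultimately show ?thesis by (simp add: psd_iff)
qed

lemma av_pd:
  fixes U :: "real \<Rightarrow> complex^'n::finite^'n"
  assumes U: "set_integrable lebesgue {0..1} U" and pd: "AE x in lebesgue. x \<in> {0..1} \<longrightarrow> pd (U x)"
  shows "pd (av U I)"
  unfolding pd_def
proof (intro conjI allI impI)
  show "psd (av U I)" by (rule av_psd[OF U]) (use pd in \<open>auto simp: pd_psd elim!: eventually_mono\<close>)
  fix x :: "complex^'n" assume "x \<noteq> 0"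
  then have "0 < av (\<lambda>t. (U t *v x) \<bullet> x) I"
    by (intro av_pos av_form(1)[OF U]) (use pd in \<open>auto simp: pd_pos elim!: eventually_mono\<close>)
  then show "0 < (av U I *v x) \<bullet> x" by (simp add: av_form(2)[OF U])
qed

section \<open>The dyadic maximal function on the tree\<close>

text \<open>The maximal function at depth \<open>h\<close>. Indicators inside the supremum make it visibly measurable.\<close>

definition max_fun :: "(bool list \<Rightarrow> real) \<Rightarrow> nat \<Rightarrow> ennreal \<Rightarrow> bool list \<Rightarrow> real \<Rightarrow> ennreal" where
  "max_fun v h m I x = max m (SUP K\<in>{K. length K \<le> h}. ennreal (v (K @ I)) * indicator (dint (K @ I)) x)"

lemma measurable_max_fun [measurable]: "max_fun v h m I \<in> borel_measurable lebesgue"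
  unfolding max_fun_def[abs_def]
  by (intro borel_measurable_max borel_measurable_SUP borel_measurable_times_ennreal borel_measurable_indicator) auto

lemma nn_integral_dint_split:
  assumes [measurable]: "f \<in> borel_measurable lebesgue"
  shows "(\<integral>\<^sup>+x\<in>dint I. f x \<partial>lebesgue) = (\<integral>\<^sup>+x\<in>dint (False # I). f x \<partial>lebesgue) + (\<integral>\<^sup>+x\<in>dint (True # I). f x \<partial>lebesgue)"
proof -
  have "(\<integral>\<^sup>+x\<in>dint I. f x \<partial>lebesgue) = (\<integral>\<^sup>+x. f x * indicator (dint (False # I)) x + f x * indicator (dint (True # I)) x \<partial>lebesgue)"
  proof (rule nn_integral_cong_AE)
    show "AE x in lebesgue. f x * indicator (dint I) x = f x * indicator (dint (False # I)) x + f x * indicator (dint (True # I)) x"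
      using AE_not_dyadic_pt
    proof eventually_elim
      case (elim x)
      then show ?case using dint_Cons_disjoint[OF elim, of False I True] dint_split[of I] by (auto simp: indicator_def)
    qed
  qed
  then show ?thesis by (simp add: nn_integral_add)
qed

lemma max_fun_step:
  assumes x: "x \<in> dint (b # I)" "x \<notin> dyadic_pts"
  shows "max_fun v (Suc h) m I x = max_fun v h (max m (ennreal (v I))) (b # I) x"
  unfolding max_fun_def
proof (rule antisym)
  let ?t = "\<lambda>K. ennreal (v (K @ I)) * indicator (dint (K @ I)) x"
  let ?t' = "\<lambda>K. ennreal (v (K @ b # I)) * indicator (dint (K @ b # I)) x"
  have "?t K \<le> max (max m (ennreal (v I))) (SUP K\<in>{K. length K \<le> h}. ?t' K)" if K: "length K \<le> Suc h" for K
  proof (cases K rule: rev_cases)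
    case Nil
    have "?t K \<le> ennreal (v I)" by (simp add: Nil indicator_def)
    then show ?thesis by (simp add: le_max_iff_disj)
  next
    case (snoc K' b')
    show ?thesis
    proof (cases "x \<in> dint (K @ I)")
      case True
      then have "x \<in> dint (b' # I)" using dint_append_subset[of K' "b' # I"] snoc by auto
      then have "b' = b" using dint_Cons_disjoint x by blast
      then have "?t K = ?t' K'" using snoc by simp
      also have "\<dots> \<le> (SUP K\<in>{K. length K \<le> h}. ?t' K)" by (rule SUP_upper) (use K snoc in simp)
      finally show ?thesis by (simp add: le_max_iff_disj)
    qed simp
  qed
  then show "max m (SUP K\<in>{K. length K \<le> Suc h}. ?t K) \<le> max (max m (ennreal (v I))) (SUP K\<in>{K. length K \<le> h}. ?t' K)"
    by (intro max.boundedI SUP_least) (auto simp: le_max_iff_disj)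
  have "x \<in> dint I" using x dint_Cons_subset by blast
  then have "ennreal (v I) \<le> (SUP K\<in>{K. length K \<le> Suc h}. ?t K)"
    by (intro SUP_upper2[of "[]"]) auto
  moreover have "?t' K \<le> (SUP K\<in>{K. length K \<le> Suc h}. ?t K)" if "length K \<le> h" for K
    using that by (intro SUP_upper2[of "K @ [b]"]) auto
  ultimately show "max (max m (ennreal (v I))) (SUP K\<in>{K. length K \<le> h}. ?t' K) \<le> max m (SUP K\<in>{K. length K \<le> Suc h}. ?t K)"
    by (intro max.boundedI SUP_least) (auto simp: le_max_iff_disj)
qed

lemma nn_integral_max_fun:
  assumes v: "\<And>I. 0 \<le> v I"
  shows "0 \<le> m \<Longrightarrow> (\<integral>\<^sup>+x\<in>dint I. max_fun v h (ennreal m) I x \<partial>lebesgue) = ennreal (tmax v h I m / 2 ^ length I)"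
proof (induction h arbitrary: I m)
  case 0
  have "max_fun v 0 (ennreal m) I x * indicator (dint I) x = ennreal (max m (v I)) * indicator (dint I) x" for x
    using 0 v by (auto simp: max_fun_def indicator_def max_def)
  then have "(\<integral>\<^sup>+x\<in>dint I. max_fun v 0 (ennreal m) I x \<partial>lebesgue) = ennreal (max m (v I)) * emeasure lebesgue (dint I)"
    by (simp add: nn_integral_cmult_indicator)
  then show ?case using 0 v[of I] by (simp add: emeasure_dint ennreal_mult''[symmetric])
next
  case (Suc h)
  define m' where "m' = max m (v I)"
  have m': "0 \<le> m'" "max (ennreal m) (ennreal (v I)) = ennreal m'" using Suc.prems v[of I] by (auto simp: m'_def max_def)
  have t0: "0 \<le> tmax v h J m'" for J using tmax_ge[of m' v h J] m' by linarith
  have "(\<integral>\<^sup>+x\<in>dint (b # I). max_fun v (Suc h) (ennreal m) I x \<partial>lebesgue) = ennreal (tmax v h (b # I) m' / 2 ^ Suc (length I))" for b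
  proof -
    have "(\<integral>\<^sup>+x\<in>dint (b # I). max_fun v (Suc h) (ennreal m) I x \<partial>lebesgue) = (\<integral>\<^sup>+x\<in>dint (b # I). max_fun v h (ennreal m') (b # I) x \<partial>lebesgue)"
    proof (rule nn_integral_cong_AE)
      show "AE x in lebesgue. max_fun v (Suc h) (ennreal m) I x * indicator (dint (b # I)) x = max_fun v h (ennreal m') (b # I) x * indicator (dint (b # I)) x"
        using AE_not_dyadic_pt by eventually_elim (auto simp: indicator_def max_fun_step m')
    qed
    then show ?thesis using Suc.IH[OF m'(1), of "b # I"] by simp
  qed
  note half = this
  have "(\<integral>\<^sup>+x\<in>dint I. max_fun v (Suc h) (ennreal m) I x \<partial>lebesgue)
    = ennreal (tmax v h (False # I) m' / 2 ^ Suc (length I) + tmax v h (True # I) m' / 2 ^ Suc (length I))"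
    by (subst nn_integral_dint_split[OF measurable_max_fun], unfold half, rule ennreal_plus[symmetric])
       (use t0 in auto)
  also have "tmax v h (False # I) m' / 2 ^ Suc (length I) + tmax v h (True # I) m' / 2 ^ Suc (length I)
    = tmax v (Suc h) I m / 2 ^ length I"
    by (simp add: m'_def add_divide_distrib)
  finally show ?case .
qed

text \<open>The integral of the dyadic maximal function is the limit of its finite-depth versions, by monotone
  convergence.\<close>

lemma nn_integral_dyadic_max:
  assumes v: "\<And>I. 0 \<le> av w I"
  shows "(\<integral>\<^sup>+x\<in>dint I. dyadic_max (dint I) w x \<partial>lebesgue) = (SUP h. ennreal (tmax (av w) h I 0 / 2 ^ length I))"
proof -
  let ?t = "\<lambda>x K. ennreal (av w (K @ I)) * indicator (dint (K @ I)) x"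
  have eq: "dyadic_max (dint I) w x = (SUP h. max_fun (av w) h 0 I x)" if x: "x \<notin> dyadic_pts" for x
  proof (rule antisym)
    show "dyadic_max (dint I) w x \<le> (SUP h. max_fun (av w) h 0 I x)"
      unfolding dyadic_max_def
    proof (rule SUP_least)
      fix I' assume I': "I' \<in> {I' \<in> dyadic. x \<in> I' \<and> I' \<subseteq> dint I}"
      then obtain J where "I' = dint J" "x \<in> dint J" "dint J \<subseteq> dint I" by (auto simp: dyadic_eq)
      moreover obtain K where "J = K @ I" using dint_subset_append[OF _ _ x] calculation by blast
      ultimately have "ennreal (avg I' w) = ?t x K" by (simp add: av_def)
      also have "\<dots> \<le> max_fun (av w) (length K) 0 I x"
        unfolding max_fun_def by (auto intro!: SUP_upper simp: le_max_iff_disj)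
      also have "\<dots> \<le> (SUP h. max_fun (av w) h 0 I x)" by (rule SUP_upper) simp
      finally show "ennreal (avg I' w) \<le> (SUP h. max_fun (av w) h 0 I x)" .
    qed
    have "?t x K \<le> dyadic_max (dint I) w x" for K
    proof (cases "x \<in> dint (K @ I)")
      case True
      then show ?thesis unfolding dyadic_max_def
        by (intro SUP_upper2[of "dint (K @ I)"]) (auto simp: dyadic_eq av_def intro: subsetD[OF dint_append_subset])
    qed simp
    then show "(SUP h. max_fun (av w) h 0 I x) \<le> dyadic_max (dint I) w x"
      unfolding max_fun_def by (intro SUP_least max.boundedI) auto
  qed
  have "(\<integral>\<^sup>+x\<in>dint I. dyadic_max (dint I) w x \<partial>lebesgue) = (\<integral>\<^sup>+x. (SUP h. max_fun (av w) h 0 I x * indicator (dint I) x) \<partial>lebesgue)"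
    by (rule nn_integral_cong_AE) (use AE_not_dyadic_pt in \<open>eventually_elim, simp add: eq SUP_mult_right_ennreal\<close>)
  also have "\<dots> = (SUP h. \<integral>\<^sup>+x. max_fun (av w) h 0 I x * indicator (dint I) x \<partial>lebesgue)"
  proof (rule nn_integral_monotone_convergence_SUP)
    show "incseq (\<lambda>h x. max_fun (av w) h 0 I x * indicator (dint I) x)"
      unfolding incseq_def le_fun_def max_fun_def
      by (intro allI impI mult_right_mono max.mono SUP_subset_mono) auto
  qed measurable
  finally show ?thesis using nn_integral_max_fun[where v = "av w" and m = 0, OF v] by simp
qed

lemma Ainf_char_scalar_le:
  assumes v: "\<And>I. 0 \<le> av w I" and C: "0 \<le> C" "\<And>h I. tmax (av w) h I 0 \<le> C * av w I"
  shows "Ainf_char_scalar w \<le> ennreal C"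
  unfolding Ainf_char_scalar_def
proof (rule Inf_lower, safe)
  fix I' assume "I' \<in> dyadic"
  then obtain I where I: "I' = dint I" by (auto simp: dyadic_eq)
  have "(\<integral>\<^sup>+x\<in>dint I. dyadic_max (dint I) w x \<partial>lebesgue) \<le> ennreal (C * av w I / 2 ^ length I)"
    unfolding nn_integral_dyadic_max[OF v] by (intro SUP_least ennreal_leI divide_right_mono C) simp
  then have "(\<integral>\<^sup>+x\<in>dint I. dyadic_max (dint I) w x \<partial>lebesgue) / emeasure lebesgue (dint I) \<le> ennreal (C * av w I / 2 ^ length I) / ennreal (1 / 2 ^ length I)"
    unfolding emeasure_dint by (rule divide_right_mono_ennreal)
  also have "\<dots> = ennreal C * ennreal (av w I)"
    using C v[of I] by (simp add: divide_ennreal ennreal_mult)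
  finally show "(\<integral>\<^sup>+x\<in>I'. dyadic_max I' w x \<partial>lebesgue) / emeasure lebesgue I' \<le> ennreal C * ennreal (avg I' w)"
    by (simp add: I av_def)
qed

lemma tmax_le_Ainf_char:
  assumes v: "\<And>I. 0 < av w I" and Q: "Ainf_char_scalar w \<le> ennreal Q" "0 \<le> Q"
  shows "tmax (av w) h I 0 \<le> Q * av w I"
proof -
  have v': "0 \<le> av w I" for I using v[of I] by simp
  have t0: "0 \<le> tmax (av w) h I 0" by (rule tmax_ge)
  have "ennreal (tmax (av w) h I 0 / av w I) \<le> Ainf_char_scalar w"
    unfolding Ainf_char_scalar_def
  proof (rule Inf_greatest, safe)
    fix C :: ennreal
    assume "\<forall>I\<in>dyadic. (\<integral>\<^sup>+x\<in>I. dyadic_max I w x \<partial>lebesgue) / emeasure lebesgue I \<le> C * ennreal (avg I w)"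
    then have C: "(\<integral>\<^sup>+x\<in>dint I. dyadic_max (dint I) w x \<partial>lebesgue) / emeasure lebesgue (dint I) \<le> C * ennreal (av w I)"
      by (simp add: dyadic_eq av_def)
    have "ennreal (tmax (av w) h I 0) = ennreal (tmax (av w) h I 0 / 2 ^ length I) / emeasure lebesgue (dint I)"
      using t0 by (simp add: emeasure_dint divide_ennreal)
    also have "\<dots> \<le> (\<integral>\<^sup>+x\<in>dint I. dyadic_max (dint I) w x \<partial>lebesgue) / emeasure lebesgue (dint I)"
      unfolding nn_integral_dyadic_max[OF v'] by (intro divide_right_mono_ennreal SUP_upper) simp
    finally have le: "ennreal (tmax (av w) h I 0) \<le> C * ennreal (av w I)" using C by simp
    show "ennreal (tmax (av w) h I 0 / av w I) \<le> C"
    proof (cases C)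
      case (real c)
      then have "ennreal (tmax (av w) h I 0) \<le> ennreal (c * av w I)" using le v'[of I] by (simp add: ennreal_mult)
      then have "tmax (av w) h I 0 \<le> c * av w I" using real v'[of I] by (simp add: ennreal_le_iff)
      then show ?thesis using real v[of I] by (simp add: ennreal_leI divide_le_eq)
    qed simp
  qed
  then have "ennreal (tmax (av w) h I 0 / av w I) \<le> ennreal Q" using Q(1) by (rule order_trans)
  then have "tmax (av w) h I 0 / av w I \<le> Q" by (simp add: ennreal_le_iff[OF Q(2)])
  then show ?thesis using v[of I] by (simp add: divide_le_eq)
qed

section \<open>Weights of class \<open>A\<^sub>2\<close>\<close>

locale A2_weight =
  fixes W :: "real \<Rightarrow> complex^'n::finite^'n"
  assumes weight: "matrix_weight W" and A2_finite: "A2_char W < \<top>"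
begin

abbreviation V :: "real \<Rightarrow> complex^'n^'n" where "V \<equiv> inv_weight W"

definition A :: real where "A = enn2real (A2_char W)"

lemma A2_char_eq: "A2_char W = ennreal A"
  using A2_finite by (simp add: A_def)

lemma A_nonneg: "0 \<le> A" by (simp add: A_def)

lemma W_integrable: "set_integrable lebesgue {0..1} W"
  using weight by (simp add: matrix_weight_def)

lemma V_integrable: "set_integrable lebesgue {0..1} V"
  using A2_finite by (auto simp: A2_char_def split: if_splits)

lemma AE_psd_invertible: "AE x in lebesgue. x \<in> {0..1} \<longrightarrow> psd (W x) \<and> invertible (W x)"
proof -
  have "AE x in lebesgue_on {0..1}. psd (W x)" using weight by (simp add: matrix_weight_def)
  moreover have "AE x in lebesgue_on {0..1}. invertible (W x)"
    using A2_finite by (auto simp: A2_char_def split: if_splits)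
  ultimately show ?thesis unfolding AE_J01 by eventually_elim auto
qed

lemma pd_W: "pd (av W I)"
  by (rule av_pd[OF W_integrable]) (use AE_psd_invertible in \<open>auto intro: pd_if_invertible elim!: eventually_mono\<close>)

lemma pd_V: "pd (av V I)"
  by (rule av_pd[OF V_integrable])
     (use AE_psd_invertible in \<open>auto simp: inv_weight_def intro: pd_matrix_inv elim!: eventually_mono\<close>)

lemmas psd_W = pd_psd[OF pd_W] and psd_V = pd_psd[OF pd_V]

lemma A2_norm: "(norm (msqrt (av W I) *v (msqrt (av V I) *v x)))\<^sup>2 \<le> A * (norm x)\<^sup>2"
proof -
  define T where "T = msqrt (av W I) ** msqrt (av V I)"
  have "ennreal ((opnorm T)\<^sup>2) \<le> A2_char W"
    using A2_finite unfolding A2_char_def T_def av_def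
    by (auto split: if_splits intro!: SUP_upper2[of "dint I"] simp: dyadic_eq)
  then have op: "(opnorm T)\<^sup>2 \<le> A" by (simp add: A2_char_eq ennreal_le_iff A_nonneg)
  have "norm (T *v x) \<le> opnorm T * norm x"
    unfolding opnorm_def
    by (rule onorm) (use linear_matrix_vector[of T] in \<open>simp add: linear_conv_bounded_linear\<close>)
  then have "(norm (T *v x))\<^sup>2 \<le> (opnorm T * norm x)\<^sup>2" by (intro power_mono) auto
  also have "\<dots> \<le> A * (norm x)\<^sup>2" unfolding power_mult_distrib by (intro mult_right_mono op) auto
  finally show ?thesis by (simp add: T_def matrix_vector_mul_assoc)
qed

text \<open>The inequality \<open>W\<^sub>I \<le> A V\<^sub>I\<^sup>-\<^sup>1\<close>, written without the inverse.\<close>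

lemma A2_form: "(av W I *v (av V I *v u)) \<bullet> (av V I *v u) \<le> A * ((av V I *v u) \<bullet> u)"
proof -
  have "(norm (msqrt (av W I) *v (msqrt (av V I) *v (msqrt (av V I) *v u))))\<^sup>2 \<le> A * (norm (msqrt (av V I) *v u))\<^sup>2"
    by (rule A2_norm)
  also have "msqrt (av V I) *v (msqrt (av V I) *v u) = av V I *v u"
    by (simp add: matrix_vector_mul_assoc msqrt_square[OF psd_V])
  finally show ?thesis by (simp add: norm_msqrt[OF psd_W] norm_msqrt[OF psd_V])
qed

text \<open>A square matrix and its adjoint have the same Hilbert-Schmidt norm.\<close>

lemma A2_trace: "(\<Sum>b\<in>Basis. (av V I *v (msqrt (av W I) *v b)) \<bullet> (msqrt (av W I) *v b)) \<le> real DIM(complex^'n) * A"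
proof -
  define P where "P = msqrt (av W I)"
  define R where "R = msqrt (av V I)"
  have h: "hermitian P" "hermitian R" by (simp_all add: P_def R_def msqrt_hermitian psd_W psd_V)
  have "(\<Sum>b\<in>Basis. (av V I *v (P *v b)) \<bullet> (P *v b)) = (\<Sum>b\<in>Basis. (norm (R *v (P *v b)))\<^sup>2)"
    by (simp add: R_def norm_msqrt[OF psd_V])
  also have "\<dots> = (\<Sum>b\<in>Basis. \<Sum>c\<in>Basis. ((R *v (P *v b)) \<bullet> c)\<^sup>2)" by (simp add: power2_norm_Basis)
  also have "\<dots> = (\<Sum>b\<in>Basis. \<Sum>c\<in>Basis. ((P *v (R *v c)) \<bullet> b)\<^sup>2)"
  proof -
    have "(R *v (P *v b)) \<bullet> c = (P *v (R *v c)) \<bullet> b" for b c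
      by (metis h hermitian_inner inner_commute)
    then show ?thesis by simp
  qed
  also have "\<dots> = (\<Sum>c\<in>Basis. \<Sum>b\<in>Basis. ((P *v (R *v c)) \<bullet> b)\<^sup>2)" by (rule sum.swap)
  also have "\<dots> = (\<Sum>c\<in>Basis. (norm (P *v (R *v c)))\<^sup>2)" by (simp add: power2_norm_Basis)
  also have "\<dots> \<le> (\<Sum>c\<in>(Basis :: (complex^'n) set). A * (norm c)\<^sup>2)"
    unfolding P_def R_def by (intro sum_mono A2_norm)
  also have "\<dots> = real DIM(complex^'n) * A" by simp
  finally show ?thesis by (simp add: P_def)
qed

definition v :: "complex^'n \<Rightarrow> real \<Rightarrow> real" where
  "v e x = (V x *v e) \<bullet> e"

lemma v_integrable: "set_integrable lebesgue {0..1} (v e)"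
  unfolding v_def[abs_def] by (rule av_form(1)[OF V_integrable])

lemma av_v: "av (v e) I = (av V I *v e) \<bullet> e"
  unfolding v_def[abs_def] by (rule av_form(2)[OF V_integrable])

lemma av_v_pos: "e \<noteq> 0 \<Longrightarrow> 0 < av (v e) I"
  by (simp add: av_v pd_pos[OF pd_V])

lemma AE_v_pos: "e \<noteq> 0 \<Longrightarrow> AE x in lebesgue. x \<in> {0..1} \<longrightarrow> 0 < v e x"
  using AE_psd_invertible by eventually_elim (auto simp: v_def inv_weight_def intro: pd_pos pd_matrix_inv)

text \<open>Half of the formula \<open>1 / \<langle>W\<^sup>-\<^sup>1 e, e\<rangle> = min {\<langle>W f, f\<rangle> | \<langle>f, e\<rangle> = 1}\<close>; it bounds the average of \<open>1/v\<close> by a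
  quadratic form of the average of \<open>W\<close>.\<close>

lemma inverse_v_le:
  assumes "f \<bullet> e = 1" "e \<noteq> 0"
  shows "AE x in lebesgue. x \<in> {0..1} \<longrightarrow> 1 / v e x \<le> (W x *v f) \<bullet> f"
  using AE_psd_invertible AE_v_pos[OF assms(2)]
proof eventually_elim
  case (elim x)
  then show ?case using inverse_cauchy_schwarz[of "W x" f e] assms
    by (auto simp: v_def inv_weight_def divide_le_eq)
qed

lemma inverse_v_integrable:
  assumes e: "e \<noteq> 0"
  shows "set_integrable lebesgue {0..1} (\<lambda>x. 1 / v e x)"
proof -
  define f where "f = e /\<^sub>R (e \<bullet> e)"
  have fe: "f \<bullet> e = 1" using e by (simp add: f_def)
  have m: "(\<lambda>x. indicator {0..1} x *\<^sub>R v e x) \<in> borel_measurable lebesgue"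
    using v_integrable[of e] unfolding set_integrable_def by (rule borel_measurable_integrable)
  have m': "(\<lambda>x. indicator {0..1} x *\<^sub>R (1 / v e x)) \<in> borel_measurable lebesgue"
  proof -
    have "(\<lambda>x. 1 / (indicator {0..1} x *\<^sub>R v e x)) \<in> borel_measurable lebesgue" using m by measurable
    moreover have "1 / (indicator {0..1} x *\<^sub>R v e x) = indicator {0..1} x *\<^sub>R (1 / v e x)" for x
      by (simp add: indicator_def)
    ultimately show ?thesis by simp
  qed
  show ?thesis
    unfolding set_integrable_def
  proof (rule Bochner_Integration.integrable_bound[OF av_form(1)[OF W_integrable, of f f, unfolded set_integrable_def] m'])
    show "AE x in lebesgue. norm (indicator {0..1} x *\<^sub>R (1 / v e x)) \<le> norm (indicator {0..1} x *\<^sub>R ((W x *v f) \<bullet> f))"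
      using inverse_v_le[OF fe e] AE_v_pos[OF e]
      by eventually_elim (auto simp: indicator_def)
  qed
qed

text \<open>The scalar weight \<open>v e\<close> has \<open>A\<^sub>2\<close> characteristic at most \<open>A\<close>, so Doob's inequality applies with \<open>s\<close> the
  average of \<open>1/v\<close>.\<close>

lemma tmax_v_le: 
  assumes e: "e \<noteq> 0"
  shows "tmax (av (v e)) h I 0 \<le> 5/2 * A * av (v e) I"
proof (rule tmax_le_5_2_A2)
  define s where "s x = 1 / v e x" for x
  have si: "set_integrable lebesgue {0..1} s" unfolding s_def[abs_def] by (rule inverse_v_integrable[OF e])
  show "mart (av (v e))" "mart (av s)" by (intro mart_av v_integrable si)+
  show spos: "0 < av s I" for I
    by (rule av_pos[OF si]) (use AE_v_pos[OF e] in \<open>auto simp: s_def elim!: eventually_mono\<close>)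
  note vpos = av_v_pos[OF e]
  show "1 \<le> av (v e) I * av s I" for I
  proof -
    \<comment> \<open>averaging \<open>l\<^sup>2 v + 1/v \<ge> 2 l\<close> and choosing this \<open>l\<close> gives the Cauchy-Schwarz inequality\<close>
    define l where "l = 1 / av (v e) I"
    have l0: "0 < l" using vpos[of I] by (simp add: l_def)
    have lin: "linear (\<lambda>y. l\<^sup>2 * y)" by (intro linearI) (simp_all add: algebra_simps)
    have "set_integrable lebesgue {0..1::real} (\<lambda>_. 2 * l)" by (rule set_integrable_const)
    then have "av (\<lambda>_. 2 * l) I \<le> av (\<lambda>x. l\<^sup>2 * v e x + s x) I"
    proof (rule av_mono)
      show "set_integrable lebesgue {0..1} (\<lambda>x. l\<^sup>2 * v e x + s x)"
        using av_linear(1)[OF v_integrable lin] si by (rule set_integral_add)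
      show "AE x in lebesgue. x \<in> {0..1} \<longrightarrow> 2 * l \<le> l\<^sup>2 * v e x + s x"
        using AE_v_pos[OF e]
      proof eventually_elim
        case (elim x)
        show ?case
        proof
          assume "x \<in> {0..1}"
          then have p: "0 < v e x" using elim by simp
          have "0 \<le> (l * v e x - 1)\<^sup>2 / v e x" using p by simp
          also have "\<dots> = l\<^sup>2 * v e x + s x - 2 * l" using p by (simp add: s_def power2_eq_square field_simps)
          finally show "2 * l \<le> l\<^sup>2 * v e x + s x" by simp
        qed
      qed
    qed
    also have "av (\<lambda>x. l\<^sup>2 * v e x + s x) I = l\<^sup>2 * av (v e) I + av s I"
      using av_linear(2)[OF v_integrable lin, of e I] set_integrable_dint[OF av_linear(1)[OF v_integrable lin], of I]
        set_integrable_dint[OF si, of I]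
      by (simp add: av_eq set_integral_add algebra_simps)
    also have "av (\<lambda>_. 2 * l) I = 2 * l"
      by (simp add: av_eq set_lebesgue_integral_def measure_dint)
    finally have "2 * l \<le> l + av s I" using vpos[of I] by (simp add: l_def power2_eq_square)
    then show ?thesis using vpos[of I] by (simp add: l_def field_simps)
  qed
  show "av (v e) I * av s I \<le> A" for I
  proof -
    define R where "R = av V I"
    \<comment> \<open>up to the factor \<open>A\<close>, this vector minimizes the form of the average of \<open>W\<close> subject to \<open>f \<bullet> e = 1\<close>\<close>
    define f where "f = (R *v e) /\<^sub>R ((R *v e) \<bullet> e)"
    have p: "0 < (R *v e) \<bullet> e" using vpos[of I] by (simp add: av_v R_def)
    have fe: "f \<bullet> e = 1" using p by (simp add: f_def)
    have "av s I \<le> av (\<lambda>x. (W x *v f) \<bullet> f) I"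
      by (rule av_mono[OF si av_form(1)[OF W_integrable]]) (use inverse_v_le[OF fe e] in \<open>simp add: s_def\<close>)
    also have "\<dots> = (av W I *v f) \<bullet> f" by (rule av_form(2)[OF W_integrable])
    also have "\<dots> = ((av W I *v (R *v e)) \<bullet> (R *v e)) / ((R *v e) \<bullet> e)\<^sup>2"
      by (simp add: f_def matrix_vector_scaleR power2_eq_square field_simps)
    also have "\<dots> \<le> (A * ((R *v e) \<bullet> e)) / ((R *v e) \<bullet> e)\<^sup>2"
      unfolding R_def by (intro divide_right_mono A2_form) auto
    also have "\<dots> = A / ((R *v e) \<bullet> e)" using p by (simp add: power2_eq_square)
    finally show ?thesis using p by (simp add: av_v R_def[symmetric] field_simps)
  qed
qed

lemma Ainf_char_eq: "Ainf_char V = (SUP e\<in>UNIV - {0}. Ainf_char_scalar (v e))"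
  unfolding Ainf_char_def v_def[abs_def] Re_cinner ..

lemma Ainf_le_A2: "Ainf_char V \<le> ennreal (5/2 * A)"
  unfolding Ainf_char_eq
  by (intro SUP_least Ainf_char_scalar_le tmax_v_le) (use A_nonneg av_v_pos in \<open>auto intro: less_imp_le\<close>)

definition Q :: real where "Q = enn2real (Ainf_char V)"

lemma Ainf_eq: "Ainf_char V = ennreal Q"
  using Ainf_le_A2 unfolding Q_def by (metis ennreal_enn2real ennreal_less_top le_less_trans)

lemma Q_nonneg: "0 \<le> Q" by (simp add: Q_def)

lemma tmax_le_Q:
  assumes e: "e \<noteq> 0"
  shows "tmax (av (v e)) h I 0 \<le> Q * av (v e) I"
proof (rule tmax_le_Ainf_char[OF av_v_pos[OF e] _ Q_nonneg])
  show "Ainf_char_scalar (v e) \<le> ennreal Q"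
    unfolding Ainf_eq[symmetric] Ainf_char_eq by (rule SUP_upper) (use e in simp)
qed

lemma Q_ge_1: "1 \<le> Q"
proof -
  obtain e :: "complex^'n" where e: "e \<noteq> 0" by (metis zero_neq_one)
  have "av (v e) [] \<le> Q * av (v e) []"
    using tmax_ge_v[of "av (v e)" "[]" 0 0] tmax_le_Q[OF e, of 0 "[]"] by linarith
  then show ?thesis using av_v_pos[OF e, of "[]"] by simp
qed

end

section \<open>The square function as a sum over the tree\<close>

text \<open>Lebesgue measure is complete, so measurability passes to functions that agree almost everywhere.\<close>

lemma borel_measurable_lebesgue_AE:
  fixes f g :: "real \<Rightarrow> 'a::topological_space"
  assumes f: "f \<in> borel_measurable lebesgue" and eq: "AE x in lebesgue. f x = g x"
  shows "g \<in> borel_measurable lebesgue"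
proof (rule measurableI)
  fix B :: "'a set" assume B: "B \<in> sets borel"
  have "f -` B \<in> sets lebesgue" using measurable_sets[OF f B] by simp
  moreover have "AE x in lebesgue. x \<in> f -` B \<longleftrightarrow> x \<in> g -` B" using eq by eventually_elim simp
  ultimately show "g -` B \<inter> space lebesgue \<in> sets lebesgue"
    using completion.in_sets_AE[where A = "f -` B" and B = "g -` B" and M = lborel] by simp
qed simp

lemma av_add:
  fixes f g :: "real \<Rightarrow> 'a::euclidean_space"
  assumes "set_integrable lebesgue {0..1} f" "set_integrable lebesgue {0..1} g"
  shows "av (\<lambda>x. f x + g x) I = av f I + av g I"
  using set_integral_add(2)[OF set_integrable_dint[OF assms(1)] set_integrable_dint[OF assms(2)]]
  by (simp add: av_eq scaleR_right_distrib)

lemma measurable_form: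
  fixes M :: "real \<Rightarrow> complex^'n::finite^'n" and f g :: "real \<Rightarrow> complex^'n"
  assumes [measurable]: "M \<in> borel_measurable N" "f \<in> borel_measurable N" "g \<in> borel_measurable N"
  shows "(\<lambda>x. (M x *v f x) \<bullet> g x) \<in> borel_measurable N"
proof -
  have "(M x *v f x) \<bullet> g x = (\<Sum>b\<in>Basis. \<Sum>c\<in>Basis. (f x \<bullet> b) * (g x \<bullet> c) * ((M x *v b) \<bullet> c))" for x
  proof -
    have "(M x *v f x) \<bullet> g x = (M x *v (\<Sum>b\<in>Basis. (f x \<bullet> b) *\<^sub>R b)) \<bullet> (\<Sum>c\<in>Basis. (g x \<bullet> c) *\<^sub>R c)"
      by (simp add: euclidean_representation)
    also have "\<dots> = (\<Sum>b\<in>Basis. \<Sum>c\<in>Basis. (f x \<bullet> b) * (g x \<bullet> c) * ((M x *v b) \<bullet> c))"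
      unfolding linear_sum[OF linear_matrix_vector] inner_sum_left inner_sum_right matrix_vector_scaleR
      by (subst sum.swap) (simp add: mult_ac)
    finally show ?thesis .
  qed
  moreover have "(\<lambda>x. (M x *v b) \<bullet> c) \<in> borel_measurable N" for b c
    using measurable_compose[OF assms(1) borel_measurable_continuous_onI[OF linear_continuous_on]]
      linear_form[of b c] by (simp add: linear_conv_bounded_linear)
  ultimately show ?thesis by simp
qed

lemma esqrt_ennreal: "0 \<le> r \<Longrightarrow> esqrt (ennreal r) = ennreal (sqrt r)"
  by (simp add: esqrt_def)

lemma esqrt_square: "(esqrt x)\<^sup>2 = x"
proof (cases x)
  case (real r)
  then have "(ennreal (sqrt r))\<^sup>2 = ennreal r" by (simp add: ennreal_power)
  then show ?thesis using real by (simp add: esqrt_ennreal)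
qed (simp add: esqrt_def power2_eq_square ennreal_top_mult)

lemma esqrt_mono: "x \<le> y \<Longrightarrow> esqrt x \<le> esqrt y"
  unfolding esqrt_def by (auto simp: top_unique less_top intro!: ennreal_leI enn2real_mono)

lemma measurable_esqrt [measurable]: "esqrt \<in> borel_measurable borel"
  unfolding esqrt_def[abs_def] by measurable

text \<open>Along a sequence of distinct intervals the signs are again independent and uniform.\<close>

lemma signs_eq_distr:
  fixes I :: "nat \<Rightarrow> bool list"
  assumes "inj I"
  shows "(\<lambda>\<sigma> n. \<sigma> (dint (I n))) \<in> measurable random_signs signs"
    "distr random_signs signs (\<lambda>\<sigma> n. \<sigma> (dint (I n))) = signs"
proof -
  have inj: "inj_on (\<lambda>n. dint (I n)) UNIV" using assms inj_dint by (auto simp: inj_on_def)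
  have r: "random_signs = Pi\<^sub>M dyadic (\<lambda>_. coin)" by (simp add: random_signs_def coin_def)
  have "distr (Pi\<^sub>M dyadic (\<lambda>_. coin)) (\<Pi>\<^sub>M i\<in>UNIV. coin) (\<lambda>\<omega>. \<lambda>n\<in>UNIV. \<omega> (dint (I n))) = (\<Pi>\<^sub>M i\<in>UNIV. coin)"
    by (rule distr_PiM_reindex[OF _ inj]) (auto simp: dyadic_eq prob_space_coin)
  then show "distr random_signs signs (\<lambda>\<sigma> n. \<sigma> (dint (I n))) = signs"
    by (simp add: r signs_def restrict_def)
  have "(\<lambda>\<omega>. \<lambda>n\<in>UNIV. \<omega> (dint (I n))) \<in> measurable (Pi\<^sub>M dyadic (\<lambda>_. coin)) (\<Pi>\<^sub>M i\<in>UNIV. coin)"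
    by (intro measurable_restrict measurable_component_singleton) (auto simp: dyadic_eq)
  then show "(\<lambda>\<sigma> n. \<sigma> (dint (I n))) \<in> measurable random_signs signs"
    by (simp add: r signs_def restrict_def)
qed

text \<open>The series converges in the image under \<open>B\<close>, where square summability is known; the inverse of \<open>B\<close>
  carries convergence back, so that \<open>B\<close> may be taken into the sum.\<close>

lemma sign_series_matrix:
  fixes B :: "complex^'n::finite^'n" and a :: "nat \<Rightarrow> complex^'n"
  assumes Bi: "Bi ** B = mat 1" and sm: "summable (\<lambda>n. (norm (B *v a n))\<^sup>2)"
  shows "(\<integral>\<^sup>+\<omega>. ennreal ((norm (B *v (\<Sum>n. \<omega> n *\<^sub>R a n)))\<^sup>2) \<partial>signs) = ennreal (\<Sum>n. (norm (B *v a n))\<^sup>2)"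
proof -
  have bl: "bounded_linear ((*v) X)" for X :: "complex^'n^'n"
    using linear_matrix_vector[of X] by (simp add: linear_conv_bounded_linear)
  have "AE \<omega> in signs. summable (\<lambda>n. \<omega> n *\<^sub>R (B *v a n))" by (rule sign_series_AE_summable[OF sm])
  then have "AE \<omega> in signs. B *v (\<Sum>n. \<omega> n *\<^sub>R a n) = (\<Sum>n. \<omega> n *\<^sub>R (B *v a n))"
  proof eventually_elim
    case (elim \<omega>)
    have "summable (\<lambda>n. Bi *v (\<omega> n *\<^sub>R (B *v a n)))" by (rule bounded_linear.summable[OF bl elim])
    then have "summable (\<lambda>n. \<omega> n *\<^sub>R a n)"
      by (simp add: matrix_vector_scaleR matrix_vector_mul_assoc Bi)
    from bounded_linear.suminf[OF bl this] show ?case by (simp add: matrix_vector_scaleR)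
  qed
  then have "(\<integral>\<^sup>+\<omega>. ennreal ((norm (B *v (\<Sum>n. \<omega> n *\<^sub>R a n)))\<^sup>2) \<partial>signs)
     = (\<integral>\<^sup>+\<omega>. ennreal ((norm (\<Sum>n. \<omega> n *\<^sub>R (B *v a n)))\<^sup>2) \<partial>signs)"
    by (intro nn_integral_cong_AE) (auto elim!: eventually_mono)
  then show ?thesis by (simp add: sign_series_L2[OF sm])
qed

text \<open>At a dyadic point two intervals of a generation may contain \<open>x\<close>; the choice is irrelevant because such
  points form a null set.\<close>

definition word_at :: "real \<Rightarrow> nat \<Rightarrow> bool list" where
  "word_at x n = (SOME I. length I = n \<and> x \<in> dint I)"

lemma word_at:
  assumes "x \<in> {0..1}"
  shows "length (word_at x n) = n" "x \<in> dint (word_at x n)"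
  using someI_ex[OF dint_exists[OF assms, of n]] by (auto simp: word_at_def)

lemma word_at_unique:
  assumes "x \<in> {0..1}" "x \<notin> dyadic_pts" "length I = n" "x \<in> dint I"
  shows "I = word_at x n"
  using dint_unique[of I "word_at x n" x] assms word_at[OF assms(1)] by simp

lemma haar_dint: "haar (dint I) x = (indicator (dint (True # I)) x - indicator (dint (False # I)) x) * sqrt (2 ^ length I)"
  by (simp add: haar_def left_half_dint right_half_dint measure_dint real_sqrt_divide)

lemma haar_outside: "x \<notin> dint I \<Longrightarrow> haar (dint I) x = 0"
  using dint_Cons_subset[of True I] dint_Cons_subset[of False I] by (auto simp: haar_dint indicator_def)

lemma haar_coeff_dint:
  assumes f: "set_integrable lebesgue {0..1} f"
  shows "haar_coeff f (dint I) = (1 / sqrt (2 ^ length I)) *\<^sub>R dif (av f) I"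
proof -
  have i: "integrable lebesgue (\<lambda>x. indicator (dint K) x *\<^sub>R f x)" for K
    using set_integrable_dint[OF f] by (simp add: set_integrable_def)
  have "haar_coeff f (dint I) = (LINT x|lebesgue. sqrt (2 ^ length I) *\<^sub>R
      (indicator (dint (True # I)) x *\<^sub>R f x - indicator (dint (False # I)) x *\<^sub>R f x))"
    unfolding haar_coeff_def set_lebesgue_integral_def
  proof (rule Bochner_Integration.integral_cong[OF refl])
    fix x
    have "x \<in> dint K \<Longrightarrow> x \<in> {0..1}" for K using dint_subset by blast
    then show "indicator {0..1} x *\<^sub>R haar (dint I) x *\<^sub>R f x = sqrt (2 ^ length I) *\<^sub>R
      (indicator (dint (True # I)) x *\<^sub>R f x - indicator (dint (False # I)) x *\<^sub>R f x)"
      by (cases "x \<in> {0..1}") (auto simp: haar_dint indicator_def scaleR_diff_left)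
  qed
  also have "\<dots> = sqrt (2 ^ length I) *\<^sub>R ((1 / 2 ^ Suc (length I)) *\<^sub>R av f (True # I) - (1 / 2 ^ Suc (length I)) *\<^sub>R av f (False # I))"
    using i integral_dint[of "True # I" f] integral_dint[of "False # I" f] by (simp add: set_lebesgue_integral_def)
  also have "\<dots> = (sqrt (2 ^ length I) / 2 ^ length I) *\<^sub>R dif (av f) I"
    by (simp add: dif_def scaleR_right_diff_distrib mult.commute)
  also have "sqrt (2 ^ length I) / 2 ^ length I = 1 / sqrt (2 ^ length I)"
    by (simp add: field_simps)
  finally show ?thesis .
qed

lemma T_sigma_word_at:
  assumes x: "x \<in> {0..1}" "x \<notin> dyadic_pts"
  shows "T_sigma \<sigma> f x = (\<Sum>n. \<sigma> (dint (word_at x n)) *\<^sub>R (haar (dint (word_at x n)) x *\<^sub>R haar_coeff f (dint (word_at x n))))"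
  unfolding T_sigma_def
proof (rule arg_cong[where f = suminf], rule ext)
  fix n
  let ?t = "\<lambda>I. (\<sigma> (dint I) * haar (dint I) x) *\<^sub>R haar_coeff f (dint I)"
  have "(\<Sum>I\<in>dyadic_gen n. (\<sigma> I * haar I x) *\<^sub>R haar_coeff f I) = (\<Sum>I | length I = n. ?t I)"
    by (rule sum_dyadic_gen)
  also have "\<dots> = (\<Sum>I\<in>{word_at x n}. ?t I)"
  proof (rule sum.mono_neutral_right)
    show "\<forall>I\<in>{I. length I = n} - {word_at x n}. ?t I = 0"
      using word_at_unique[OF x] haar_outside by auto
  qed (auto simp: finite_words word_at[OF x(1)])
  finally show "(\<Sum>I\<in>dyadic_gen n. (\<sigma> I * haar I x) *\<^sub>R haar_coeff f I)
      = \<sigma> (dint (word_at x n)) *\<^sub>R (haar (dint (word_at x n)) x *\<^sub>R haar_coeff f (dint (word_at x n)))"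
    by simp
qed

context A2_weight
begin

text \<open>The square of the square function, as a sum over all dyadic intervals; the factor \<open>1/|I|\<close> of its usual
  form has cancelled against the normalization of the Haar coefficients.\<close>

abbreviation square_sum :: "(real \<Rightarrow> complex^'n) \<Rightarrow> nat \<Rightarrow> real" where
  "square_sum f h \<equiv> tsum (\<lambda>I. (av W I *v dif (av f) I) \<bullet> dif (av f) I) h []"

definition tree_square :: "(real \<Rightarrow> complex^'n) \<Rightarrow> real \<Rightarrow> ennreal" where
  "tree_square f x = (\<Sum>n. \<Sum>I | length I = n. ennreal ((W x *v dif (av f) I) \<bullet> dif (av f) I) * indicator (dint I) x)"

text \<open>Where the sum is finite, Khintchine's identity applies to the Haar series at \<open>x\<close>. The terms of that
  series are \<open>\<plusminus> dif (av f) I\<close> along the intervals that contain \<open>x\<close>.\<close>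

lemma square_fun_eq:
  assumes f: "set_integrable lebesgue {0..1} f"
    and x: "x \<in> {0..1}" "x \<notin> dyadic_pts" and W: "psd (W x)" "invertible (W x)"
    and fin: "tree_square f x < \<top>"
  shows "(square_fun W f x)\<^sup>2 = tree_square f x"
proof -
  define d where "d n = dif (av f) (word_at x n)" for n
  define a where "a n = haar (dint (word_at x n)) x *\<^sub>R haar_coeff f (dint (word_at x n))" for n
  define B where "B = msqrt (W x)"
  obtain Bi where Bi: "Bi ** B = mat 1"
    using pd_sqrt_inverse[OF pd_if_invertible[OF W]] unfolding B_def by metis
  have a: "(norm (B *v a n))\<^sup>2 = (W x *v d n) \<bullet> d n" for n
  proof -
    have "x \<in> dint (word_at x n)" by (rule word_at(2)[OF x(1)])
    then consider "x \<in> dint (True # word_at x n)" "x \<notin> dint (False # word_at x n)"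
      | "x \<in> dint (False # word_at x n)" "x \<notin> dint (True # word_at x n)"
      using dint_split[of "word_at x n"] dint_Cons_disjoint[OF x(2), of True "word_at x n" False] by auto
    then have "a n = d n \<or> a n = - d n"
      by cases (auto simp: a_def d_def haar_dint haar_coeff_dint[OF f] word_at(1)[OF x(1)])
    then have "(norm (B *v a n))\<^sup>2 = (norm (B *v d n))\<^sup>2"
      by (auto simp: linear_neg[OF linear_matrix_vector])
    then show ?thesis by (simp add: B_def norm_msqrt[OF W(1)])
  qed
  have nn: "0 \<le> (W x *v d n) \<bullet> d n" for n by (rule psd_nonneg[OF W(1)])
  have gen: "(\<Sum>I | length I = n. ennreal ((W x *v dif (av f) I) \<bullet> dif (av f) I) * indicator (dint I) x) = ennreal ((W x *v d n) \<bullet> d n)" for n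
  proof -
    have "(\<Sum>I | length I = n. ennreal ((W x *v dif (av f) I) \<bullet> dif (av f) I) * indicator (dint I) x)
      = (\<Sum>I\<in>{word_at x n}. ennreal ((W x *v dif (av f) I) \<bullet> dif (av f) I) * indicator (dint I) x)"
    proof (rule sum.mono_neutral_right)
      show "\<forall>I\<in>{I. length I = n} - {word_at x n}. ennreal ((W x *v dif (av f) I) \<bullet> dif (av f) I) * indicator (dint I) x = 0"
        using word_at_unique[OF x] by (auto simp: indicator_def)
    qed (auto simp: finite_words word_at[OF x(1)])
    then show ?thesis using word_at(2)[OF x(1), of n] by (simp add: d_def)
  qed
  have tree: "tree_square f x = (\<Sum>n. ennreal ((W x *v d n) \<bullet> d n))" by (simp add: tree_square_def gen)
  have sm: "summable (\<lambda>n. (W x *v d n) \<bullet> d n)"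
    using fin unfolding tree by (rule summable_suminf_not_top[OF nn, OF less_imp_neq])
  have inj: "inj (word_at x)" by (rule injI) (metis word_at(1)[OF x(1)])
  have m: "(\<lambda>\<omega>. ennreal ((norm (B *v (\<Sum>n. \<omega> n *\<^sub>R a n)))\<^sup>2)) \<in> borel_measurable signs"
  proof -
    have "bounded_linear ((*v) B)" using linear_matrix_vector[of B] by (simp add: linear_conv_bounded_linear)
    then have [measurable]: "(*v) B \<in> borel_measurable borel"
      by (intro borel_measurable_continuous_onI linear_continuous_on)
    note [measurable] = measurable_sign
    show ?thesis by measurable
  qed
  have "(square_fun W f x)\<^sup>2 = (\<integral>\<^sup>+\<sigma>. ennreal ((norm (B *v (\<Sum>n. \<sigma> (dint (word_at x n)) *\<^sub>R a n)))\<^sup>2) \<partial>random_signs)"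
    by (simp add: square_fun_def esqrt_square B_def T_sigma_word_at[OF x] a_def)
  also have "\<dots> = (\<integral>\<^sup>+\<omega>. ennreal ((norm (B *v (\<Sum>n. \<omega> n *\<^sub>R a n)))\<^sup>2) \<partial>distr random_signs signs (\<lambda>\<sigma> n. \<sigma> (dint (word_at x n))))"
    by (subst nn_integral_distr[OF signs_eq_distr(1)[OF inj]]) (use m in auto)
  also have "\<dots> = ennreal (\<Sum>n. (norm (B *v a n))\<^sup>2)"
    unfolding signs_eq_distr(2)[OF inj] by (rule sign_series_matrix[OF Bi]) (simp add: a sm)
  also have "\<dots> = tree_square f x"
    unfolding tree a by (rule suminf_ennreal2[OF nn sm, symmetric])
  finally show ?thesis .
qed

lemma tree_square_integral:
  fixes f :: "real \<Rightarrow> complex^'n"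
  shows "(\<integral>\<^sup>+x. tree_square f x \<partial>lebesgue)
    = (SUP h. ennreal (square_sum f h))"
    and "(\<lambda>x. tree_square f x * indicator {0..1} x) \<in> borel_measurable lebesgue"
    and "tree_square f x * indicator {0..1} x = tree_square f x"
proof -
  define d where "d = dif (av f)"
  define c where "c I = (av W I *v d I) \<bullet> d I" for I
  have c0: "0 \<le> c I" for I unfolding c_def by (rule psd_nonneg[OF psd_W])
  have mI: "(\<lambda>x. ennreal ((W x *v d I) \<bullet> d I) * indicator (dint I) x) \<in> borel_measurable lebesgue" for I
  proof -
    have "(\<lambda>x. indicator (dint I) x *\<^sub>R ((W x *v d I) \<bullet> d I)) \<in> borel_measurable lebesgue"
      using set_integrable_dint[OF av_form(1)[OF W_integrable]] unfolding set_integrable_def by (rule borel_measurable_integrable)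
    then have "(\<lambda>x. ennreal (indicator (dint I) x *\<^sub>R ((W x *v d I) \<bullet> d I))) \<in> borel_measurable lebesgue" by measurable
    moreover have "ennreal (indicator (dint I) x *\<^sub>R ((W x *v d I) \<bullet> d I)) = ennreal ((W x *v d I) \<bullet> d I) * indicator (dint I) x" for x
      by (simp add: indicator_def)
    ultimately show ?thesis by simp
  qed
  have mn: "(\<lambda>x. \<Sum>I | length I = n. ennreal ((W x *v d I) \<bullet> d I) * indicator (dint I) x) \<in> borel_measurable lebesgue" for n
    using mI by (intro borel_measurable_sum)
  have out: "tree_square f x * indicator {0..1} x = tree_square f x" for x
  proof (cases "x \<in> {0..1}")
    case False
    then have "x \<notin> dint I" for I using dint_subset by blast
    then show ?thesis by (simp add: tree_square_def)
  qed simp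
  then show "tree_square f x * indicator {0..1} x = tree_square f x" .
  have "(\<lambda>x. tree_square f x) \<in> borel_measurable lebesgue"
    unfolding tree_square_def d_def[symmetric] using mn by (intro borel_measurable_suminf_order)
  then show "(\<lambda>x. tree_square f x * indicator {0..1} x) \<in> borel_measurable lebesgue" by (simp add: out)
  have "(\<integral>\<^sup>+x. tree_square f x \<partial>lebesgue) = (\<Sum>n. \<integral>\<^sup>+x. (\<Sum>I | length I = n. ennreal ((W x *v d I) \<bullet> d I) * indicator (dint I) x) \<partial>lebesgue)"
    unfolding tree_square_def d_def[symmetric] by (rule nn_integral_suminf) (rule mn)
  also have "\<dots> = (\<Sum>n. ennreal ((1 / 2 ^ n) * (\<Sum>I | length I = n. c I)))"
  proof (rule suminf_cong)
    fix n
    have "(\<integral>\<^sup>+x. (\<Sum>I | length I = n. ennreal ((W x *v d I) \<bullet> d I) * indicator (dint I) x) \<partial>lebesgue)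
      = (\<Sum>I | length I = n. \<integral>\<^sup>+x. ennreal ((W x *v d I) \<bullet> d I) * indicator (dint I) x \<partial>lebesgue)"
      by (rule nn_integral_sum) (rule mI)
    also have "\<dots> = (\<Sum>I | length I = n. ennreal (c I / 2 ^ n))"
    proof (rule sum.cong[OF refl])
      fix I :: "bool list" assume "I \<in> {I. length I = n}"
      then have n: "length I = n" by simp
      have "AE x in lebesgue. x \<in> {0..1} \<longrightarrow> 0 \<le> (W x *v d I) \<bullet> d I"
        using AE_psd_invertible by eventually_elim (auto intro: psd_nonneg)
      then show "(\<integral>\<^sup>+x. ennreal ((W x *v d I) \<bullet> d I) * indicator (dint I) x \<partial>lebesgue) = ennreal (c I / 2 ^ n)"
        using nn_integral_dint[OF av_form(1)[OF W_integrable], of "d I" "d I" I]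
        by (simp add: av_form(2)[OF W_integrable] c_def n)
    qed
    also have "\<dots> = ennreal (\<Sum>I | length I = n. c I / 2 ^ n)" using c0 by (intro sum_ennreal) auto
    also have "(\<Sum>I | length I = n. c I / 2 ^ n) = (1 / 2 ^ n) * (\<Sum>I | length I = n. c I)"
      by (simp add: sum_divide_distrib)
    finally show "(\<integral>\<^sup>+x. (\<Sum>I | length I = n. ennreal ((W x *v d I) \<bullet> d I) * indicator (dint I) x) \<partial>lebesgue)
      = ennreal ((1 / 2 ^ n) * (\<Sum>I | length I = n. c I))" .
  qed
  also have "\<dots> = (SUP h. \<Sum>n<h. ennreal ((1 / 2 ^ n) * (\<Sum>I | length I = n. c I)))"
    by (rule suminf_eq_SUP)
  also have "\<dots> = (SUP h. ennreal (tsum c h []))"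
    by (simp add: tsum_eq_sum sum_ennreal c0 sum_nonneg del: sum_divide_distrib)
  finally show "(\<integral>\<^sup>+x. tree_square f x \<partial>lebesgue) = (SUP h. ennreal (square_sum f h))"
    by (simp add: c_def[abs_def] d_def)
qed

text \<open>A bound for the sums over the tree makes the sum at almost every point finite, and only then does
  the identity hold almost everywhere.\<close>

lemma square_fun_L2:
  assumes f: "set_integrable lebesgue {0..1} f"
    and bd: "\<And>h. square_sum f h \<le> E"
  shows "square_fun W f \<in> L2" 
    "(\<integral>\<^sup>+x\<in>{0..1}. (square_fun W f x)\<^sup>2 \<partial>lebesgue)
      = (SUP h. ennreal (square_sum f h))"
proof -
  have le: "(\<integral>\<^sup>+x. tree_square f x \<partial>lebesgue) \<le> ennreal E"
    unfolding tree_square_integral(1) by (intro SUP_least ennreal_leI bd)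
  have m: "tree_square f \<in> borel_measurable lebesgue"
    using tree_square_integral(2)[of f] by (simp add: tree_square_integral(3))
  have "AE x in lebesgue. tree_square f x \<noteq> \<infinity>"
    by (rule nn_integral_noteq_infinite[OF m]) (use le in \<open>auto simp: top_unique\<close>)
  then have eq: "AE x in lebesgue. x \<in> {0..1} \<longrightarrow> (square_fun W f x)\<^sup>2 = tree_square f x"
    using AE_psd_invertible AE_not_dyadic_pt
    by eventually_elim (auto intro!: square_fun_eq[OF f] simp: less_top)
  then have "(\<integral>\<^sup>+x\<in>{0..1}. (square_fun W f x)\<^sup>2 \<partial>lebesgue) = (\<integral>\<^sup>+x. tree_square f x * indicator {0..1} x \<partial>lebesgue)"
    by (intro nn_integral_cong_AE) (auto simp: indicator_def elim!: eventually_mono)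
  also have "\<dots> = (SUP h. ennreal (square_sum f h))"
    by (simp only: tree_square_integral(1,3))
  finally show int: "(\<integral>\<^sup>+x\<in>{0..1}. (square_fun W f x)\<^sup>2 \<partial>lebesgue)
      = (SUP h. ennreal (square_sum f h))" .
  have "square_fun W f x = esqrt ((square_fun W f x)\<^sup>2)" for x
    unfolding square_fun_def esqrt_square ..
  then have "AE x in lebesgue. esqrt (tree_square f x) * indicator {0..1} x = square_fun W f x * indicator {0..1} x"
    using eq by (auto simp: indicator_def elim!: eventually_mono) metis
  moreover have "(\<lambda>x. esqrt (tree_square f x) * indicator {0..1} x) \<in> borel_measurable lebesgue"
    by (intro borel_measurable_times_ennreal measurable_compose[OF m measurable_esqrt] borel_measurable_indicator) simp
  ultimately have "(\<lambda>x. square_fun W f x * indicator {0..1} x) \<in> borel_measurable lebesgue"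
    by (rule borel_measurable_lebesgue_AE[rotated])
  then have meas: "square_fun W f \<in> borel_measurable (lebesgue_on {0..1})"
    by (subst borel_measurable_restrict_space_iff_ennreal) auto
  have "(\<integral>\<^sup>+x\<in>{0..1}. (square_fun W f x)\<^sup>2 \<partial>lebesgue) \<le> ennreal E"
    unfolding int by (intro SUP_least ennreal_leI bd)
  then have "L2_norm (square_fun W f) \<le> esqrt (ennreal E)"
    unfolding L2_norm_def by (rule esqrt_mono)
  also have "\<dots> < \<top>" by (simp add: esqrt_def)
  finally show "square_fun W f \<in> L2" using meas by (simp add: L2_def)
qed

section \<open>The weighted space\<close>

definition energy :: "(real \<Rightarrow> complex^'n) \<Rightarrow> real \<Rightarrow> real" where
  "energy f x = (W x *v f x) \<bullet> f x"

lemma AE_energy_nonneg: "AE x in lebesgue. x \<in> {0..1} \<longrightarrow> 0 \<le> energy f x"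
  using AE_psd_invertible by eventually_elim (auto simp: energy_def intro: psd_nonneg)

lemma energy_measurable:
  assumes "f \<in> borel_measurable (lebesgue_on {0..1})"
  shows "(\<lambda>x. indicator {0..1} x *\<^sub>R energy f x) \<in> borel_measurable lebesgue"
proof -
  have "(\<lambda>x. indicator {0..1} x *\<^sub>R W x) \<in> borel_measurable lebesgue"
    using W_integrable unfolding set_integrable_def by (rule borel_measurable_integrable)
  moreover have "(\<lambda>x. indicator {0..1} x *\<^sub>R f x) \<in> borel_measurable lebesgue"
    using assms by (subst (asm) borel_measurable_restrict_space_iff) auto
  ultimately have "(\<lambda>x. ((indicator {0..1} x *\<^sub>R W x) *v (indicator {0..1} x *\<^sub>R f x)) \<bullet> (indicator {0..1} x *\<^sub>R f x)) \<in> borel_measurable lebesgue"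
    by (intro measurable_form)
  moreover have "((indicator {0..1} x *\<^sub>R W x) *v (indicator {0..1} x *\<^sub>R f x)) \<bullet> (indicator {0..1} x *\<^sub>R f x) = indicator {0..1} x *\<^sub>R energy f x" for x
    by (cases "x \<in> {0..1}") (auto simp: energy_def)
  ultimately show ?thesis by (simp only:)
qed

lemma nn_integral_L2W:
  "(\<integral>\<^sup>+x\<in>{0..1}. ennreal ((norm (msqrt (W x) *v f x))\<^sup>2) \<partial>lebesgue) = (\<integral>\<^sup>+x\<in>{0..1}. ennreal (energy f x) \<partial>lebesgue)"
proof (rule nn_integral_cong_AE)
  show "AE x in lebesgue. ennreal ((norm (msqrt (W x) *v f x))\<^sup>2) * indicator {0..1} x = ennreal (energy f x) * indicator {0..1} x"
    using AE_psd_invertible by eventually_elim (auto simp: indicator_def energy_def norm_msqrt)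
qed

text \<open>Functions in the weighted space are integrable, because every component of \<open>f\<close> is dominated by the energy
  plus an entry of \<open>V\<close>; so their Haar coefficients make sense.\<close>

lemma L2W_integrable:
  assumes f: "f \<in> L2W W"
  shows "set_integrable lebesgue {0..1} (energy f)" "L2W_norm W f = ennreal (sqrt (av (energy f) []))"
    "set_integrable lebesgue {0..1} f"
proof -
  have fm: "f \<in> borel_measurable (lebesgue_on {0..1})" and fin: "L2W_norm W f < \<top>"
    using f by (auto simp: L2W_def)
  have "(\<integral>\<^sup>+x\<in>{0..1}. ennreal (energy f x) \<partial>lebesgue) < \<top>"
    using fin unfolding L2W_norm_def nn_integral_L2W esqrt_def by (auto simp: less_top split: if_splits)
  also have "(\<integral>\<^sup>+x\<in>{0..1}. ennreal (energy f x) \<partial>lebesgue) = (\<integral>\<^sup>+x. ennreal (norm (indicator {0..1} x *\<^sub>R energy f x)) \<partial>lebesgue)"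
    by (rule nn_integral_cong_AE) (use AE_energy_nonneg[of f] in \<open>auto simp: indicator_def elim!: eventually_mono\<close>)
  finally show ei: "set_integrable lebesgue {0..1} (energy f)"
    unfolding set_integrable_def integrable_iff_bounded using energy_measurable[OF fm] by auto
  have "(\<integral>\<^sup>+x\<in>{0..1}. ennreal (energy f x) \<partial>lebesgue) = ennreal (av (energy f) [])"
    using nn_integral_dint[OF ei AE_energy_nonneg, of "[]"] by (simp add: dint_Nil)
  moreover have "0 \<le> av (energy f) []"
    using av_mono[OF set_integrable_const[of 0] ei AE_energy_nonneg, of "[]"] by (simp add: av_eq)
  ultimately show "L2W_norm W f = ennreal (sqrt (av (energy f) []))"
    unfolding L2W_norm_def nn_integral_L2W by (simp add: esqrt_ennreal)
  define g where "g x = (\<Sum>b\<in>Basis. energy f x + (V x *v b) \<bullet> b)" for x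
  have gi: "integrable lebesgue (\<lambda>x. indicator {0..1} x *\<^sub>R g x)"
  proof -
    have "integrable lebesgue (\<lambda>x. \<Sum>b\<in>Basis. indicator {0..1} x *\<^sub>R energy f x + indicator {0..1} x *\<^sub>R ((V x *v b) \<bullet> b))"
      using ei av_form(1)[OF V_integrable] unfolding set_integrable_def
      by (intro Bochner_Integration.integrable_sum Bochner_Integration.integrable_add)
    then show ?thesis by (simp add: g_def sum_distrib_left algebra_simps)
  qed
  show "set_integrable lebesgue {0..1} f"
    unfolding set_integrable_def
  proof (rule Bochner_Integration.integrable_bound[OF gi])
    show "(\<lambda>x. indicator {0..1} x *\<^sub>R f x) \<in> borel_measurable lebesgue"
      using fm by (subst (asm) borel_measurable_restrict_space_iff) auto
    show "AE x in lebesgue. norm (indicator {0..1} x *\<^sub>R f x) \<le> norm (indicator {0..1} x *\<^sub>R g x)"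
      using AE_psd_invertible
    proof eventually_elim
      case (elim x)
      show ?case
      proof (cases "x \<in> {0..1}")
        case True
        then have W: "psd (W x)" "invertible (W x)" using elim by auto
        have nb: "\<bar>f x \<bullet> b\<bar> \<le> energy f x + (V x *v b) \<bullet> b" for b
          using energy_inequality[OF W, of "f x" b] energy_inequality[OF W, of "f x" "- b"]
            psd_nonneg[OF W(1), of "f x"] psd_nonneg[OF pd_psd[OF pd_matrix_inv[OF W]], of b]
          by (simp add: energy_def inv_weight_def linear_neg[OF linear_matrix_vector] abs_le_iff)
        have "norm (f x) \<le> (\<Sum>b\<in>Basis. \<bar>f x \<bullet> b\<bar>)" by (rule norm_le_l1)
        also have "\<dots> \<le> g x" unfolding g_def by (intro sum_mono nb)
        finally show ?thesis using True by simp
      qed simp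
    qed
  qed
qed

lemma energy_tree:
  assumes f: "f \<in> L2W W"
  shows "2 * (av f I \<bullet> u) \<le> av (energy f) I + (av V I *v u) \<bullet> u"
proof -
  note ei = L2W_integrable(1)[OF f] and fi = L2W_integrable(3)[OF f]
  have lin: "linear (\<lambda>y::complex^'n. 2 * (y \<bullet> u))" by (intro linearI) (simp_all add: inner_add_left algebra_simps)
  have "2 * (av f I \<bullet> u) = av (\<lambda>x. 2 * (f x \<bullet> u)) I" by (rule av_linear(2)[OF fi lin, symmetric])
  also have "\<dots> \<le> av (\<lambda>x. energy f x + (V x *v u) \<bullet> u) I"
  proof (rule av_mono[OF av_linear(1)[OF fi lin]])
    show "set_integrable lebesgue {0..1} (\<lambda>x. energy f x + (V x *v u) \<bullet> u)"
      by (rule set_integral_add(1)[OF ei av_form(1)[OF V_integrable]])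
    show "AE x in lebesgue. x \<in> {0..1} \<longrightarrow> 2 * (f x \<bullet> u) \<le> energy f x + (V x *v u) \<bullet> u"
      using AE_psd_invertible by eventually_elim (auto simp: energy_def inv_weight_def intro: energy_inequality)
  qed
  also have "\<dots> = av (energy f) I + (av V I *v u) \<bullet> u"
    by (simp add: av_add[OF ei av_form(1)[OF V_integrable]] av_form(2)[OF V_integrable])
  finally show ?thesis .
qed

section \<open>The upper bound\<close>

lemma A_pos: "0 < A"
proof -
  obtain e :: "complex^'n" where e: "e \<noteq> 0" by (metis zero_neq_one)
  have "av (v e) [] \<le> 5/2 * A * av (v e) []"
    using tmax_ge_v[of "av (v e)" "[]" 0 0] tmax_v_le[OF e, of 0 "[]"] by linarith
  then show ?thesis using av_v_pos[OF e, of "[]"] by (simp add: mult_le_cancel_right1)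
qed

text \<open>The testing estimate ends in the maximal function of \<open>v e\<close>, and \<open>Q\<close> is the constant in the bound for its
  averages.\<close>

lemma carleson_condition:
  "tsum (\<lambda>I. (av W I *v (dif (av V) I *v e)) \<bullet> (dif (av V) I *v e)) h I
    \<le> (1728 * (real DIM(complex^'n))\<^sup>2 * A * Q) * ((av V I *v e) \<bullet> e)"
proof (cases "e = 0")
  case True
  have "tsum (\<lambda>I. 0 :: real) h I = 0" for I by (induction h arbitrary: I) auto
  then show ?thesis using True by simp
next
  case False
  define D where "D = real DIM(complex^'n)"
  have "tsum (\<lambda>I. (av W I *v (dif (av V) I *v e)) \<bullet> (dif (av V) I *v e)) h I
    \<le> 1728 * D * (D * A) * tmax (\<lambda>I. (av V I *v e) \<bullet> e) h I 0"
    unfolding D_def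
    by (rule testing_tree[OF mart_av[OF W_integrable] mart_av[OF V_integrable] pd_W pd_V False A2_trace])
  also have "(\<lambda>I. (av V I *v e) \<bullet> e) = av (v e)" by (rule ext) (simp add: av_v)
  also have "1728 * D * (D * A) * tmax (av (v e)) h I 0 \<le> 1728 * D * (D * A) * (Q * av (v e) I)"
    by (intro mult_left_mono tmax_le_Q False) (use A_pos in \<open>simp add: D_def\<close>)
  also have "\<dots> = (1728 * D\<^sup>2 * A * Q) * ((av V I *v e) \<bullet> e)"
    by (simp add: av_v power2_eq_square)
  finally show ?thesis by (simp add: D_def)
qed

end

definition upper_const :: "'n::finite itself \<Rightarrow> real \<Rightarrow> real" where
  "upper_const _ C = 4 + 2 * (real CARD('n) + 1)^3 * C\<^sup>2 * 1728 * (real DIM(complex^'n))\<^sup>2"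

context A2_weight
begin

lemma square_sum_bound:
  assumes C: "interp_const TYPE('n) C" and f: "f \<in> L2W W"
  shows "square_sum f h
    \<le> upper_const TYPE('n) C * (A * Q) * av (energy f) []"
proof -
  define k where "k = 1728 * (real DIM(complex^'n))\<^sup>2"
  have k0: "0 < k" by (simp add: k_def)
  note Q = Q_ge_1 and A = A_pos
  have e0: "0 \<le> av (energy f) []"
    using av_mono[OF set_integrable_const[of 0] L2W_integrable(1)[OF f] AE_energy_nonneg, of "[]"] by (simp add: av_eq)
  have "square_sum f h
    \<le> (4 * A + 2 * (real CARD('n) + 1)^3 * C\<^sup>2 * (k * A * Q)) * av (energy f) []"
  proof (rule embedding_tree[OF mart_av[OF V_integrable] mart_av[OF L2W_integrable(3)[OF f]]
      mart_av[OF L2W_integrable(1)[OF f]] pd_V psd_W energy_tree[OF f] A2_form _ _ _ C])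
    show "0 \<le> A" "0 < k * A * Q" using A Q k0 by auto
    show "tsum (\<lambda>I. (av W I *v (dif (av V) I *v e)) \<bullet> (dif (av V) I *v e)) h I
      \<le> k * A * Q * ((av V I *v e) \<bullet> e)" for h I e
      using carleson_condition[of e h I] by (simp add: k_def)
  qed
  also have "\<dots> \<le> (upper_const TYPE('n) C * (A * Q)) * av (energy f) []"
  proof (rule mult_right_mono[OF _ e0])
    have "4 * A \<le> 4 * (A * Q)" using A Q by (simp add: mult_le_cancel_left1)
    then show "4 * A + 2 * (real CARD('n) + 1)^3 * C\<^sup>2 * (k * A * Q) \<le> upper_const TYPE('n) C * (A * Q)"
      by (simp add: upper_const_def k_def algebra_simps)
  qed
  finally show ?thesis .
qed

lemma square_fun_in_L2:
  assumes "interp_const TYPE('n) C" "f \<in> L2W W"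
  shows "square_fun W f \<in> L2"
  by (rule square_fun_L2(1)[OF L2W_integrable(3)[OF assms(2)] square_sum_bound[OF assms]])

lemma L2_norm_square_fun:
  assumes C: "interp_const TYPE('n) C" and f: "f \<in> L2W W"
  shows "L2_norm (square_fun W f) = esqrt (SUP h. ennreal (square_sum f h))"
  unfolding L2_norm_def
    square_fun_L2(2)[OF L2W_integrable(3)[OF f] square_sum_bound[OF C f]] ..

lemma square_fun_norm_le:
  assumes C: "interp_const TYPE('n) C"
  shows "square_fun_norm W \<le> ennreal (sqrt (upper_const TYPE('n) C * (A * Q)))"
  unfolding square_fun_norm_def
proof (rule Inf_lower, safe)
  fix f assume f: "f \<in> L2W W"
  have G: "0 \<le> upper_const TYPE('n) C * (A * Q)"
    using A_nonneg Q_nonneg by (intro mult_nonneg_nonneg) (auto simp: upper_const_def)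
  have e0: "0 \<le> av (energy f) []"
    using av_mono[OF set_integrable_const[of 0] L2W_integrable(1)[OF f] AE_energy_nonneg, of "[]"] by (simp add: av_eq)
  have "L2_norm (square_fun W f) \<le> esqrt (ennreal (upper_const TYPE('n) C * (A * Q) * av (energy f) []))"
    unfolding L2_norm_square_fun[OF C f] by (intro esqrt_mono SUP_least ennreal_leI square_sum_bound C f)
  also have "\<dots> = ennreal (sqrt (upper_const TYPE('n) C * (A * Q))) * L2W_norm W f"
    unfolding L2W_integrable(2)[OF f] esqrt_ennreal[OF mult_nonneg_nonneg[OF G e0]] real_sqrt_mult[of _ "av (energy f) []"]
    by (rule ennreal_mult) (use G e0 in auto)
  finally show "L2_norm (square_fun W f) \<le> ennreal (sqrt (upper_const TYPE('n) C * (A * Q))) * L2W_norm W f" .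
qed

text \<open>The least constant is attained, so single functions bound the operator norm from below.\<close>

lemma square_fun_norm_lower:
  assumes K: "square_fun_norm W \<le> ennreal K" "0 \<le> K" and f: "f \<in> L2W W" and e: "0 < av (energy f) []"
  shows "square_sum f h \<le> K\<^sup>2 * av (energy f) []"
proof -
  obtain C where C: "interp_const TYPE('n) C" using interp_const_exists by blast
  define T where "T = square_sum f h"
  define E where "E = av (energy f) []"
  have "ennreal (sqrt \<bar>T\<bar> / sqrt E) \<le> square_fun_norm W" if "0 \<le> T"
    unfolding square_fun_norm_def
  proof (rule Inf_greatest, safe)
    fix k :: ennreal assume k: "\<forall>f\<in>L2W W. L2_norm (square_fun W f) \<le> k * L2W_norm W f"
    have "ennreal (sqrt \<bar>T\<bar>) \<le> L2_norm (square_fun W f)"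
      using that unfolding L2_norm_square_fun[OF C f] T_def
      by (subst esqrt_ennreal[symmetric]) (auto intro!: esqrt_mono SUP_upper)
    also have "\<dots> \<le> k * ennreal (sqrt E)" using k[rule_format, OF f] unfolding L2W_integrable(2)[OF f] E_def .
    finally have le: "ennreal (sqrt \<bar>T\<bar>) \<le> k * ennreal (sqrt E)" .
    show "ennreal (sqrt \<bar>T\<bar> / sqrt E) \<le> k"
    proof (cases k)
      case (real c)
      then have "ennreal (sqrt \<bar>T\<bar>) \<le> ennreal (c * sqrt E)" using le e by (simp add: ennreal_mult E_def)
      then have "sqrt \<bar>T\<bar> \<le> c * sqrt E" using real e by (simp add: ennreal_le_iff E_def)
      then show ?thesis using real e by (simp add: ennreal_leI divide_le_eq E_def)
    qed simp
  qed
  then have "sqrt T \<le> K * sqrt E" if "0 \<le> T"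
    using that K e order_trans[OF _ K(1)] by (fastforce simp: ennreal_le_iff[OF K(2)] divide_le_eq E_def)
  then have "T \<le> K\<^sup>2 * E"
  proof (cases "0 \<le> T")
    case True
    then have "(sqrt T)\<^sup>2 \<le> (K * sqrt E)\<^sup>2" using \<open>0 \<le> T \<Longrightarrow> sqrt T \<le> K * sqrt E\<close> by (intro power_mono) auto
    then show ?thesis using True e by (simp add: power_mult_distrib E_def)
  next
    case False
    have "0 \<le> K\<^sup>2 * E" using e by (simp add: E_def)
    then show ?thesis using False by linarith
  qed
  then show ?thesis by (simp add: T_def E_def)
qed

end

section \<open>Geometric step weights\<close>

text \<open>\<open>lev x = n\<close> for \<open>x\<close> between \<open>2\<^sup>-\<^sup>n\<^sup>-\<^sup>1\<close> and \<open>2\<^sup>-\<^sup>n\<close>.\<close>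

definition lev :: "real \<Rightarrow> nat" where
  "lev x = nat \<lfloor>- log 2 x\<rfloor>"

definition step :: "real \<Rightarrow> real \<Rightarrow> real" where
  "step q x = q ^ lev x"

abbreviation spine :: "nat \<Rightarrow> bool list" where
  "spine n \<equiv> replicate n False"

lemma pos_spine: "pos (spine n) = 0"
  by (induction n) auto

lemma dint_spine: "dint (spine n) = {0..1 / 2 ^ n}"
  by (simp add: dint_def pos_spine)

lemma dint_True_spine: "dint (True # spine n) = {1 / 2 ^ Suc n..1 / 2 ^ n}"
  by (simp add: dint_def pos_spine field_simps)

lemma lev_eq:
  assumes "1 / 2 ^ Suc n < x" "x \<le> 1 / 2 ^ n"
  shows "lev x = n"
proof -
  have x: "0 < x" using assms(1) by (rule less_trans[rotated]) simp
  have l: "log 2 (1 / 2 ^ k) = - real k" for k :: nat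
    using log_inverse[of 2 "2 ^ k"] log_nat_power[of 2 2 k] by (simp add: inverse_eq_divide)
  have 1: "real n \<le> - log 2 x" using assms x l[of n] log_le_cancel_iff[of 2 x "1 / 2 ^ n"] by simp
  have 2: "- log 2 x < real n + 1"
    using assms x l[of "Suc n"] log_less_cancel_iff[of 2 "1 / 2 ^ Suc n" x] by simp
  have "\<lfloor>- log 2 x\<rfloor> = int n" by (rule floor_unique) (use 1 2 in auto)
  then show ?thesis by (simp add: lev_def)
qed

lemma lev_dint: "x \<in> dint (True # spine n) \<Longrightarrow> x \<notin> dyadic_pts \<Longrightarrow> lev x = n"
proof (rule lev_eq)
  assume x: "x \<in> dint (True # spine n)" "x \<notin> dyadic_pts"
  have "real 1 / 2 ^ Suc n \<in> dyadic_pts" unfolding dyadic_pts_def by (rule range_eqI[of _ _ "(1, Suc n)"]) simp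
  then have "x \<noteq> 1 / 2 ^ Suc n" using x(2) by (metis of_nat_1)
  moreover have "1 / 2 ^ Suc n \<le> x \<and> x \<le> 1 / 2 ^ n" using x(1) unfolding dint_True_spine by simp
  ultimately show "1 / 2 ^ Suc n < x" "x \<le> 1 / 2 ^ n" by argo+
qed

lemma dint_lev:
  assumes "x \<in> dint (spine n)" "x \<notin> dyadic_pts"
  shows "\<exists>k. x \<in> dint (True # spine (n + k))"
proof -
  have "real 0 / 2 ^ 0 \<in> dyadic_pts" unfolding dyadic_pts_def by (rule range_eqI[of _ _ "(0, 0)"]) simp
  then have "x \<noteq> 0" using assms(2) by (metis div_0 of_nat_0)
  moreover have "0 \<le> x \<and> x \<le> 1 / 2 ^ n" using assms(1) unfolding dint_spine by simp
  ultimately have x: "0 < x" "x \<le> 1 / 2 ^ n" by argo+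
  obtain m where "(1/2) ^ m < x" using real_arch_pow_inv[of x "1/2"] x by auto
  then have ex: "\<exists>m. x > 1 / 2 ^ m" by (auto simp: power_one_over)
  define m where "m = (LEAST m. x > 1 / 2 ^ m)"
  have m: "x > 1 / 2 ^ m" unfolding m_def using ex by (rule LeastI_ex)
  have "n < m"
  proof (rule ccontr)
    assume "\<not> n < m"
    then have "(1::real) / 2 ^ n \<le> 1 / 2 ^ m" by (intro divide_left_mono power_increasing) auto
    then show False using m x by simp
  qed
  then obtain j where j: "m = Suc j" "n \<le> j" by (cases m) auto
  have "\<not> x > 1 / 2 ^ j" using not_less_Least[of j "\<lambda>m. x > 1 / 2 ^ m"] j by (simp add: m_def)
  then have "x \<in> dint (True # spine j)" using m j by (simp add: dint_True_spine)
  then show ?thesis using j by (intro exI[of _ "j - n"]) simp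
qed

lemma spine_append: "spine k @ spine n = spine (n + k)"
  by (simp add: replicate_add[symmetric] add.commute)

lemma measurable_step [measurable]: "step q \<in> borel_measurable borel"
  unfolding step_def[abs_def] lev_def[abs_def] by measurable

lemma nn_integral_step:
  assumes q: "0 < q" "q < 2"
  shows "(\<integral>\<^sup>+x\<in>dint (spine n). ennreal (step q x) \<partial>lebesgue) = ennreal ((q/2) ^ n / (2 - q))"
proof -
  let ?t = "\<lambda>k x. ennreal (q ^ (n + k)) * indicator (dint (True # spine (n + k))) x"
  have "(\<integral>\<^sup>+x\<in>dint (spine n). ennreal (step q x) \<partial>lebesgue) = (\<integral>\<^sup>+x. (\<Sum>k. ?t k x) \<partial>lebesgue)"
  proof (rule nn_integral_cong_AE)
    show "AE x in lebesgue. ennreal (step q x) * indicator (dint (spine n)) x = (\<Sum>k. ?t k x)"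
      using AE_not_dyadic_pt
    proof eventually_elim
      case (elim x)
      show ?case
      proof (cases "x \<in> dint (spine n)")
        case True
        then obtain k where k: "x \<in> dint (True # spine (n + k))" using dint_lev elim by blast
        have "(\<Sum>j. ?t j x) = (\<Sum>j\<in>{k}. ?t j x)"
        proof (rule suminf_finite)
          fix j assume "j \<notin> {k}"
          then have "x \<notin> dint (True # spine (n + j))"
            using lev_dint[of x "n + j"] lev_dint[OF k elim] elim by auto
          then show "?t j x = 0" by simp
        qed simp
        then show ?thesis using True k lev_dint[OF k elim] by (simp add: step_def)
      next
        case False
        have "dint (True # spine (n + k)) \<subseteq> dint (spine n)" for k
          using dint_append_subset[of "True # spine k" "spine n"] by (simp add: spine_append)
        then have "?t k x = 0" for k using False by (auto simp: indicator_def)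
        then have "(\<Sum>k. ?t k x) = (\<Sum>k. 0)" by (intro suminf_cong)
        then show ?thesis using False by simp
      qed
    qed
  qed
  also have "\<dots> = (\<Sum>k. \<integral>\<^sup>+x. ?t k x \<partial>lebesgue)"
    by (rule nn_integral_suminf) (intro borel_measurable_times_ennreal borel_measurable_const borel_measurable_indicator dint_sets)
  also have "\<dots> = (\<Sum>k. ennreal ((q/2) ^ n / 2 * (q/2) ^ k))"
  proof (rule suminf_cong)
    fix k
    have "(\<integral>\<^sup>+x. ?t k x \<partial>lebesgue) = ennreal (q ^ (n + k)) * ennreal (1 / 2 ^ Suc (n + k))"
      by (simp add: nn_integral_cmult_indicator emeasure_dint)
    also have "\<dots> = ennreal (q ^ (n + k) * (1 / 2 ^ Suc (n + k)))"
      using q by (intro ennreal_mult[symmetric]) auto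
    also have "q ^ (n + k) * (1 / 2 ^ Suc (n + k)) = (q/2) ^ n / 2 * (q/2) ^ k"
      by (simp add: power_add power_divide)
    finally show "(\<integral>\<^sup>+x. ?t k x \<partial>lebesgue) = ennreal ((q/2) ^ n / 2 * (q/2) ^ k)" .
  qed
  also have "\<dots> = ennreal ((q/2) ^ n / (2 - q))"
  proof (rule suminf_ennreal_eq)
    have "(\<lambda>k. (q/2) ^ n / 2 * (q/2) ^ k) sums ((q/2) ^ n / 2 * (1 / (1 - q/2)))"
      using q by (intro sums_mult geometric_sums) auto
    moreover have "(q/2) ^ n / 2 * (1 / (1 - q/2)) = (q/2) ^ n / (2 - q)" using q by (simp add: field_simps)
    ultimately show "(\<lambda>k. (q/2) ^ n / 2 * (q/2) ^ k) sums ((q/2) ^ n / (2 - q))" by simp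
  qed (use q in auto)
  finally show ?thesis .
qed

lemma step_pos: "0 < q \<Longrightarrow> 0 < step q x" by (simp add: step_def)

lemma step_integrable:
  assumes q: "0 < q" "q < 2"
  shows "set_integrable lebesgue {0..1} (step q)"
  unfolding set_integrable_def integrable_iff_bounded
proof
  show "(\<lambda>x. indicator {0..1} x *\<^sub>R step q x) \<in> borel_measurable lebesgue"
    by (rule measurable_completion) measurable
  have "(\<integral>\<^sup>+x. ennreal (norm (indicator {0..1} x *\<^sub>R step q x)) \<partial>lebesgue) = (\<integral>\<^sup>+x\<in>dint (spine 0). ennreal (step q x) \<partial>lebesgue)"
    using step_pos[OF q(1)] by (intro nn_integral_cong) (auto simp: dint_Nil indicator_def less_imp_le)
  then show "(\<integral>\<^sup>+x. ennreal (norm (indicator {0..1} x *\<^sub>R step q x)) \<partial>lebesgue) < \<infinity>"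
    unfolding nn_integral_step[OF q] by simp
qed

lemma av_step_spine:
  assumes q: "0 < q" "q < 2"
  shows "av (step q) (spine n) = q ^ n / (2 - q)"
proof -
  have "ennreal (av (step q) (spine n) / 2 ^ n) = ennreal ((q/2) ^ n / (2 - q))"
    using nn_integral_dint[OF step_integrable[OF q], of "spine n"] nn_integral_step[OF q, of n] step_pos[OF q(1)]
    by (simp add: less_imp_le)
  moreover have "0 < av (step q) (spine n)" by (rule av_pos[OF step_integrable[OF q]]) (simp add: step_pos q)
  ultimately have "av (step q) (spine n) / 2 ^ n = (q/2) ^ n / (2 - q)" using q by simp
  then have "av (step q) (spine n) = 2 ^ n * ((q/2) ^ n / (2 - q))" by (simp add: divide_eq_eq mult.commute)
  then show ?thesis by (simp add: power_divide)
qed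

lemma av_const_on:
  fixes g :: "real \<Rightarrow> real"
  assumes "AE x in lebesgue. x \<in> dint I \<longrightarrow> g x = c"
  shows "av g I = c"
proof -
  have "(LINT x:dint I|lebesgue. g x) = (LINT x:dint I|lebesgue. c)"
    unfolding set_lebesgue_integral_def
  proof (rule integral_cong_AE)
    have eq: "AE x in lebesgue. indicator (dint I) x *\<^sub>R c = indicator (dint I) x *\<^sub>R g x"
      using assms by (auto simp: indicator_def elim!: eventually_mono)
    show m: "(\<lambda>x. indicator (dint I) x *\<^sub>R c) \<in> borel_measurable lebesgue"
      by (intro borel_measurable_scaleR borel_measurable_indicator borel_measurable_const dint_sets)
    show "(\<lambda>x. indicator (dint I) x *\<^sub>R g x) \<in> borel_measurable lebesgue"
      by (rule borel_measurable_lebesgue_AE[OF m eq])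
    show "AE x in lebesgue. indicator (dint I) x *\<^sub>R g x = indicator (dint I) x *\<^sub>R c"
      using eq by eventually_elim auto
  qed
  then show ?thesis by (simp add: av_eq set_lebesgue_integral_def measure_dint)
qed

lemma av_step_off_spine: "av (step q) (K @ True # spine n) = q ^ n"
proof (rule av_const_on)
  show "AE x in lebesgue. x \<in> dint (K @ True # spine n) \<longrightarrow> step q x = q ^ n"
    using AE_not_dyadic_pt
    by eventually_elim (use dint_append_subset[of K "True # spine n"] lev_dint in \<open>auto simp: step_def\<close>)
qed

text \<open>Either \<open>I\<close> starts at 0, or it lies in one of the intervals on which the step functions are constant.\<close>

lemma spine_cases:
  obtains n where "I = spine n" | K n where "I = K @ True # spine n"
proof (induction I arbitrary: thesis)
  case Nil
  then show ?case using Nil(1)[of 0] by simp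
next
  case (Cons b I)
  show ?case
  proof (rule Cons.IH)
    fix n assume I: "I = spine n"
    show thesis
    proof (cases b)
      case True then show ?thesis using Cons.prems(2)[of "[]" n] I by simp
    next
      case False then show ?thesis using Cons.prems(1)[of "Suc n"] I by simp
    qed
  next
    fix K n assume "I = K @ True # spine n"
    then show thesis using Cons.prems(2)[of "b # K" n] by simp
  qed
qed

section \<open>Sharpness\<close>

lemma scalar_matrix_vector: "(c *\<^sub>R mat 1) *v x = c *\<^sub>R (x :: complex^'n::finite)"
  by (simp add: matrix_vector_simps)

lemma scalar_matrix_mult: "(a *\<^sub>R mat 1) ** (b *\<^sub>R mat 1) = (a * b) *\<^sub>R (mat 1 :: complex^'n::finite^'n)"
  by (subst matrix_eq) (simp add: scalar_matrix_vector flip: matrix_vector_mul_assoc)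

lemma psd_scalar_matrix: "0 \<le> c \<Longrightarrow> psd (c *\<^sub>R (mat 1 :: complex^'n::finite^'n))"
  by (rule psd_scaleR[OF psd_1])

lemma msqrt_scalar_matrix: "0 \<le> c \<Longrightarrow> msqrt (c *\<^sub>R mat 1) = sqrt c *\<^sub>R (mat 1 :: complex^'n::finite^'n)"
  by (rule psd_sqrt_unique)
     (simp_all add: msqrt_psd msqrt_square psd_scalar_matrix scalar_matrix_mult)

lemma opnorm_scalar_matrix: "opnorm (c *\<^sub>R (mat 1 :: complex^'n::finite^'n)) = \<bar>c\<bar>"
  unfolding opnorm_def scalar_matrix_vector
  using onorm_scaleR[OF bounded_linear_ident[where 'a = "complex^'n"], of c] by (simp add: onorm_id)

lemma invertible_scalar_matrix: "c \<noteq> 0 \<Longrightarrow> invertible (c *\<^sub>R (mat 1 :: complex^'n::finite^'n))"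
  unfolding invertible_def by (rule exI[of _ "(1/c) *\<^sub>R mat 1"]) (simp add: scalar_matrix_mult)

lemma inverse_scalar_matrix:
  assumes "c \<noteq> 0"
  shows "matrix_inv (c *\<^sub>R (mat 1 :: complex^'n::finite^'n)) = (1/c) *\<^sub>R mat 1"
proof -
  have "(1/c) *\<^sub>R (mat 1 :: complex^'n^'n) ** (c *\<^sub>R mat 1 ** matrix_inv (c *\<^sub>R mat 1)) = (1/c) *\<^sub>R mat 1"
    by (simp add: matrix_inv_mult(1)[OF invertible_scalar_matrix[OF assms]])
  then show ?thesis using assms by (simp add: matrix_mul_assoc scalar_matrix_mult)
qed

lemma tsum_nonneg: "(\<And>I. 0 \<le> a I) \<Longrightarrow> 0 \<le> (tsum a h I :: real)"
  by (induction h arbitrary: I) (auto intro!: add_nonneg_nonneg)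

lemma tsum_spine:
  assumes a: "\<And>I. 0 \<le> (a I :: real)"
  shows "(\<Sum>k<h. a (spine (m + k)) / 2 ^ k) \<le> tsum a h (spine m)"
proof (induction h arbitrary: m)
  case (Suc h)
  have "(\<Sum>k<Suc h. a (spine (m + k)) / 2 ^ k) = a (spine m) + (1/2) * (\<Sum>k<h. a (spine (Suc m + k)) / 2 ^ k)"
    by (subst sum.lessThan_Suc_shift) (simp add: sum_distrib_left)
  also have "\<dots> \<le> a (spine m) + (1/2) * tsum a h (spine (Suc m))" using Suc[of "Suc m"] by simp
  also have "\<dots> \<le> tsum a (Suc h) (spine m)" using tsum_nonneg[where a = a and h = h and I = "True # spine m", OF a] by simp
  finally show ?case .
qed simp

definition step_weight :: "real \<Rightarrow> real \<Rightarrow> complex^'n::finite^'n" where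
  "step_weight r x = step (1/r) x *\<^sub>R mat 1"

lemma step_inverse: "0 < r \<Longrightarrow> 1 / step (1/r) x = step r x"
  by (simp add: step_def power_one_over)

lemma linear_scalar: "linear (\<lambda>c. c *\<^sub>R (m :: 'a::real_vector))"
  by (intro linearI) (simp_all add: scaleR_left_distrib)

text \<open>On intervals starting at 0 the product of the averages of \<open>W\<close> and of its inverse does not depend on the
  interval, by self-similarity; on all other dyadic intervals the weight is constant.\<close>

lemma step_weight_A2:
  fixes r t :: real
  assumes r: "1 \<le> r" "r < 2" and t: "1 \<le> t" "t * ((2 - r) * (2 * r - 1)) = r"
  shows "matrix_weight (step_weight r :: real \<Rightarrow> complex^'n::finite^'n)"
    "A2_char (step_weight r :: real \<Rightarrow> complex^'n^'n) = ennreal t"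
    "inv_weight (step_weight r :: real \<Rightarrow> complex^'n^'n) = (\<lambda>x. step r x *\<^sub>R mat 1)"
    "av (step_weight r :: real \<Rightarrow> complex^'n^'n) I = av (step (1/r)) I *\<^sub>R mat 1"
proof -
  let ?W = "step_weight r :: real \<Rightarrow> complex^'n^'n"
  have q: "0 < 1/r" "1/r < 2" "0 < r" "r < 2" using r by (auto simp: field_simps)
  note si = step_integrable[OF q(1,2)] step_integrable[OF q(3,4)]
  have av_W: "av ?W J = av (step (1/r)) J *\<^sub>R mat 1" for J
    unfolding step_weight_def[abs_def] by (rule av_linear(2)[OF si(1) linear_scalar])
  then show "av ?W I = av (step (1/r)) I *\<^sub>R mat 1" .
  have W_int: "set_integrable lebesgue {0..1} ?W"
    unfolding step_weight_def[abs_def] by (rule av_linear(1)[OF si(1) linear_scalar])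
  have sp: "0 < step (1/r) x" "0 < step r x" for x using q by (auto intro: step_pos)
  have psd: "psd (?W x)" for x unfolding step_weight_def using sp by (intro psd_scalar_matrix less_imp_le)
  have inv: "invertible (?W x)" for x
    unfolding step_weight_def using sp(1)[of x] by (intro invertible_scalar_matrix) simp
  show "matrix_weight ?W" using W_int psd by (simp add: matrix_weight_def)
  have V: "inv_weight ?W = (\<lambda>x. step r x *\<^sub>R mat 1)"
  proof
    fix x
    show "inv_weight ?W x = step r x *\<^sub>R mat 1"
      unfolding inv_weight_def step_weight_def
      using sp(1)[of x] by (simp add: inverse_scalar_matrix step_inverse[OF q(3)])
  qed
  then show "inv_weight ?W = (\<lambda>x. step r x *\<^sub>R mat 1)" .
  have V_int: "set_integrable lebesgue {0..1} (inv_weight ?W)"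
    unfolding V by (rule av_linear(1)[OF si(2) linear_scalar])
  have av_V: "av (inv_weight ?W) J = av (step r) J *\<^sub>R mat 1" for J
    unfolding V by (rule av_linear(2)[OF si(2) linear_scalar])
  have ap: "0 < av (step (1/r)) J" "0 < av (step r) J" for J
    using sp by (auto intro!: av_pos si)
  have val: "(opnorm (msqrt (avg (dint J) ?W) ** msqrt (avg (dint J) (inv_weight ?W))))\<^sup>2 = av (step (1/r)) J * av (step r) J" for J
    using ap[of J]
    by (simp add: av_def[symmetric] av_W av_V msqrt_scalar_matrix scalar_matrix_mult opnorm_scalar_matrix
        less_imp_le power_mult_distrib)
  have spine_val: "av (step (1/r)) (spine n) * av (step r) (spine n) = t" for n
  proof -
    have "t = r / ((2 - r) * (2 * r - 1))" using t(2) r by (simp add: eq_divide_eq)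
    moreover have "(1/r) ^ n / (2 - 1/r) * (r ^ n / (2 - r)) = r / ((2 - r) * (2 * r - 1))"
    proof -
      have "(1/r) ^ n * r ^ n = 1" using r by (simp add: power_one_over)
      then have "(1/r) ^ n / (2 - 1/r) * (r ^ n / (2 - r)) = 1 / ((2 - 1/r) * (2 - r))" by simp
      also have "(2 - 1/r) * (2 - r) = (2 - r) * (2 * r - 1) / r" using r by (simp add: field_simps)
      finally show ?thesis by simp
    qed
    ultimately show ?thesis unfolding av_step_spine[OF q(1,2)] av_step_spine[OF q(3,4)] by simp
  qed
  have le: "av (step (1/r)) J * av (step r) J \<le> t" for J
  proof (cases J rule: spine_cases)
    case (1 n)
    then show ?thesis by (simp add: spine_val)
  next
    case (2 K n)
    then show ?thesis using t(1) r by (simp add: av_step_off_spine power_one_over)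
  qed
  have "A2_char ?W = (SUP J. ennreal (av (step (1/r)) J * av (step r) J))"
    unfolding A2_char_def using inv V_int by (simp add: dyadic_eq val image_image)
  also have "\<dots> = ennreal t"
  proof (rule antisym)
    show "(SUP J. ennreal (av (step (1/r)) J * av (step r) J)) \<le> ennreal t"
      by (intro SUP_least ennreal_leI le)
    show "ennreal t \<le> (SUP J. ennreal (av (step (1/r)) J * av (step r) J))"
      by (rule SUP_upper2[of "spine 0"]) (simp_all only: spine_val UNIV_I order_refl)
  qed
  finally show "A2_char ?W = ennreal t" .
qed

text \<open>The test function is \<open>v e\<close> on the left half. Cutting off the right half creates a jump at the top
  interval; it gives a lower bound of order \<open>t\<close> for the square of the norm, enough when \<open>r\<close> is near 1. When
  \<open>r\<close> is near 2, the intervals starting at 0 contribute a geometric series of ratio \<open>r/2\<close>, of order \<open>t\<^sup>2\<close>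
  relative to the energy.\<close>

lemma step_weight_lower_bound:
  fixes r t K :: real
  assumes r: "1 \<le> r" "r < 2" and t: "1 \<le> t" "t * ((2 - r) * (2 * r - 1)) = r"
    and K: "square_fun_norm (step_weight r :: real \<Rightarrow> complex^'n::finite^'n) \<le> ennreal K" "0 \<le> K"
  shows "t / 2 \<le> K"
proof -
  define W :: "real \<Rightarrow> complex^'n^'n" where "W = step_weight r"
  note facts = step_weight_A2[OF r t, where 'n = 'n]
  interpret A2_weight W
    by unfold_locales (simp_all add: W_def facts(1,2))
  have q: "0 < 1/r" "1/r < 2" "0 < r" "r < 2" using r by (auto simp: field_simps)
  note si = step_integrable[OF q(3,4)]
  obtain e :: "complex^'n" where e: "norm e = 1" using vector_choose_size[of 1] by auto
  then have ee: "e \<bullet> e = 1" by (simp add: norm_eq_1)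
  define g where "g x = indicator (dint [False]) x * step r x" for x
  define f where "f x = g x *\<^sub>R e" for x
  have step1: "step (1/r) x * step r x = 1" for x
    using r by (simp add: step_def flip: power_mult_distrib)
  have en: "energy f = g"
  proof
    fix x
    have "energy f x = step (1/r) x * (g x)\<^sup>2"
      unfolding energy_def by (simp add: f_def W_def step_weight_def scalar_matrix_vector ee power2_eq_square)
    also have "\<dots> = g x"
      using step1[of x] by (auto simp: g_def indicator_def power2_eq_square)
    finally show "energy f x = g x" .
  qed
  have g_int: "set_integrable lebesgue {0..1} g"
  proof -
    have "integrable lebesgue (\<lambda>x. indicator (dint [False]) x *\<^sub>R (indicator {0..1} x *\<^sub>R step r x))"
      using si unfolding set_integrable_def by (rule integrable_mult_indicator[OF dint_sets])
    moreover have "indicator (dint [False]) x *\<^sub>R (indicator {0..1} x *\<^sub>R step r x) = indicator {0..1} x *\<^sub>R g x" for x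
      by (simp add: g_def)
    ultimately show ?thesis unfolding set_integrable_def by (simp only:)
  qed
  have f_int: "set_integrable lebesgue {0..1} f" and av_f: "av f I = av g I *\<^sub>R e" for I
    unfolding f_def[abs_def] by (rule av_linear[OF g_int linear_scalar])+
  have f: "f \<in> L2W W"
  proof -
    have "f \<in> borel_measurable (lebesgue_on {0..1})"
      using f_int unfolding set_integrable_def
      by (subst borel_measurable_restrict_space_iff) (auto dest: borel_measurable_integrable)
    moreover have "L2W_norm W f < \<top>"
    proof -
      have "(\<integral>\<^sup>+x\<in>{0..1}. ennreal (energy f x) \<partial>lebesgue) = ennreal (av g [] / 2 ^ length [])"
        using nn_integral_dint[OF g_int, of "[]"] step_pos[OF q(3)]
        by (simp add: en dint_Nil g_def less_imp_le)
      then show ?thesis unfolding L2W_norm_def nn_integral_L2W by (simp add: esqrt_def)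
    qed
    ultimately show ?thesis by (simp add: L2W_def)
  qed
  have g_left: "av g (K @ [False]) = av (step r) (K @ [False])" for K
  proof -
    have "x \<in> dint (K @ [False]) \<Longrightarrow> x \<in> dint [False]" for x using dint_append_subset by blast
    then have "(LINT x:dint (K @ [False])|lebesgue. g x) = (LINT x:dint (K @ [False])|lebesgue. step r x)"
      unfolding set_lebesgue_integral_def by (intro Bochner_Integration.integral_cong refl) (auto simp: g_def indicator_def)
    then show ?thesis by (simp add: av_eq)
  qed
  have g_spine: "av g (spine (Suc n)) = r ^ Suc n / (2 - r)" for n
    using g_left[of "spine n"] av_step_spine[OF q(3,4), of "Suc n"] by (simp add: replicate_append_same)
  have g_off: "av g (True # spine (Suc n)) = r ^ Suc n" for n
    using g_left[of "True # spine n"] av_step_off_spine[of r "[]" "Suc n"] by (simp add: replicate_append_same)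
  have g_right: "av g [True] = 0"
    by (rule av_const_on) (use AE_not_dyadic_pt in \<open>eventually_elim, use dint_Cons_disjoint[of _ True "[]" False] in \<open>auto simp: g_def indicator_def\<close>\<close>)
  have "av g [] = (av g [False] + av g [True]) / 2"
    using mart_av[OF g_int] unfolding mart_real by (rule spec)
  also have "\<dots> = r / (2 * (2 - r))" using g_spine[of 0] g_right by simp
  finally have E: "av g [] = r / (2 * (2 - r))" .
  have E0: "0 < av g []" using r by (simp add: E)
  define a where "a I = (av W I *v dif (av f) I) \<bullet> dif (av f) I" for I
  have a_eq: "a I = av (step (1/r)) I * (dif (av g) I)\<^sup>2" for I
    by (simp add: a_def W_def facts(4) scalar_matrix_vector dif_def av_f ee power2_eq_square
        flip: scaleR_diff_left)
  have a0: "0 \<le> a I" for I unfolding a_def by (rule psd_nonneg[OF psd_W])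
  have bound: "tsum a h [] \<le> K\<^sup>2 * (r / (2 * (2 - r)))" for h
    using square_fun_norm_lower[OF K[folded W_def] f, of h] E0 by (simp add: a_def[abs_def] en E)
  have d: "2 - 1/r = (2 * r - 1) / r" using r by (simp add: field_simps)
  have "(t/2)\<^sup>2 \<le> K\<^sup>2"
  proof (cases "r \<le> 3/2")
    case True
    have "0 \<le> (r - 1) * (3 - 2 * r)" using True r by (intro mult_nonneg_nonneg) auto
    then have "1 \<le> (2 - r) * (2 * r - 1)" by (simp add: algebra_simps)
    then have "t * 1 \<le> t * ((2 - r) * (2 * r - 1))" using t by (intro mult_left_mono) auto
    then have t32: "t \<le> 3/2" using t True by simp
    have "a [] = (r / (2 * r - 1)) * (r / (2 * (2 - r)))\<^sup>2"
      using av_step_spine[OF q(1,2), of 0] g_spine[of 0] g_right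
      by (simp add: a_eq dif_def d power2_eq_square)
    moreover have "a [] \<le> K\<^sup>2 * (r / (2 * (2 - r)))" using bound[of 1] by (simp add: tsum_nonneg)
    ultimately have "(r / (2 * r - 1) * (r / (2 * (2 - r)))) * (r / (2 * (2 - r))) \<le> K\<^sup>2 * (r / (2 * (2 - r)))"
      by (simp only: power2_eq_square mult.assoc)
    then have "r / (2 * r - 1) * (r / (2 * (2 - r))) \<le> K\<^sup>2"
      by (rule mult_right_le_imp_le) (use r in simp)
    moreover have "r / (2 * r - 1) * (r / (2 * (2 - r))) = t * r / 2"
    proof -
      have "t = r / ((2 - r) * (2 * r - 1))" using t(2) r by (simp add: eq_divide_eq)
      then show ?thesis by simp
    qed
    ultimately have "t * r / 2 \<le> K\<^sup>2" by (simp only:)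
    moreover have "(t/2)\<^sup>2 \<le> t * r / 2"
    proof -
      have "t * t \<le> t * (2 * r)" using t t32 r by (intro mult_left_mono) auto
      then show ?thesis by (simp add: power2_eq_square)
    qed
    ultimately show ?thesis by simp
  next
    case False
    define \<beta> where "\<beta> = (r / (2 * r - 1)) * ((r - 1) / (2 - r))\<^sup>2"
    have \<beta>0: "0 \<le> \<beta>" using r by (simp add: \<beta>_def)
    have a_spine: "a (spine (Suc n)) = \<beta> * r ^ Suc n" for n
    proof -
      have "dif (av g) (spine (Suc n)) = (1/2) * (r ^ Suc n - r ^ Suc (Suc n) / (2 - r))"
        using g_spine[of "Suc n"] g_off[of n] by (simp add: dif_def)
      also have "\<dots> = - (r ^ Suc n * ((r - 1) / (2 - r)))" using r by (simp add: field_simps)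
      finally have "a (spine (Suc n)) = ((1/r) ^ Suc n * r ^ Suc n) * \<beta> * r ^ Suc n"
        by (simp only: a_eq av_step_spine[OF q(1,2)] d) (simp add: \<beta>_def power2_eq_square)
      also have "(1/r) ^ Suc n * r ^ Suc n = 1" using r by (simp only: power_mult_distrib[symmetric]) simp
      finally show ?thesis by simp
    qed
    have partial: "\<beta> * (r/2) * (\<Sum>k<h. (r/2) ^ k) \<le> K\<^sup>2 * (r / (2 * (2 - r)))" for h
    proof -
      have "\<beta> * (r/2) * (\<Sum>k<h. (r/2) ^ k) = (1/2) * (\<Sum>k<h. a (spine (Suc 0 + k)) / 2 ^ k)"
        by (simp add: a_spine[simplified] sum_distrib_left power_divide mult_ac)
      also have "\<dots> \<le> (1/2) * tsum a h (spine (Suc 0))" using tsum_spine[where a = a and h = h and m = "Suc 0", OF a0] by simp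
      also have "\<dots> \<le> tsum a (Suc h) []"
        using a0[of "[]"] tsum_nonneg[where a = a and h = h and I = "[True]", OF a0] by (simp add: field_simps)
      finally show ?thesis using bound[of "Suc h"] by (rule order_trans)
    qed
    have "(\<lambda>h. \<beta> * (r/2) * (\<Sum>k<h. (r/2) ^ k)) \<longlonglongrightarrow> \<beta> * (r/2) * (1 / (1 - r/2))"
      using geometric_sums[of "r/2"] r unfolding sums_def by (intro tendsto_mult tendsto_const) auto
    then have "\<beta> * (r/2) * (1 / (1 - r/2)) \<le> K\<^sup>2 * (r / (2 * (2 - r)))"
      by (rule LIMSEQ_le_const2) (use partial in blast)
    also have "\<beta> * (r/2) * (1 / (1 - r/2)) = (2 * \<beta>) * (r / (2 * (2 - r)))"
      using r by (simp add: field_simps)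
    finally have "2 * \<beta> \<le> K\<^sup>2" by (rule mult_right_le_imp_le) (use r in simp)
    moreover have "(t/2)\<^sup>2 \<le> 2 * \<beta>"
    proof -
      have teq: "t = r / ((2 - r) * (2 * r - 1))" using t(2) r by (simp add: eq_divide_eq)
      have "(1/2)\<^sup>2 \<le> (r - 1)\<^sup>2" using False by (intro power_mono) auto
      moreover have "1 \<le> (2 * r - 1) / r" using r by (simp add: le_divide_eq)
      ultimately have "1/4 * 1 \<le> (r - 1)\<^sup>2 * ((2 * r - 1) / r)"
        by (intro mult_mono) (auto simp: power2_eq_square)
      then have "t\<^sup>2 * (1/4) \<le> t\<^sup>2 * (2 * ((r - 1)\<^sup>2 * ((2 * r - 1) / r)))" by (intro mult_left_mono) auto
      also have "\<dots> = 2 * \<beta>" unfolding teq \<beta>_def using r by (simp add: power2_eq_square divide_simps)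
      finally show ?thesis by (simp add: power_divide)
    qed
    ultimately show ?thesis by simp
  qed
  then show ?thesis using K(2) by (rule power2_le_imp_le)
qed

lemma step_ratio_exists:
  assumes "1 \<le> t"
  shows "\<exists>r. 1 \<le> r \<and> r < 2 \<and> t * ((2 - r) * (2 * r - 1)) = (r :: real)"
proof -
  have "\<exists>r. 1 \<le> r \<and> r \<le> 2 \<and> t * ((2 - r) * (2 * r - 1)) - r = 0"
    by (rule IVT2') (use assms in \<open>auto intro!: continuous_intros\<close>)
  then obtain r where r: "1 \<le> r" "r \<le> 2" "t * ((2 - r) * (2 * r - 1)) = r" by auto
  then have "r \<noteq> 2" by auto
  then show ?thesis using r by (intro exI[of _ r]) auto
qed

theorem theorem1:
  shows "(\<exists>C::real. C > 0 \<and>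
            (\<forall>W :: real \<Rightarrow> complex ^ 'n::finite ^ 'n. matrix_weight W \<and> A2_char W < \<top> \<longrightarrow>
               (\<forall>f\<in>L2W W. square_fun W f \<in> L2) \<and>
               square_fun_norm W < \<top> \<and>
               square_fun_norm W
                 \<le> ennreal C * esqrt (A2_char W) * esqrt (Ainf_char (inv_weight W)) \<and>
               esqrt (A2_char W) * esqrt (Ainf_char (inv_weight W)) \<le> ennreal C * A2_char W \<and>
               square_fun_norm W \<le> ennreal (C\<^sup>2) * A2_char W)) \<and>
         (\<exists>c::real. c > 0 \<and>
            (\<forall>\<phi> :: real \<Rightarrow> real.
               (\<forall>t\<ge>1. 0 \<le> \<phi> t) \<and>
               (\<forall>W :: real \<Rightarrow> complex ^ 'n ^ 'n. matrix_weight W \<and> A2_char W < \<top> \<longrightarrow>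
                  square_fun_norm W \<le> ennreal (\<phi> (enn2real (A2_char W)))) \<longrightarrow>
               (\<forall>t\<ge>1. c * t \<le> \<phi> t)))"
proof (rule conjI, goal_cases)
  case 1
  obtain c where c: "interp_const TYPE('n) c" using interp_const_exists by blast
  define G where "G = upper_const TYPE('n) c"
  define C where "C = sqrt G + 2"
  have G0: "0 \<le> G" by (simp add: G_def upper_const_def)
  show ?case
  proof (intro exI[of _ C] conjI allI impI)
    have C2: "2 \<le> C" "sqrt G \<le> C" using G0 by (simp_all add: C_def)
    then show "0 < C" by simp
    fix W :: "real \<Rightarrow> complex ^ 'n ^ 'n"
    assume W: "matrix_weight W \<and> A2_char W < \<top>"
    interpret A2_weight W by unfold_locales (use W in auto)
    show "\<forall>f\<in>L2W W. square_fun W f \<in> L2" using square_fun_in_L2[OF c] by blast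
    have norm: "square_fun_norm W \<le> ennreal (sqrt (G * (A * Q)))"
      unfolding G_def by (rule square_fun_norm_le[OF c])
    then show "square_fun_norm W < \<top>" by (rule le_less_trans) simp
    have AQ: "esqrt (A2_char W) = ennreal (sqrt A)" "esqrt (Ainf_char (inv_weight W)) = ennreal (sqrt Q)"
      by (simp_all add: A2_char_eq Ainf_eq esqrt_ennreal A_nonneg Q_nonneg)
    have "sqrt (G * (A * Q)) \<le> C * sqrt A * sqrt Q"
      using C2 A_nonneg Q_nonneg by (simp add: real_sqrt_mult mult_right_mono mult.assoc)
    then have "ennreal (sqrt (G * (A * Q))) \<le> ennreal C * ennreal (sqrt A) * ennreal (sqrt Q)"
      using C2 A_nonneg Q_nonneg by (simp add: ennreal_mult[symmetric] ennreal_leI)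
    then show mixed: "square_fun_norm W \<le> ennreal C * esqrt (A2_char W) * esqrt (Ainf_char (inv_weight W))"
      unfolding AQ using norm by (rule order_trans[rotated])
    have "ennreal Q \<le> ennreal (5/2 * A)" using Ainf_le_A2 by (simp add: Ainf_eq)
    then have "Q \<le> 5/2 * A" using A_nonneg by (simp add: ennreal_le_iff)
    then have "A * Q \<le> A * (4 * A)" using A_nonneg by (intro mult_left_mono) auto
    then have "sqrt (A * Q) \<le> sqrt ((2 * A)\<^sup>2)" by (intro real_sqrt_le_mono) (simp add: power2_eq_square)
    also have "\<dots> = 2 * A" by (simp only: real_sqrt_abs) (use A_nonneg in simp)
    also have "\<dots> \<le> C * A" using C2 A_nonneg by (intro mult_right_mono) auto
    finally have "sqrt A * sqrt Q \<le> C * A" by (simp add: real_sqrt_mult)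
    then have "ennreal (sqrt A) * ennreal (sqrt Q) \<le> ennreal C * ennreal A"
      using C2 A_nonneg Q_nonneg by (simp add: ennreal_mult[symmetric] ennreal_leI)
    then show AQA: "esqrt (A2_char W) * esqrt (Ainf_char (inv_weight W)) \<le> ennreal C * A2_char W"
      unfolding AQ by (simp add: A2_char_eq)
    have "square_fun_norm W \<le> ennreal C * (esqrt (A2_char W) * esqrt (Ainf_char (inv_weight W)))"
      using mixed by (simp add: mult.assoc)
    also have "\<dots> \<le> ennreal C * (ennreal C * A2_char W)" by (intro mult_left_mono AQA) simp
    also have "\<dots> = ennreal (C\<^sup>2) * A2_char W"
      using C2 by (simp add: power2_eq_square ennreal_mult mult.assoc)
    finally show "square_fun_norm W \<le> ennreal (C\<^sup>2) * A2_char W" .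
  qed
next
  case 2
  show ?case
  proof (intro exI[of _ "1/2"] conjI allI impI)
    fix \<phi> :: "real \<Rightarrow> real" and t :: real
    assume \<phi>: "(\<forall>t\<ge>1. 0 \<le> \<phi> t) \<and>
       (\<forall>W :: real \<Rightarrow> complex ^ 'n ^ 'n. matrix_weight W \<and> A2_char W < \<top> \<longrightarrow>
          square_fun_norm W \<le> ennreal (\<phi> (enn2real (A2_char W))))" and t: "1 \<le> t"
    obtain r where r: "1 \<le> r" "r < 2" "t * ((2 - r) * (2 * r - 1)) = r"
      using step_ratio_exists[OF t] by blast
    note weight = step_weight_A2(1,2)[OF r(1,2) t r(3), where 'n = 'n]
    have "square_fun_norm (step_weight r :: real \<Rightarrow> complex^'n^'n) \<le> ennreal (\<phi> t)"
      using \<phi>[THEN conjunct2, rule_format, of "step_weight r"] weight t by simp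
    moreover have "0 \<le> \<phi> t" using \<phi> t by blast
    ultimately show "1/2 * t \<le> \<phi> t"
      using step_weight_lower_bound[OF r(1,2) t r(3)] by simp
  qed simp
qed

end
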